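(* Let $(\mathcal{X},d,\mu)$ be a non-homogeneous space with dominating function $\lambda$. Let $1<p<\infty$, $0<\delta<1$, $\phi\in\mathcal{G}^{dec}_\delta$, $\lambda\in\mathcal{R}_\sigma$ for some $\sigma\in(0,\delta/p)$, and let $T_\lambda$ be bounded on $L^2(\mu)$. Let $l\ge0$, $\rho>0$, $s\ge1$, and let $K_{l,\theta}$ be a $\theta$-type generalized Calderón–Zygmund kernel. Then the fractional type Marcinkiewicz integral operator $\widetilde{\mathcal{M}}_{l,\rho,s}$ with kernel $K_{l,\theta}$ is bounded on the generalized Morrey space $L^{p,\phi}$.
   Context: Non-homogeneous space: $(\mathcal{X},d)$ is a metric space with a Borel measure $\mu$ such that (i) (geometrically doubling) there is $N_0\in\mathbb{N}$ such that any ball $B(x,r)$ can be covered by at most $N_0$ balls $B(x_i,r/2)$; (ii) (upper doubling) there are a function $\lambda:\mathcal{X}\times(0,\infty)\to(0,\infty)$ (the dominating function), with $r\mapsto\lambda(x,r)$ non-decreasing for each $x$, and a constant $C_{(\lambda)}$ with $\mu(B(x,r))\le\lambda(x,r)\le C_{(\lambda)}\lambda(x,r/2)$ for all $x\in\mathcal{X}$, $r>0$. It is always assumed moreover that $\lambda(x,r)\le C_{(\lambda)}\lambda(y,r)$ whenever $d(x,y)\le r$. Every ball $B$ has a centre $c_B$ and radius $r_B$; $aB:=B(c_B,ar_B)$ for $a>0$; $\phi(B):=\phi(c_B,r_B)$. $A\lesssim B$ means $A\le CB$ with $C>0$ independent of the main parameters. $L_c^\infty(\mu)$ is the set of $L^\infty$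 functions supported on some ball. $\mathcal{G}^{dec}_\delta$ ($0<\delta<1$): the set of $\phi:\mathcal{X}\times(0,\infty)\to(0,\infty)$ such that for every $x$, $\lim_{r\to0^+}\phi(x,r)=+\infty$ and $\lim_{r\to+\infty}\phi(x,r)=0$, and for every $\eta>1$ there are positive constants $c_{(\phi,\eta)},C_{(\phi,\eta)}$ such that for all balls $B_1\subset B_2$: $\phi(B_1)(\mu(\eta B_1))^\delta\ge c_{(\phi,\eta)}\phi(B_2)(\mu(\eta B_2))^\delta$ and $\phi(B_1)\mu(\eta B_1)\le C_{(\phi,\eta)}\phi(B_2)\mu(\eta B_2)$. Generalized Morrey space $L^{p,\phi}$: the $f\in L^p_{loc}$ with $\|f\|_{L^{p,\phi}}:=\sup_B\big(\frac1{\phi(B)\mu(\eta B)}\int_B|f|^p\,d\mu\big)^{1/p}<\infty$, where $\eta\in(1,\infty)$ is fixed (the space is independent of $\eta$). $\sigma$-weak reverse doubling, $\lambda\in\mathcal{R}_\sigma$ ($\sigma\in(0,\infty)$): there are positive constants $C_{(a)}$ depending only on $a$ and $\mathcal{X}$ such that for any $x\in\mathcal{X}$, $0<r<2\operatorname{diam}(\mathcal{X})$ and $1<a<2\operatorname{diam}(\mathcal{X})/r$, $C_{(a)}\lambda(x,r)\le\lambda(x,ar)$, and $\sum_{j=1}^\infty C_{(a^j)}^{-\sigma}<\infty$. $T_\lambda(f)(x):=\int_{\mathcal{X}}\frac{f(y)}{\lambda(x,d(x,y))}\,d\mu(y)$ for $f\in L_c^\infty(\mu)$, $x\notin\operatorname{supp}f$.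 Kernel: let $l\ge0$ and let $\theta:(0,\infty)\to[0,\infty)$ be non-decreasing with $\int_0^1\frac{\theta(t)}t\log\frac1t\,dt<\infty$. A locally integrable $K_{l,\theta}$ on $\mathcal{X}^2\setminus\{(x,x):x\in\mathcal{X}\}$ is a $\theta$-type generalized Calderón–Zygmund kernel if $|K_{l,\theta}(x,y)|\lesssim\frac{d(x,y)^{1+l}}{\lambda(x,d(x,y))}$ for $x\ne y$, and $|K_{l,\theta}(x,y)-K_{l,\theta}(z,y)|+|K_{l,\theta}(y,x)-K_{l,\theta}(y,z)|\lesssim\theta\big(\frac{d(x,z)}{d(x,y)}\big)\frac{d(x,z)^{1+l}}{\lambda(x,d(x,y))}$ for $x,y,z$ (with $y\neq x$, $y\ne z$) such that $d(x,y)\ge d(x,z)/2$. Marcinkiewicz operator: $\widetilde{\mathcal{M}}_{l,\rho,s}(f)(x):=\Big(\int_0^{+\infty}\Big|\frac1{t^{l+\rho}}\int_{d(x,y)\le t}\frac{K_{l,\theta}(x,y)}{d(x,y)^{1-\rho}}f(y)\,d\mu(y)\Big|^s\frac{dt}t\Big)^{1/s}$, for $f\in L_c^\infty(\mu)$, $x\notin\operatorname{supp}f$. *)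

theory Defs
  imports "HOL-Analysis.Analysis"
begin

(* The metric space is the whole type 'a.  A ball is a pair (centre, radius > 0), so that the
   radius of a ball is meaningful even when the underlying set does not determine it. *)

locale nonhomogeneous_space =
  fixes \<mu> :: "'a::metric_space measure"
    and lam :: "'a \<Rightarrow> real \<Rightarrow> real"
  assumes sets_mu: "sets \<mu> = sets borel"
    and geometrically_doubling:
      "\<exists>N\<^sub>0::nat. \<forall>x::'a. \<forall>r>0. \<exists>A. finite A \<and> card A \<le> N\<^sub>0 \<and> ball x r \<subseteq> (\<Union>z\<in>A. ball z (r / 2))"
    and lam_pos: "\<And>x r. 0 < r \<Longrightarrow> 0 < lam x r"
    and lam_mono: "\<And>x. mono_on {0<..} (lam x)"
    and upper_doubling:
      "\<exists>C. (\<forall>x. \<forall>r>0. emeasure \<mu> (ball x r) \<le> ennreal (lam x r) \<and> lam x r \<le> C * lam x (r / 2)) \<and>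
           (\<forall>x y. \<forall>r>0. dist x y \<le> r \<longrightarrow> lam x r \<le> C * lam y r)"

definition G_dec :: "'a::metric_space measure \<Rightarrow> real \<Rightarrow> ('a \<Rightarrow> real \<Rightarrow> real) set" where
  "G_dec \<mu> \<delta> = {\<phi>.
     (\<forall>x. \<forall>r>0. 0 < \<phi> x r) \<and>
     (\<forall>x. filterlim (\<phi> x) at_top (at_right 0) \<and> (\<phi> x \<longlongrightarrow> 0) at_top) \<and>
     (\<forall>\<eta>>1. \<exists>c>0. \<exists>C>0. \<forall>x\<^sub>1 r\<^sub>1 x\<^sub>2 r\<^sub>2. 0 < r\<^sub>1 \<and> 0 < r\<^sub>2 \<and> ball x\<^sub>1 r\<^sub>1 \<subseteq> ball x\<^sub>2 r\<^sub>2 \<longrightarrow>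
        \<phi> x\<^sub>1 r\<^sub>1 * measure \<mu> (ball x\<^sub>1 (\<eta> * r\<^sub>1)) powr \<delta>
          \<ge> c * (\<phi> x\<^sub>2 r\<^sub>2 * measure \<mu> (ball x\<^sub>2 (\<eta> * r\<^sub>2)) powr \<delta>) \<and>
        \<phi> x\<^sub>1 r\<^sub>1 * measure \<mu> (ball x\<^sub>1 (\<eta> * r\<^sub>1))
          \<le> C * (\<phi> x\<^sub>2 r\<^sub>2 * measure \<mu> (ball x\<^sub>2 (\<eta> * r\<^sub>2))))}"

(* If the ball with radius \<eta> * r is a null set, the integral vanishes too and the quotient is
   0 / 0 = 0, so such balls do not contribute to the supremum. *)
definition morrey_mean ::
  "'a::metric_space measure \<Rightarrow> ('a \<Rightarrow> real \<Rightarrow> real) \<Rightarrow> real \<Rightarrow> real \<Rightarrow>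
   ('a \<Rightarrow> 'b::real_normed_vector) \<Rightarrow> 'a \<Rightarrow> real \<Rightarrow> real" where
  "morrey_mean \<mu> \<phi> \<eta> p f x r =
     (1 / (\<phi> x r * measure \<mu> (ball x (\<eta> * r))) * (LINT y:ball x r|\<mu>. norm (f y) powr p)) powr (1 / p)"

definition morrey_space ::
  "'a::metric_space measure \<Rightarrow> ('a \<Rightarrow> real \<Rightarrow> real) \<Rightarrow> real \<Rightarrow> real \<Rightarrow>
   ('a \<Rightarrow> 'b::real_normed_vector) set" where
  "morrey_space \<mu> \<phi> \<eta> p = {f \<in> borel_measurable \<mu>.
     (\<forall>x. \<forall>r>0. set_integrable \<mu> (ball x r) (\<lambda>y. norm (f y) powr p)) \<and>
     bdd_above ((\<lambda>(x, r). morrey_mean \<mu> \<phi> \<eta> p f x r) ` (UNIV \<times> {0<..}))}"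

definition morrey_norm ::
  "'a::metric_space measure \<Rightarrow> ('a \<Rightarrow> real \<Rightarrow> real) \<Rightarrow> real \<Rightarrow> real \<Rightarrow>
   ('a \<Rightarrow> 'b::real_normed_vector) \<Rightarrow> real" where
  "morrey_norm \<mu> \<phi> \<eta> p f = (SUP (x, r)\<in>UNIV \<times> {0<..}. morrey_mean \<mu> \<phi> \<eta> p f x r)"

(* The library's diameter is real-valued and meaningless for unbounded sets. *)
definition space_diam :: "'a::metric_space itself \<Rightarrow> ereal" where
  "space_diam _ = (SUP (x::'a, y)\<in>UNIV. ereal (dist x y))"

definition weak_reverse_doubling :: "real \<Rightarrow> ('a::metric_space \<Rightarrow> real \<Rightarrow> real) \<Rightarrow> bool" where
  "weak_reverse_doubling \<sigma> lam \<longleftrightarrow>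
     (\<exists>C :: real \<Rightarrow> real. (\<forall>a>1. 0 < C a) \<and>
        (\<forall>x r a. 0 < r \<and> ereal r < 2 * space_diam TYPE('a) \<and>
            1 < a \<and> ereal a < 2 * space_diam TYPE('a) / ereal r \<longrightarrow>
            C a * lam x r \<le> lam x (a * r)) \<and>
        (\<forall>a>1. summable (\<lambda>j. C (a ^ Suc j) powr (- \<sigma>))))"

definition L2_space :: "'a measure \<Rightarrow> ('a \<Rightarrow> complex) set" where
  "L2_space \<mu> = {f \<in> borel_measurable \<mu>. integrable \<mu> (\<lambda>x. (norm (f x))\<^sup>2)}"

definition L2_fun_norm :: "'a measure \<Rightarrow> ('a \<Rightarrow> complex) \<Rightarrow> real" where
  "L2_fun_norm \<mu> f = sqrt (LINT x|\<mu>. (norm (f x))\<^sup>2)"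

definition supp :: "('a::topological_space \<Rightarrow> complex) \<Rightarrow> 'a set" where
  "supp f = closure {x. f x \<noteq> 0}"

definition Linf_c :: "'a::metric_space measure \<Rightarrow> ('a \<Rightarrow> complex) set" where
  "Linf_c \<mu> = {f \<in> borel_measurable \<mu>.
     (\<exists>B. AE x in \<mu>. norm (f x) \<le> B) \<and> (\<exists>x r. supp f \<subseteq> ball x r)}"

definition T_lam ::
  "'a::metric_space measure \<Rightarrow> ('a \<Rightarrow> real \<Rightarrow> real) \<Rightarrow> ('a \<Rightarrow> complex) \<Rightarrow> 'a \<Rightarrow> complex" where
  "T_lam \<mu> lam f x = (LINT y|\<mu>. f y / of_real (lam x (dist x y)))"

(* As usual in Calderon-Zygmund theory, the integral formula for the operator is only prescribed
   for f in Linf_c and off the support of f; boundedness on L^2 means that it is realised by a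
   bounded linear operator on L^2.  Elements of L^2 are functions here, so the identities
   are required almost everywhere. *)
definition T_lam_bounded_L2 :: "'a::metric_space measure \<Rightarrow> ('a \<Rightarrow> real \<Rightarrow> real) \<Rightarrow> bool" where
  "T_lam_bounded_L2 \<mu> lam \<longleftrightarrow>
     (\<exists>T :: ('a \<Rightarrow> complex) \<Rightarrow> ('a \<Rightarrow> complex).
        (\<forall>f\<in>L2_space \<mu>. \<forall>g\<in>L2_space \<mu>. \<forall>a b.
           AE x in \<mu>. T (\<lambda>y. a * f y + b * g y) x = a * T f x + b * T g x) \<and>
        (\<exists>C. \<forall>f\<in>L2_space \<mu>. T f \<in> L2_space \<mu> \<and> L2_fun_norm \<mu> (T f) \<le> C * L2_fun_norm \<mu> f) \<and>
        (\<forall>f\<in>Linf_c \<mu>. AE x in \<mu>. x \<notin> supp f \<longrightarrow> T f x = T_lam \<mu> lam f x))"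

definition log_dini :: "(real \<Rightarrow> real) \<Rightarrow> bool" where
  "log_dini \<theta> \<longleftrightarrow> (\<forall>t>0. 0 \<le> \<theta> t) \<and> mono_on {0<..} \<theta> \<and>
     set_integrable lborel {0<..<1} (\<lambda>t. \<theta> t / t * ln (1 / t))"

(* Open boxes U \<times> V with U, V disjoint are a neighbourhood base of the complement of the diagonal. *)
definition locally_integrable_off_diagonal ::
  "'a::metric_space measure \<Rightarrow> ('a \<Rightarrow> 'a \<Rightarrow> complex) \<Rightarrow> bool" where
  "locally_integrable_off_diagonal \<mu> K \<longleftrightarrow>
     (\<forall>x y. x \<noteq> y \<longrightarrow> (\<exists>U V. open U \<and> open V \<and> x \<in> U \<and> y \<in> V \<and> U \<inter> V = {} \<and>
        set_integrable (\<mu> \<Otimes>\<^sub>M \<mu>) (U \<times> V) (\<lambda>(u, v). K u v)))"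

(* For z = x the value \<theta> 0 is unspecified, but it is multiplied by 0 powr (1 + l) = 0. *)
definition theta_cz_kernel ::
  "'a::metric_space measure \<Rightarrow> ('a \<Rightarrow> real \<Rightarrow> real) \<Rightarrow> real \<Rightarrow> (real \<Rightarrow> real) \<Rightarrow>
   ('a \<Rightarrow> 'a \<Rightarrow> complex) \<Rightarrow> bool" where
  "theta_cz_kernel \<mu> lam l \<theta> K \<longleftrightarrow>
     locally_integrable_off_diagonal \<mu> K \<and>
     (\<exists>C>0. \<forall>x y. x \<noteq> y \<longrightarrow>
        norm (K x y) \<le> C * (dist x y powr (1 + l) / lam x (dist x y))) \<and>
     (\<exists>C>0. \<forall>x y z. y \<noteq> x \<and> y \<noteq> z \<and> dist x y \<ge> dist x z / 2 \<longrightarrow>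
        norm (K x y - K z y) + norm (K y x - K y z)
          \<le> C * (\<theta> (dist x z / dist x y) * (dist x z powr (1 + l) / lam x (dist x y))))"

(* On the diagonal, where K is unspecified, this is 0 because division by 0 yields 0. *)
definition marcinkiewicz_integrand ::
  "real \<Rightarrow> ('a::metric_space \<Rightarrow> 'a \<Rightarrow> complex) \<Rightarrow> ('a \<Rightarrow> complex) \<Rightarrow> 'a \<Rightarrow> 'a \<Rightarrow> complex" where
  "marcinkiewicz_integrand \<rho> K f x y = K x y / of_real (dist x y powr (1 - \<rho>)) * f y"

definition marcinkiewicz_inner ::
  "'a::metric_space measure \<Rightarrow> real \<Rightarrow> real \<Rightarrow> ('a \<Rightarrow> 'a \<Rightarrow> complex) \<Rightarrow> ('a \<Rightarrow> complex) \<Rightarrow>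
   'a \<Rightarrow> real \<Rightarrow> complex" where
  "marcinkiewicz_inner \<mu> l \<rho> K f x t =
     of_real (1 / t powr (l + \<rho>)) * (LINT y:{y. dist x y \<le> t}|\<mu>. marcinkiewicz_integrand \<rho> K f x y)"

definition marcinkiewicz ::
  "'a::metric_space measure \<Rightarrow> real \<Rightarrow> real \<Rightarrow> real \<Rightarrow> ('a \<Rightarrow> 'a \<Rightarrow> complex) \<Rightarrow>
   ('a \<Rightarrow> complex) \<Rightarrow> 'a \<Rightarrow> real" where
  "marcinkiewicz \<mu> l \<rho> s K f x =
     (LINT t:{0<..}|lborel. norm (marcinkiewicz_inner \<mu> l \<rho> K f x t) powr s / t) powr (1 / s)"

(* Excludes the convention that the integral of a non-integrable function is 0. *)
definition marcinkiewicz_converges ::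
  "'a::metric_space measure \<Rightarrow> real \<Rightarrow> real \<Rightarrow> real \<Rightarrow> ('a \<Rightarrow> 'a \<Rightarrow> complex) \<Rightarrow>
   ('a \<Rightarrow> complex) \<Rightarrow> 'a \<Rightarrow> bool" where
  "marcinkiewicz_converges \<mu> l \<rho> s K f x \<longleftrightarrow>
     (\<forall>t>0. set_integrable \<mu> {y. dist x y \<le> t} (marcinkiewicz_integrand \<rho> K f x)) \<and>
     set_integrable lborel {0<..} (\<lambda>t. norm (marcinkiewicz_inner \<mu> l \<rho> K f x t) powr s / t)"

(* The integral formula determines the (non-linear) operator only if it is used at almost every
   point, also on the support of f; so it is taken as the definition for every f in the Morrey
   space, and its almost everywhere absolute convergence is part of boundedness. *)
definition marcinkiewicz_bounded_on_morrey ::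
  "'a::metric_space measure \<Rightarrow> ('a \<Rightarrow> real \<Rightarrow> real) \<Rightarrow> real \<Rightarrow> real \<Rightarrow>
   real \<Rightarrow> real \<Rightarrow> real \<Rightarrow> ('a \<Rightarrow> 'a \<Rightarrow> complex) \<Rightarrow> bool" where
  "marcinkiewicz_bounded_on_morrey \<mu> \<phi> \<eta> p l \<rho> s K \<longleftrightarrow>
     (\<exists>C. \<forall>f\<in>morrey_space \<mu> \<phi> \<eta> p.
        (AE x in \<mu>. marcinkiewicz_converges \<mu> l \<rho> s K f x) \<and>
        marcinkiewicz \<mu> l \<rho> s K f \<in> morrey_space \<mu> \<phi> \<eta> p \<and>
        morrey_norm \<mu> \<phi> \<eta> p (marcinkiewicz \<mu> l \<rho> s K f) \<le> C * morrey_norm \<mu> \<phi> \<eta> p f)"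

end

theory Submission
  imports Defs
begin

text \<open>
  The size condition on the kernel alone gives \<open>M f \<le> C * S \<bar>f\<bar>\<close> pointwise, where \<open>S\<close>
  has the positive kernel \<open>1 / lam x (dist x y)\<close>, so everything reduces to \<open>S\<close>.

  \<^item> \<open>S\<close> is bounded on \<open>L\<^sup>2\<close>: the hypothesis only controls interactions of separated sets, but
    averaging over all ways to split a fine partition into two halves recovers the full
    bilinear form up to a factor 4, because the kernel is positive; pairs of points closer than the
    mesh are handled by Schur's test.
  \<^item> \<open>S\<close> is bounded on \<open>L\<^sup>p\<close>: \<open>lam x (dist x y)\<close> is a quasi-metric up to constants, hence
    \<open>(S f)\<^sup>s \<le> C * S (f * (S f)\<^sup>s\<^sup>-\<^sup>1)\<close> for \<open>1 \<le> s \<le> 2\<close>, which turns an \<open>L\<^sup>q\<close> bound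
    into an \<open>L\<^sup>s\<^sup>q\<close> bound; the exponents below 2 follow by duality.
  \<^item> The conditions on \<open>\<phi>\<close> for all \<open>\<eta> > 1\<close> force \<open>\<mu>\<close> to be doubling. This controls the
    part of \<open>f\<close> near a ball, and weak reverse doubling makes the sum over the distant annuli
    converge.
\<close>

section \<open>Positive operators with a quasi-metric kernel\<close>

text \<open>Both arguments that change the exponent end by absorbing half of an integral of the
  potential, which is legitimate only if that integral is finite. Hence the finite measure, the
  bounded kernel and the bounded functions below. The resulting constants depend on
  \<open>\<kappa>\<close>, the exponents and the given bound, but not on the measure or the kernel,
  so they survive the limit over truncations in scale, space and height.

  Where \<open>k\<close> is positive, the kernel condition is the ultrametric inequality for
  \<open>1 / k\<close> up to the factor \<open>\<kappa>\<close>. For \<open>1 / lam\<close> it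
  reflects that of two balls sharing a point the larger one, dilated by 4, contains the other.

  The condition \<open>\<sigma> < \<delta> / p\<close> comes from the annuli: the decay of
  \<open>\<phi>\<close> and Hoelder's inequality leave the factor
  \<open>(lam x r / lam x (2 ^ k * r)) powr (\<delta> / p)\<close>, summable in \<open>k\<close> by
  weak reverse doubling. Doubling of \<open>\<mu>\<close> is called for because the near part of a
  function lives on twice the ball, while the growth condition on \<open>\<phi>\<close> bounds small
  balls by large ones and not conversely.\<close>

locale quasi_metric_kernel = finite_measure M for M :: "'a measure" +
  fixes k :: "'a \<Rightarrow> 'a \<Rightarrow> real" and \<kappa> :: real
  assumes k_measurable [measurable]: "(\<lambda>(x, y). k x y) \<in> borel_measurable (M \<Otimes>\<^sub>M M)"
    and k_nonneg: "\<And>x y. 0 \<le> k x y"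
    and k_bounded: "\<exists>b. \<forall>x y. k x y \<le> b"
    and k_sym: "\<And>x y. k x y = k y x"
    and k_quasi_metric: "\<And>x y z. min (k x y) (k x z) \<le> \<kappa> * k y z"
    and \<kappa>_ge_1: "1 \<le> \<kappa>"
begin

sublocale pair_sigma_finite M M ..

text \<open>The bound holds at every point of the type, also outside the space of \<open>M\<close>,
  so the closure properties involve no exceptional sets.\<close>

definition bounded_nonneg :: "('a \<Rightarrow> real) set" where
  "bounded_nonneg = {f \<in> borel_measurable M. \<exists>b. \<forall>x. 0 \<le> f x \<and> f x \<le> b}"

definition potential :: "('a \<Rightarrow> real) \<Rightarrow> 'a \<Rightarrow> real" where
  "potential f x = (LINT y|M. k x y * f y)"

text \<open>\<open>A\<close> is a bound for the \<open>q\<close>-th power of an operator norm; no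
  root is taken, so that integrals can be absorbed directly.\<close>

definition Lp_bound :: "real \<Rightarrow> real \<Rightarrow> bool" where
  "Lp_bound q A \<longleftrightarrow> (\<forall>f\<in>bounded_nonneg.
     (LINT x|M. potential f x powr q) \<le> A * (LINT x|M. f x powr q))"

section \<open>Stability of the class of bounded nonnegative functions\<close>

lemma bounded_nonneg_measurable: "f \<in> bounded_nonneg \<Longrightarrow> f \<in> borel_measurable M"
  by (simp add: bounded_nonneg_def)

lemma bounded_nonnegD: "f \<in> bounded_nonneg \<Longrightarrow> 0 \<le> f x"
  by (auto simp: bounded_nonneg_def)

lemma bounded_nonneg_bound:
  assumes "f \<in> bounded_nonneg" obtains b where "0 \<le> b" "\<And>x. f x \<le> b"
proof -
  obtain b where "\<forall>x. 0 \<le> f x \<and> f x \<le> b" using assms by (auto simp: bounded_nonneg_def)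
  then show ?thesis using that[of b] by (meson order_trans)
qed

lemma bounded_nonnegI:
  "f \<in> borel_measurable M \<Longrightarrow> (\<And>x. 0 \<le> f x) \<Longrightarrow> (\<And>x. f x \<le> b) \<Longrightarrow> f \<in> bounded_nonneg"
  by (auto simp: bounded_nonneg_def)

lemma integrable_bounded_nonneg: "f \<in> bounded_nonneg \<Longrightarrow> integrable M f"
  unfolding bounded_nonneg_def by (auto intro!: integrable_const_bound AE_I2)

lemma k_section_bounded_nonneg: assumes "x \<in> space M" shows "k x \<in> bounded_nonneg"
proof -
  obtain b where "\<forall>x y. k x y \<le> b" using k_bounded by auto
  moreover have "k x \<in> borel_measurable M"
    using measurable_compose[OF measurable_Pair1'[OF assms] k_measurable] by simp
  ultimately show ?thesis by (intro bounded_nonnegI[where b=b]) (auto simp: k_nonneg)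
qed

lemma bounded_nonneg_mult:
  assumes f: "f \<in> bounded_nonneg" and g: "g \<in> bounded_nonneg"
  shows "(\<lambda>x. f x * g x) \<in> bounded_nonneg"
proof -
  obtain a b where "0 \<le> a" "\<And>x. f x \<le> a" "0 \<le> b" "\<And>x. g x \<le> b"
    using assms by (metis bounded_nonneg_bound)
  then show ?thesis
    using bounded_nonnegD[OF f] bounded_nonnegD[OF g]
    by (intro bounded_nonnegI[where b="a * b"] borel_measurable_times bounded_nonneg_measurable[OF f]
        bounded_nonneg_measurable[OF g] mult_mono mult_nonneg_nonneg) auto
qed

lemma bounded_nonneg_scale:
  assumes f: "f \<in> bounded_nonneg" and "0 \<le> c"
  shows "(\<lambda>x. c * f x) \<in> bounded_nonneg"
  using bounded_nonneg_mult[OF bounded_nonnegI[of "\<lambda>_. c" c] f] assms(2) by simp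

lemma bounded_nonneg_add:
  assumes f: "f \<in> bounded_nonneg" and g: "g \<in> bounded_nonneg"
  shows "(\<lambda>x. f x + g x) \<in> bounded_nonneg"
proof -
  obtain a b where "\<And>x. f x \<le> a" "\<And>x. g x \<le> b" using assms by (metis bounded_nonneg_bound)
  then show ?thesis
    using bounded_nonnegD[OF f] bounded_nonnegD[OF g]
    by (intro bounded_nonnegI[where b="a + b"] borel_measurable_add bounded_nonneg_measurable[OF f]
        bounded_nonneg_measurable[OF g] add_mono) auto
qed

lemma bounded_nonneg_powr:
  assumes f: "f \<in> bounded_nonneg" and q: "0 \<le> q"
  shows "(\<lambda>x. f x powr q) \<in> bounded_nonneg"
proof -
  obtain a where a: "0 \<le> a" "\<And>x. f x \<le> a" using bounded_nonneg_bound[OF f] by blast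
  note [measurable] = bounded_nonneg_measurable[OF f]
  show ?thesis using a bounded_nonnegD[OF f] q
    by (intro bounded_nonnegI[where b="a powr q"] powr_mono2) auto
qed

section \<open>Potentials of bounded functions: measurability, boundedness, self-adjointness\<close>

lemma potential_measurable:
  assumes f: "f \<in> bounded_nonneg"
  shows "potential f \<in> borel_measurable M"
proof -
  note [measurable] = bounded_nonneg_measurable[OF f]
  show ?thesis unfolding potential_def by measurable
qed

lemma potential_nonneg: "f \<in> bounded_nonneg \<Longrightarrow> 0 \<le> potential f x"
  unfolding potential_def by (simp add: bounded_nonnegD k_nonneg)

lemma potential_bounded_nonneg:
  assumes f: "f \<in> bounded_nonneg"
  shows "potential f \<in> bounded_nonneg"
proof -
  obtain a where a: "0 \<le> a" "\<And>x. f x \<le> a" using bounded_nonneg_bound[OF f] by blast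
  obtain b where b: "\<forall>x y. k x y \<le> b" using k_bounded by auto
  have "potential f x \<le> b * a * measure M (space M)" for x
  proof (cases "integrable M (\<lambda>y. k x y * f y)")
    case True
    have "0 \<le> b" using b k_nonneg by (meson order_trans)
    then have "potential f x \<le> (LINT y|M. b * a)"
      unfolding potential_def using a b bounded_nonnegD[OF f] k_nonneg
      by (intro integral_mono True mult_mono) (auto intro: order_trans)
    then show ?thesis by (simp add: mult_ac)
  next
    \<comment> \<open>For \<open>x\<close> outside the space the section of the kernel need not be
      measurable; the integral is then 0 by convention.\<close>
    case False
    have "0 \<le> b" using b k_nonneg by (meson order_trans)
    then show ?thesis using False a unfolding potential_def
      by (simp add: not_integrable_integral_eq)
  qed
  then show ?thesis
    by (intro bounded_nonnegI potential_measurable f potential_nonneg)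
qed

lemma integrable_pair_bounded:
  fixes F :: "'a \<Rightarrow> 'a \<Rightarrow> real"
  assumes [measurable]: "(\<lambda>(x, y). F x y) \<in> borel_measurable (M \<Otimes>\<^sub>M M)"
    and "\<And>x y. \<bar>F x y\<bar> \<le> b"
  shows "integrable (M \<Otimes>\<^sub>M M) (\<lambda>(x, y). F x y)"
proof -
  interpret P: finite_measure "M \<Otimes>\<^sub>M M" using finite_measure_axioms finite_measure_pair_measure by blast
  show ?thesis using assms(2) by (intro P.integrable_const_bound[where B=b]) (auto intro!: AE_I2)
qed

lemma potential_self_adjoint:
  assumes f: "f \<in> bounded_nonneg" and g: "g \<in> bounded_nonneg"
  shows "(LINT x|M. g x * potential f x) = (LINT x|M. f x * potential g x)"
proof -
  note [measurable] = bounded_nonneg_measurable[OF f] bounded_nonneg_measurable[OF g]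
  obtain a where a: "0 \<le> a" "\<And>x. f x \<le> a" using bounded_nonneg_bound[OF f] by blast
  obtain a' where a': "0 \<le> a'" "\<And>x. g x \<le> a'" using bounded_nonneg_bound[OF g] by blast
  obtain b where b: "\<forall>x y. k x y \<le> b" using k_bounded by auto
  have b0: "0 \<le> b" using b k_nonneg by (meson order_trans)
  have int: "integrable (M \<Otimes>\<^sub>M M) (\<lambda>(x, y). g x * (k x y * f y))"
    using a a' b b0 bounded_nonnegD[OF f] bounded_nonnegD[OF g] k_nonneg
    by (intro integrable_pair_bounded[where b="a' * (b * a)"])
       (auto simp: abs_mult intro!: mult_mono)
  have "(LINT x|M. g x * potential f x) = (LINT x|M. LINT y|M. g x * (k x y * f y))"
    by (simp add: potential_def)
  also have "\<dots> = (LINT y|M. LINT x|M. g x * (k x y * f y))"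
    using Fubini_integral[OF int] by simp
  also have "\<dots> = (LINT y|M. f y * (LINT x|M. k y x * g x))"
    by (simp flip: integral_mult_right_zero) (simp add: k_sym mult_ac)
  finally show ?thesis by (simp add: potential_def)
qed

text \<open>Writing the product of two kernel values as minimum times maximum, the minimum is at most
  \<open>\<kappa>\<close> times the kernel between the two outer points.\<close>

lemma potential_square_le:
  assumes f: "f \<in> bounded_nonneg" and x: "x \<in> space M"
  shows "(potential f x)\<^sup>2 \<le> 2 * (LINT y|M. k x y * f y * min (potential f x) (\<kappa> * potential f y))"
proof -
  define a where "a = potential f x"
  note [measurable] = bounded_nonneg_measurable[OF f]
  have kf: "(\<lambda>y. k x y * f y) \<in> bounded_nonneg"
    by (intro bounded_nonneg_mult k_section_bounded_nonneg x f)
  have [measurable]: "k x \<in> borel_measurable M"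
    by (rule bounded_nonneg_measurable[OF k_section_bounded_nonneg[OF x]])
  note kf' = integrable_bounded_nonneg[OF kf]
  obtain c where c: "0 \<le> c" "\<And>x. f x \<le> c" using bounded_nonneg_bound[OF f] by blast
  obtain b where b: "\<forall>x y. k x y \<le> b" using k_bounded by auto
  have b0: "0 \<le> b" using b k_nonneg by (meson order_trans)
  define m where "m y z = min (k x y) (k x z)" for y z
  have m: "0 \<le> m y z" "m y z \<le> b" "m y z \<le> k x z" "m y z \<le> \<kappa> * k y z" "m y z = m z y" for y z
    using k_nonneg b k_quasi_metric by (auto simp: m_def min_le_iff_disj min.commute)
  have [measurable]: "(\<lambda>(y, z). m y z) \<in> borel_measurable (M \<Otimes>\<^sub>M M)"
    unfolding m_def by measurable
  have bd: "\<bar>k x y * f y * (m y z * f z)\<bar> \<le> (b * c) * (b * c)" for y z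
    using b b0 c m[of y z] bounded_nonnegD[OF f] k_nonneg
    by (auto simp: abs_mult intro!: mult_mono)
  have int: "integrable (M \<Otimes>\<^sub>M M) (\<lambda>(y, z). k x y * f y * (m y z * f z))"
    by (rule integrable_pair_bounded[OF _ bd]) simp
  have int2: "integrable (M \<Otimes>\<^sub>M M) (\<lambda>(y, z). k x z * f z * (m z y * f y))"
    by (rule integrable_pair_bounded[OF _ bd]) (simp add: m(5)[of _ "snd _", symmetric], measurable)
  have int0: "integrable (M \<Otimes>\<^sub>M M) (\<lambda>(y, z). k x y * f y * (k x z * f z))"
    using b b0 c bounded_nonnegD[OF f] k_nonneg
    by (intro integrable_pair_bounded[where b="(b*c)*(b*c)"]) (auto simp: abs_mult intro!: mult_mono)
  have "a\<^sup>2 = (LINT y|M. LINT z|M. k x y * f y * (k x z * f z))"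
    by (simp add: a_def potential_def power2_eq_square)
  also have "\<dots> = (LINT p|(M \<Otimes>\<^sub>M M). (case p of (y, z) \<Rightarrow> k x y * f y * (k x z * f z)))"
    using integral_fst'[OF int0] by simp
  also have "\<dots> \<le> (LINT p|(M \<Otimes>\<^sub>M M). ((case p of (y, z) \<Rightarrow> k x y * f y * (m y z * f z))
       + (case p of (y, z) \<Rightarrow> k x z * f z * (m z y * f y))))"
  proof (rule integral_mono[OF int0 Bochner_Integration.integrable_add[OF int int2]], clarify)
    fix y z
    \<comment> \<open>The maximum of two nonnegative numbers is at most their sum. The two resulting
      terms agree after exchanging \<open>y\<close> and \<open>z\<close>, which accounts for the
      factor 2.\<close>
    have "k x y * k x z \<le> k x y * m y z + k x z * m y z"
      using k_nonneg[of x y] k_nonneg[of x z] by (auto simp: m_def min_def mult_ac)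
    then have "f y * f z * (k x y * k x z) \<le> f y * f z * (k x y * m y z + k x z * m y z)"
      using bounded_nonnegD[OF f] by (intro mult_left_mono) auto
    then show "k x y * f y * (k x z * f z) \<le> k x y * f y * (m y z * f z) + k x z * f z * (m z y * f y)"
      by (simp add: algebra_simps m(5)[of z y])
  qed
  also have "\<dots> = (LINT p|(M \<Otimes>\<^sub>M M). (case p of (y, z) \<Rightarrow> k x y * f y * (m y z * f z)))
       + (LINT p|(M \<Otimes>\<^sub>M M). (case p of (y, z) \<Rightarrow> k x z * f z * (m z y * f y)))"
    by (rule Bochner_Integration.integral_add[OF int int2])
  also have "\<dots> = 2 * (LINT y|M. k x y * f y * (LINT z|M. m y z * f z))"
    using integral_fst'[OF int] integral_snd[OF int2] by simp
  also have "\<dots> \<le> 2 * (LINT y|M. k x y * f y * min a (\<kappa> * potential f y))"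
  proof -
    have mb: "(\<lambda>z. m y z * f z) \<in> bounded_nonneg" if "y \<in> space M" for y
    proof -
      have "m y \<in> bounded_nonneg" unfolding m_def
        using k_nonneg b by (intro bounded_nonnegI[where b=b]) (auto simp: min_le_iff_disj)
      then show ?thesis by (intro bounded_nonneg_mult f)
    qed
    \<comment> \<open>The minimum \<open>m\<close> is bounded in two ways, giving \<open>a\<close>
      and \<open>\<kappa> * potential f y\<close>. Keeping the smaller of the two is what permits
      interpolation between them later.\<close>
    have 1: "(LINT z|M. m y z * f z) \<le> a" if "y \<in> space M" for y
      unfolding a_def potential_def
      using m bounded_nonnegD[OF f]
      by (intro integral_mono integrable_bounded_nonneg mb that kf mult_right_mono m(3)) auto
    have 2: "(LINT z|M. m y z * f z) \<le> \<kappa> * potential f y" if "y \<in> space M" for y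
    proof -
      have "(LINT z|M. m y z * f z) \<le> (LINT z|M. \<kappa> * (k y z * f z))"
        using bounded_nonnegD[OF f] \<kappa>_ge_1
        by (intro integral_mono integrable_bounded_nonneg mb that bounded_nonneg_scale
            bounded_nonneg_mult f k_section_bounded_nonneg)
           (auto simp: mult.assoc[symmetric] intro!: mult_right_mono m(4))
      then show ?thesis by (simp add: potential_def)
    qed
    have mi: "(\<lambda>y. min a (\<kappa> * potential f y)) \<in> bounded_nonneg"
      using potential_nonneg[OF f] \<kappa>_ge_1 potential_measurable[OF f]
      by (intro bounded_nonnegI[where b=a]) (auto simp: a_def)
    have [measurable]: "(\<lambda>y. LINT z|M. m y z * f z) \<in> borel_measurable M" by measurable
    have "integrable M (\<lambda>y. LINT z|M. k x y * f y * (m y z * f z))"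
      using integrable_fst'[OF int] by simp
    then have i1: "integrable M (\<lambda>y. k x y * f y * (LINT z|M. m y z * f z))" by simp
    show ?thesis
      using 1 2 k_nonneg bounded_nonnegD[OF f]
      by (intro mult_left_mono integral_mono i1 integrable_bounded_nonneg bounded_nonneg_mult[OF kf mi]) auto
  qed
  finally show ?thesis by (simp add: a_def)
qed

text \<open>In the square estimate, \<open>min a v\<close> is at most
  \<open>a powr (2 - s) * v powr (s - 1)\<close>, a geometric mean whose weights are nonnegative
  precisely for \<open>s\<close> between 1 and 2. Dividing by \<open>a powr (2 - s)\<close>, where
  \<open>a\<close> is the potential at \<open>x\<close>, leaves the claim.\<close>

lemma potential_powr_le:
  assumes f: "f \<in> bounded_nonneg" and x: "x \<in> space M" and s: "1 \<le> s" "s \<le> 2"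
  shows "potential f x powr s \<le> 2 * \<kappa> powr (s - 1) * potential (\<lambda>y. f y * potential f y powr (s - 1)) x"
proof (cases "potential f x = 0")
  case True
  have "(\<lambda>y. f y * potential f y powr (s - 1)) \<in> bounded_nonneg"
    using s by (intro bounded_nonneg_mult f bounded_nonneg_powr potential_bounded_nonneg) auto
  from potential_nonneg[OF this, of x] show ?thesis using True by (simp)
next
  case False
  define a where "a = potential f x"
  have a: "a > 0" using False potential_nonneg[OF f, of x] by (simp add: a_def)
  let ?w = "potential f"
  have pb: "(\<lambda>y. k x y * f y) \<in> bounded_nonneg"
    by (intro bounded_nonneg_mult k_section_bounded_nonneg x f)
  have wb: "(\<lambda>y. ?w y powr (s - 1)) \<in> bounded_nonneg"
    using s by (intro bounded_nonneg_powr potential_bounded_nonneg f) auto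
  have mi: "(\<lambda>y. min a (\<kappa> * ?w y)) \<in> bounded_nonneg"
    using potential_nonneg[OF f] \<kappa>_ge_1 a potential_measurable[OF f]
    by (intro bounded_nonnegI[where b=a]) auto
  have key: "min a (\<kappa> * ?w y) \<le> a powr (2 - s) * \<kappa> powr (s - 1) * ?w y powr (s - 1)" for y
  proof -
    define v where "v = \<kappa> * ?w y"
    have v0: "0 \<le> v" using potential_nonneg[OF f, of y] \<kappa>_ge_1 by (simp add: v_def)
    define t where "t = min a v"
    have t0: "0 \<le> t" "t \<le> a" "t \<le> v" using v0 a by (auto simp: t_def)
    have "t = t powr (2 - s) * t powr (s - 1)"
      using t0 by (cases "t = 0") (auto simp flip: powr_add)
    also have "\<dots> \<le> a powr (2 - s) * v powr (s - 1)"
      using t0 s by (intro mult_mono powr_mono2) auto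
    finally show ?thesis
      using \<kappa>_ge_1 potential_nonneg[OF f, of y] by (simp add: t_def v_def powr_mult mult_ac)
  qed
  have "a\<^sup>2 \<le> 2 * (LINT y|M. k x y * f y * min a (\<kappa> * ?w y))"
    unfolding a_def by (rule potential_square_le[OF f x])
  also have "\<dots> \<le> 2 * (LINT y|M. (a powr (2 - s) * \<kappa> powr (s - 1)) * (k x y * f y * ?w y powr (s - 1)))"
  proof (intro mult_left_mono integral_mono integrable_bounded_nonneg bounded_nonneg_scale
      bounded_nonneg_mult[OF pb mi] bounded_nonneg_mult[OF pb wb])
    fix y
    have "k x y * f y * min a (\<kappa> * ?w y) \<le> k x y * f y * (a powr (2 - s) * \<kappa> powr (s - 1) * ?w y powr (s - 1))"
      using key k_nonneg bounded_nonnegD[OF f] by (intro mult_left_mono) auto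
    then show "k x y * f y * min a (\<kappa> * ?w y) \<le> (a powr (2 - s) * \<kappa> powr (s - 1)) * (k x y * f y * ?w y powr (s - 1))"
      by (simp add: mult_ac)
  qed auto
  also have "\<dots> = a powr (2 - s) * (2 * \<kappa> powr (s - 1) * potential (\<lambda>y. f y * ?w y powr (s - 1)) x)"
    by (simp only: integral_mult_right_zero) (simp add: potential_def mult.assoc mult.left_commute)
  finally have "a\<^sup>2 \<le> a powr (2 - s) * (2 * \<kappa> powr (s - 1) * potential (\<lambda>y. f y * ?w y powr (s - 1)) x)" .
  moreover have "a\<^sup>2 = a powr (2 - s) * a powr s"
    using a by (simp flip: powr_add)
  ultimately show ?thesis using a by (simp add: a_def)
qed

text \<open>The \<open>q\<close>-th power of the pointwise inequality is integrated, and the bound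
  for the exponent \<open>q\<close> is applied to \<open>f\<close> times the power
  \<open>s - 1\<close> of its potential. The result mixes \<open>f\<close> with its potential; half
  of the integral of the potential is absorbed on the left, where it is finite.\<close>

lemma Lp_bound_self_improve:
  assumes P: "Lp_bound q A" and q: "1 \<le> q" and s: "1 \<le> s" "s \<le> 2" and A: "0 \<le> A"
  defines "B \<equiv> (2 * \<kappa> powr (s - 1)) powr q * A"
  shows "Lp_bound (s * q) (2 * (2 * B) powr s)"
  unfolding Lp_bound_def
proof
  fix f assume f: "f \<in> bounded_nonneg"
  let ?w = "potential f"
  have wb: "?w \<in> bounded_nonneg" by (rule potential_bounded_nonneg[OF f])
  have B0: "0 \<le> B" using A by (simp add: B_def)
  define g where "g y = f y * ?w y powr (s - 1)" for y
  have g: "g \<in> bounded_nonneg" unfolding g_def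
    using s by (intro bounded_nonneg_mult f bounded_nonneg_powr wb) auto
  have sq: "0 \<le> s * q" "0 \<le> q" using s q by auto
  have half: "(\<lambda>x. ?w x powr (s * q) / 2) \<in> bounded_nonneg"
    using bounded_nonneg_scale[OF bounded_nonneg_powr[OF wb sq(1)], of "1 / 2"] by simp
  have "(LINT x|M. ?w x powr (s * q)) \<le> (LINT x|M. (2 * \<kappa> powr (s - 1)) powr q * potential g x powr q)"
  proof (intro integral_mono integrable_bounded_nonneg bounded_nonneg_scale bounded_nonneg_powr
      wb potential_bounded_nonneg g sq)
    fix x assume x: "x \<in> space M"
    have "(?w x powr s) powr q \<le> (2 * \<kappa> powr (s - 1) * potential g x) powr q"
      unfolding g_def using potential_powr_le[OF f x s] q by (intro powr_mono2) auto
    then show "?w x powr (s * q) \<le> (2 * \<kappa> powr (s - 1)) powr q * potential g x powr q"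
      using potential_nonneg[OF g, of x] by (simp add: powr_powr powr_mult)
  qed auto
  also have "\<dots> \<le> (2 * \<kappa> powr (s - 1)) powr q * (A * (LINT x|M. g x powr q))"
    using P g by (simp add: Lp_bound_def mult_left_mono)
  also have "\<dots> = (LINT x|M. B * g x powr q)" by (simp add: B_def)
  also have "\<dots> \<le> (LINT x|M. ?w x powr (s * q) / 2 + (2 * B) powr s * f x powr (s * q))"
  proof (intro integral_mono integrable_bounded_nonneg bounded_nonneg_scale bounded_nonneg_powr
      g sq B0 bounded_nonneg_add f)
    show "(\<lambda>x. ?w x powr (s * q) / 2) \<in> bounded_nonneg" by (rule half)
  next
    fix x
    define F where "F = f x powr q"
    define W where "W = ?w x powr q"
    have FW: "0 \<le> F" "0 \<le> W" by (auto simp: F_def W_def)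
    have gx: "g x powr q = F * W powr (s - 1)"
      using bounded_nonnegD[OF f, of x] bounded_nonnegD[OF wb, of x]
      by (simp add: g_def F_def W_def powr_mult powr_powr mult.commute)
    have Wp: "W powr (s - 1) * W = W powr s"
      using FW by (cases "W = 0") (auto simp: powr_mult_base mult.commute)
    have Fs: "F powr s = f x powr (s * q)" "W powr s = ?w x powr (s * q)"
      using bounded_nonnegD[OF f, of x] bounded_nonnegD[OF wb, of x]
      by (auto simp: F_def W_def powr_powr mult.commute)
    \<comment> \<open>A case distinction in place of Young's inequality: either \<open>B * F\<close>
      is at most \<open>W / 2\<close> and the term is absorbed, or \<open>W\<close> is below
      \<open>2 * B * F\<close> and only \<open>f\<close> remains.\<close>
    show "B * g x powr q \<le> ?w x powr (s * q) / 2 + (2 * B) powr s * f x powr (s * q)"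
    proof (cases "B * F \<le> W / 2")
      case True
      then have "B * g x powr q \<le> W / 2 * W powr (s - 1)"
        unfolding gx mult.assoc[symmetric] by (intro mult_right_mono) auto
      also have "\<dots> = ?w x powr (s * q) / 2" using Wp Fs by (simp add: mult_ac)
      finally show ?thesis by (simp add: add_increasing2)
    next
      case False
      then have "B * g x powr q \<le> B * (F * (2 * B * F) powr (s - 1))"
        unfolding gx using FW B0 s by (intro mult_left_mono powr_mono2) auto
      also have "\<dots> \<le> (2 * B * F) * (2 * B * F) powr (s - 1)"
        using FW B0 by (simp add: mult.assoc[symmetric] mult_right_mono)
      also have "\<dots> = (2 * B * F) powr s"
        using FW B0 by (simp add: powr_mult_base)
      also have "\<dots> = (2 * B) powr s * f x powr (s * q)"
        using FW B0 Fs by (simp add: powr_mult)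
      finally show ?thesis by (simp add: add_increasing)
    qed
  qed auto
  also have "\<dots> = (LINT x|M. ?w x powr (s * q)) / 2 + (2 * B) powr s * (LINT x|M. f x powr (s * q))"
    by (subst Bochner_Integration.integral_add)
       (auto intro!: integrable_bounded_nonneg half bounded_nonneg_powr f sq)
  finally show "(LINT x|M. ?w x powr (s * q)) \<le> 2 * (2 * B) powr s * (LINT x|M. f x powr (s * q))"
    by simp
qed

text \<open>With \<open>q' = q / (q - 1)\<close>, the potential \<open>w\<close> of \<open>f\<close>
  is tested against \<open>w powr (q' - 1)\<close>, and self-adjointness moves the operator onto
  this test function. Since \<open>(q' - 1) * q = q'\<close>, the bound for \<open>q\<close> returns
  the integral of \<open>w powr q'\<close>; the weight \<open>1 / (2 * A)\<close> makes its
  coefficient one half.\<close>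

lemma Lp_bound_dual:
  assumes P: "Lp_bound q A" and q: "1 < q" and A: "1 \<le> A"
  shows "Lp_bound (q / (q - 1)) (2 * (2 * A) powr (1 / (q - 1)))"
  unfolding Lp_bound_def
proof
  fix f assume f: "f \<in> bounded_nonneg"
  let ?w = "potential f"
  define q' where "q' = q / (q - 1)"
  have q': "0 < q'" "q' - 1 = 1 / (q - 1)" "(q' - 1) * q = q'" using q by (auto simp: q'_def field_simps)
  have q'1: "0 \<le> q' - 1" using q by (simp add: q'(2))
  have wb: "?w \<in> bounded_nonneg" by (rule potential_bounded_nonneg[OF f])
  define g where "g y = ?w y powr (q' - 1)" for y
  have g: "g \<in> bounded_nonneg" unfolding g_def by (intro bounded_nonneg_powr wb q'1)
  let ?h = "potential g"
  have hb: "?h \<in> bounded_nonneg" by (rule potential_bounded_nonneg[OF g])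
  have q0: "0 \<le> q" "0 \<le> q'" using q q' by auto
  have w0: "0 \<le> ?w x" "0 \<le> ?h x" "0 \<le> f x" for x
    using bounded_nonnegD[OF wb] bounded_nonnegD[OF hb] bounded_nonnegD[OF f] by auto
  have h: "(LINT x|M. ?h x powr q) \<le> A * (LINT x|M. ?w x powr q')"
    using P g q'(3) unfolding Lp_bound_def g_def by (auto simp: powr_powr)
  have "(LINT x|M. ?w x powr q') = (LINT x|M. g x * ?w x)"
  proof (rule Bochner_Integration.integral_cong)
    fix x show "?w x powr q' = g x * ?w x"
      using w0(1)[of x] by (simp add: g_def powr_mult_base mult.commute[of _ "?w x"])
  qed simp
  also have "\<dots> = (LINT x|M. f x * ?h x)" by (rule potential_self_adjoint[OF f g])
  also have "\<dots> \<le> (LINT x|M. 1 / (2 * A) * ?h x powr q + (2 * A) powr (q' - 1) * f x powr q')"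
  proof (intro integral_mono integrable_bounded_nonneg bounded_nonneg_scale bounded_nonneg_powr
      g q0 bounded_nonneg_add bounded_nonneg_mult f hb)
    fix x
    \<comment> \<open>Young's inequality with unoptimised constants: either \<open>f\<close> is
      dominated by a power of the potential \<open>?h\<close>, or conversely.\<close>
    show "f x * ?h x \<le> 1 / (2 * A) * ?h x powr q + (2 * A) powr (q' - 1) * f x powr q'"
    proof (cases "f x \<le> 1 / (2 * A) * ?h x powr (q - 1)")
      case True
      then have "f x * ?h x \<le> 1 / (2 * A) * (?h x powr (q - 1) * ?h x)"
        unfolding mult.assoc[symmetric] using w0 by (intro mult_right_mono) auto
      also have "?h x powr (q - 1) * ?h x = ?h x powr q"
        using w0 q by (subst mult.commute) (simp add: powr_mult_base)
      finally show ?thesis by (simp add: add_increasing2)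
    next
      case False
      then have *: "?h x powr (q - 1) \<le> 2 * A * f x" using A by (simp add: field_simps)
      have "?h x = (?h x powr (q - 1)) powr (1 / (q - 1))" using q w0 by (simp add: powr_powr)
      also have "\<dots> \<le> (2 * A * f x) powr (q' - 1)"
        unfolding q'(2) using q * by (intro powr_mono2) auto
      finally have "f x * ?h x \<le> f x * (2 * A * f x) powr (q' - 1)" using w0 by (intro mult_left_mono) auto
      also have "\<dots> = (2 * A) powr (q' - 1) * f x powr q'"
        using w0(3)[of x] A by (simp add: powr_mult powr_mult_base mult.left_commute[of "f x"])
      finally show ?thesis using A by (simp add: add_increasing)
    qed
  qed (use A in auto)
  also have "\<dots> = 1 / (2 * A) * (LINT x|M. ?h x powr q) + (2 * A) powr (q' - 1) * (LINT x|M. f x powr q')"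
    by (subst Bochner_Integration.integral_add)
       (use A in \<open>auto simp only: zero_le_mult_iff intro!: integrable_bounded_nonneg
          bounded_nonneg_scale bounded_nonneg_powr hb f q0\<close>, auto)
  also have "\<dots> \<le> 1 / (2 * A) * (A * (LINT x|M. ?w x powr q')) + (2 * A) powr (q' - 1) * (LINT x|M. f x powr q')"
    using h A by (intro add_right_mono mult_left_mono) auto
  finally show "(LINT x|M. ?w x powr (q / (q - 1))) \<le> 2 * (2 * A) powr (1 / (q - 1)) * (LINT x|M. f x powr (q / (q - 1)))"
    using A q'(2) by (simp add: q'_def[symmetric])
qed

lemma Lp_bound_mono: "Lp_bound q A \<Longrightarrow> A \<le> B \<Longrightarrow> Lp_bound q B"
  unfolding Lp_bound_def by (fastforce intro: order_trans mult_right_mono)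

end

text \<open>\<open>B\<close> is chosen before the measure and the kernel because it must serve all
  truncations at once. One self-improvement at most doubles the exponent, so the induction runs over
  the dyadic range containing \<open>q\<close>.\<close>

lemma Lp_bound_ge_2:
  fixes q A \<kappa> :: real
  assumes "2 \<le> q" and A: "0 \<le> A"
  shows "\<exists>B. \<forall>(M :: 'a measure) k. quasi_metric_kernel M k \<kappa> \<longrightarrow>
           quasi_metric_kernel.Lp_bound M k 2 A \<longrightarrow>
           quasi_metric_kernel.Lp_bound M k q B"
proof -
  let ?P = "\<lambda>q A B. \<forall>(M :: 'a measure) k. quasi_metric_kernel M k \<kappa> \<longrightarrow>
    quasi_metric_kernel.Lp_bound M k 2 A \<longrightarrow> quasi_metric_kernel.Lp_bound M k q B"
  have "\<forall>q A. 2 \<le> q \<longrightarrow> q \<le> 2 * 2 ^ n \<longrightarrow> 0 \<le> A \<longrightarrow>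
      (\<exists>B\<ge>0. ?P q A B)" for n
  proof (induction n)
    case 0
    show ?case
    proof (intro allI impI)
      fix q A :: real assume "2 \<le> q" "q \<le> 2 * 2 ^ 0" "0 \<le> A"
      then have "q = 2" by simp
      with \<open>0 \<le> A\<close> show "\<exists>B\<ge>0. ?P q A B" by auto
    qed
  next
    case (Suc n)
    show ?case
    proof (intro allI impI)
      fix q A :: real assume q: "2 \<le> q" "q \<le> 2 * 2 ^ Suc n" and A: "0 \<le> A"
      \<comment> \<open>This choice keeps \<open>r\<close> in the range of the induction hypothesis
        and \<open>q / r\<close> between 1 and 2.\<close>
      define r where "r = max 2 (q / 2)"
      have r: "2 \<le> r" "r \<le> 2 * 2 ^ n" "1 \<le> r" "1 \<le> q / r" "q / r \<le> 2" "q = q / r * r"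
        using q by (auto simp: r_def max_def)
      obtain B where B: "B \<ge> 0" "\<And>(M :: 'a measure) k. quasi_metric_kernel M k \<kappa> \<Longrightarrow>
           quasi_metric_kernel.Lp_bound M k 2 A \<Longrightarrow>
           quasi_metric_kernel.Lp_bound M k r B"
        using Suc.IH r A by blast
      show "\<exists>B\<ge>0. ?P q A B"
        using quasi_metric_kernel.Lp_bound_self_improve[OF _ B(2) r(3,4,5) B(1)] r(6)
        by (metis mult_nonneg_nonneg powr_ge_zero zero_le_numeral)
    qed
  qed
  moreover obtain n where "q < 2 ^ n" using real_arch_pow[of 2 q] by auto
  then have "q \<le> 2 * 2 ^ n" using zero_le_power[of "2::real" n] by linarith
  ultimately show ?thesis using assms by blast
qed

lemma Lp_bound_gt_1:
  fixes p A \<kappa> :: real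
  assumes p: "1 < p" and A: "0 \<le> A"
  shows "\<exists>B. \<forall>(M :: 'a measure) k. quasi_metric_kernel M k \<kappa> \<longrightarrow>
           quasi_metric_kernel.Lp_bound M k 2 A \<longrightarrow>
           quasi_metric_kernel.Lp_bound M k p B"
proof (cases "2 \<le> p")
  case True then show ?thesis using Lp_bound_ge_2 A by blast
next
  case False
  define q where "q = p / (p - 1)"
  have q: "2 \<le> q" "1 < q" "q / (q - 1) = p" using p False by (auto simp: q_def field_simps)
  obtain B where B: "\<And>(M :: 'a measure) k. quasi_metric_kernel M k \<kappa> \<Longrightarrow>
           quasi_metric_kernel.Lp_bound M k 2 A \<Longrightarrow>
           quasi_metric_kernel.Lp_bound M k q B"
    using Lp_bound_ge_2[OF q(1) A] by blast
  \<comment> \<open>Duality divides by its constant and asks for one that is at least 1, hence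
    \<open>max 1 B\<close>.\<close>
  have "quasi_metric_kernel.Lp_bound M k p (2 * (2 * max 1 B) powr (1 / (q - 1)))"
    if k: "quasi_metric_kernel M k \<kappa>" and 2: "quasi_metric_kernel.Lp_bound M k 2 A"
    for M :: "'a measure" and k
    using quasi_metric_kernel.Lp_bound_dual[OF k
        quasi_metric_kernel.Lp_bound_mono[OF k B[OF k 2]] q(2), of "max 1 B"] q(3) by simp
  then show ?thesis by blast
qed

section \<open>A measurable kernel comparable to the dominating function\<close>

context nonhomogeneous_space begin

section \<open>Balls and the dominating function under upper doubling\<close>

lemma space_mu: "space \<mu> = UNIV"
  using sets_eq_imp_space_eq[OF sets_mu] by simp

lemma measurable_mu_borel: "borel_measurable \<mu> = borel_measurable borel"
  by (rule measurable_cong_sets[OF sets_mu refl])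

lemma ball_sets [measurable, simp]: "ball x r \<in> sets \<mu>"
  by (simp add: sets_mu)

definition C_lam :: real where
  "C_lam = (SOME C. (\<forall>x. \<forall>r>0. emeasure \<mu> (ball x r) \<le> ennreal (lam x r) \<and> lam x r \<le> C * lam x (r / 2)) \<and>
           (\<forall>x y. \<forall>r>0. dist x y \<le> r \<longrightarrow> lam x r \<le> C * lam y r))"

lemma C_lam:
  "0 < r \<Longrightarrow> emeasure \<mu> (ball x r) \<le> ennreal (lam x r)"
  "0 < r \<Longrightarrow> lam x r \<le> C_lam * lam x (r / 2)"
  "0 < r \<Longrightarrow> dist x y \<le> r \<Longrightarrow> lam x r \<le> C_lam * lam y r"
  using someI_ex[OF upper_doubling] unfolding C_lam_def by blast+

lemma lam_monoD: "0 < r \<Longrightarrow> r \<le> r' \<Longrightarrow> lam x r \<le> lam x r'"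
  using lam_mono[of x] by (auto simp: mono_on_def)

lemma C_lam_ge_1: "1 \<le> C_lam"
proof -
  fix x :: 'a
  have "lam x 1 \<le> C_lam * lam x 1" using C_lam(3)[of 1 x x] by simp
  then show ?thesis using lam_pos[of 1 x] by simp
qed

lemma emeasure_ball_finite: "emeasure \<mu> (ball x r) < \<infinity>"
proof (cases "r > 0")
  case True
  then show ?thesis using C_lam(1)[of r x] by (auto intro: le_less_trans)
qed (simp add: ball_empty)

lemma emeasure_ball: "emeasure \<mu> (ball x r) = ennreal (measure \<mu> (ball x r))"
  using emeasure_ball_finite[of x r] by (intro emeasure_eq_ennreal_measure) auto

lemma measure_ball_le_lam: "0 < r \<Longrightarrow> measure \<mu> (ball x r) \<le> lam x r"
  using C_lam(1)[of r x] lam_pos[of r x] by (simp add: emeasure_ball)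

lemma measure_ball_mono: "ball x r \<subseteq> ball y s \<Longrightarrow> measure \<mu> (ball x r) \<le> measure \<mu> (ball y s)"
  using emeasure_mono[of "ball x r" "ball y s" \<mu>] by (simp add: emeasure_ball)

sublocale sigma_finite_measure \<mu>
proof
  fix c :: 'a
  show "\<exists>A. countable A \<and> A \<subseteq> sets \<mu> \<and> \<Union> A = space \<mu> \<and> (\<forall>a\<in>A. emeasure \<mu> a \<noteq> \<infinity>)"
  proof (intro exI[of _ "range (\<lambda>n. ball c (real n))"] conjI)
    show "\<Union> (range (\<lambda>n. ball c (real n))) = space \<mu>"
      using reals_Archimedean2 by (auto simp: space_mu)
  qed (use emeasure_ball_finite in \<open>auto simp: less_top[symmetric]\<close>)
qed

lemma lam_pow: "0 < r \<Longrightarrow> lam x (2 ^ m * r) \<le> C_lam ^ m * lam x r"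
proof (induction m)
  case (Suc m)
  have "lam x (2 ^ Suc m * r) \<le> C_lam * lam x (2 ^ m * r)"
    using C_lam(2)[of "2 ^ Suc m * r" x] Suc.prems by simp
  also have "\<dots> \<le> C_lam * (C_lam ^ m * lam x r)"
    using Suc C_lam_ge_1 by (intro mult_left_mono) auto
  finally show ?case by (simp add: mult_ac)
qed simp

section \<open>Finite covers and separability from geometric doubling\<close>

lemma iterated_cover:
  "\<exists>N. \<forall>x r. 0 < r \<longrightarrow> (\<exists>A. finite A \<and> card A \<le> N \<and> ball (x :: 'a) r \<subseteq> (\<Union>z\<in>A. ball z (r / 2 ^ n)))"
proof (induction n)
  case 0
  show ?case by (rule exI[of _ 1], intro allI impI, rule_tac x="{x}" in exI) auto
next
  case (Suc n)
  obtain N where N: "\<And>x r. 0 < r \<Longrightarrow> \<exists>A. finite A \<and> card A \<le> N \<and> ball (x :: 'a) r \<subseteq> (\<Union>z\<in>A. ball z (r / 2 ^ n))"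
    using Suc by blast
  obtain N0 where N0: "\<And>x r. 0 < r \<Longrightarrow> \<exists>A. finite A \<and> card A \<le> N0 \<and> ball (x :: 'a) r \<subseteq> (\<Union>z\<in>A. ball z (r / 2))"
    using geometrically_doubling by blast
  show ?case
  proof (intro exI[of _ "N * N0"] allI impI)
    fix x :: 'a and r :: real assume r: "0 < r"
    obtain A where A: "finite A" "card A \<le> N" "ball x r \<subseteq> (\<Union>z\<in>A. ball z (r / 2 ^ n))"
      using N[OF r] by blast
    have "\<forall>z :: 'a. \<exists>B. finite B \<and> card B \<le> N0 \<and> ball z (r / 2 ^ n) \<subseteq> (\<Union>w\<in>B. ball w (r / 2 ^ n / 2))"
      using r by (intro allI N0) simp
    then obtain B where B: "\<And>z :: 'a. finite (B z) \<and> card (B z) \<le> N0 \<and> ball z (r / 2 ^ n) \<subseteq> (\<Union>w\<in>B z. ball w (r / 2 ^ n / 2))"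
      by (drule_tac choice) blast
    have "card (\<Union>z\<in>A. B z) \<le> (\<Sum>z\<in>A. card (B z))" by (rule card_UN_le[OF A(1)])
    also have "\<dots> \<le> (\<Sum>z\<in>A. N0)" using B by (intro sum_mono) auto
    also have "\<dots> \<le> N * N0" using A by simp
    finally have "card (\<Union>z\<in>A. B z) \<le> N * N0" .
    moreover have "ball x r \<subseteq> (\<Union>w\<in>(\<Union>z\<in>A. B z). ball w (r / 2 ^ Suc n))"
    proof
      fix y assume "y \<in> ball x r"
      then obtain z where z: "z \<in> A" "y \<in> ball z (r / 2 ^ n)" using A by blast
      then obtain w where "w \<in> B z" "y \<in> ball w (r / 2 ^ n / 2)" using B by blast
      then show "y \<in> (\<Union>w\<in>(\<Union>z\<in>A. B z). ball w (r / 2 ^ Suc n))" using z by (auto simp: field_simps)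
    qed
    ultimately show "\<exists>A. finite A \<and> card A \<le> N * N0 \<and> ball x r \<subseteq> (\<Union>z\<in>A. ball z (r / 2 ^ Suc n))"
      using A(1) B by blast
  qed
qed

lemma finite_cover:
  assumes "0 < e"
  obtains A where "finite A" "ball (x :: 'a) r \<subseteq> (\<Union>z\<in>A. ball z e)"
proof -
  define R where "R = max r 1"
  obtain n where n: "R / e < 2 ^ n" using real_arch_pow[of 2 "R / e"] by auto
  obtain A where A: "finite A" "ball x R \<subseteq> (\<Union>z\<in>A. ball z (R / 2 ^ n))"
    using iterated_cover[of n] by (metis R_def less_max_iff_disj zero_less_one)
  have "R / 2 ^ n \<le> e" using n assms by (simp add: field_simps)
  then have "(\<Union>z\<in>A. ball z (R / 2 ^ n)) \<subseteq> (\<Union>z\<in>A. ball z e)" by (intro UN_mono subset_ball) auto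
  moreover have "ball x r \<subseteq> ball x R" by (intro subset_ball) (simp add: R_def)
  ultimately show ?thesis using A that by (meson subset_trans)
qed

definition dense_points :: "'a set" where
  "dense_points = (SOME D. countable D \<and> (\<forall>x. \<forall>e>0. \<exists>z\<in>D. dist x z < e))"

text \<open>Balls of integer radius about one point exhaust the space, and each of them has finite
  nets of every mesh \<open>1 / Suc m\<close>.\<close>

lemma dense_points:
  shows countable_dense_points: "countable dense_points"
    and dense_pointsE: "0 < e \<Longrightarrow> \<exists>z\<in>dense_points. dist x z < e"
proof -
  fix c :: 'a
  have "\<exists>A. finite A \<and> ball c (real n) \<subseteq> (\<Union>z\<in>A. ball z (1 / real (Suc m)))" for n m
  proof -
    obtain A where "finite A" "ball c (real n) \<subseteq> (\<Union>z\<in>A. ball z (1 / real (Suc m)))"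
      by (rule finite_cover[of "1 / real (Suc m)" c "real n"]) simp_all
    then show ?thesis by blast
  qed
  then obtain A where A: "\<And>n m. finite (A n m)" "\<And>n m. ball c (real n) \<subseteq> (\<Union>z\<in>A n m. ball z (1 / real (Suc m)))"
    by metis
  have "\<exists>D. countable D \<and> (\<forall>x. \<forall>e>0. \<exists>z\<in>D. dist (x::'a) z < e)"
  proof (intro exI[of _ "\<Union>n m. A n m"] conjI allI impI)
    show "countable (\<Union>n m. A n m)" using A(1) by (simp add: countable_finite)
  next
    fix x :: 'a and e :: real assume e: "0 < e"
    obtain n where "dist c x < real n" using reals_Archimedean2 by blast
    moreover obtain m where m: "1 / real (Suc m) < e" using nat_approx_posE[OF e] by auto
    ultimately obtain z where "z \<in> A n m" "x \<in> ball z (1 / real (Suc m))" using A(2)[of n m] by auto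
    then show "\<exists>z\<in>(\<Union>n m. A n m). dist x z < e" using m by (force simp: dist_commute)
  qed
  then have "countable dense_points \<and> (\<forall>x. \<forall>e>0. \<exists>z\<in>dense_points. dist x z < e)"
    unfolding dense_points_def by (rule someI_ex)
  then show "countable dense_points" "0 < e \<Longrightarrow> \<exists>z\<in>dense_points. dist x z < e" by blast+
qed

text \<open>The type has no second-countability class, so continuity of the metric does not by
  itself give measurability for the product sigma-algebra. Writing the distance as the infimum of
  \<open>dist z x + dist z y\<close> over countably many \<open>z\<close> does.\<close>

lemma measurable_dist_pair [measurable]: "(\<lambda>(x, y). dist x y) \<in> borel_measurable (\<mu> \<Otimes>\<^sub>M \<mu>)"
proof -
  have 1: "(\<lambda>x. dist z x) \<in> borel_measurable \<mu>" for z
    unfolding measurable_mu_borel by (intro borel_measurable_continuous_onI continuous_intros)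
  note [measurable] = 1
  have eq: "ennreal (dist x y) = (INF z\<in>dense_points. ennreal (dist z x + dist z y))" for x y :: 'a
  proof (rule antisym)
    show "ennreal (dist x y) \<le> (INF z\<in>dense_points. ennreal (dist z x + dist z y))"
      by (intro INF_greatest ennreal_leI) (metis dist_commute dist_triangle)
    show "(INF z\<in>dense_points. ennreal (dist z x + dist z y)) \<le> ennreal (dist x y)"
    proof (rule ennreal_le_epsilon)
      fix e :: real assume "0 < e"
      then obtain z where z: "z \<in> dense_points" "dist x z < e / 2" using dense_pointsE[of "e / 2"] by auto
      have "dist z x + dist z y \<le> dist x y + e"
        using z dist_triangle[of z y x] by (simp add: dist_commute)
      then have "ennreal (dist z x + dist z y) \<le> ennreal (dist x y) + ennreal e"
        using \<open>0 < e\<close> by (simp add: ennreal_leI flip: ennreal_plus)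
      then show "(INF z\<in>dense_points. ennreal (dist z x + dist z y)) \<le> ennreal (dist x y) + ennreal e"
        using z(1) by (meson INF_lower2)
    qed
  qed
  have "(\<lambda>(x, y). dist x y) = (\<lambda>p. enn2real (INF z\<in>dense_points. ennreal (dist z (fst p) + dist z (snd p))))"
    by (rule ext) (simp only: eq[symmetric] case_prod_beta' enn2real_ennreal zero_le_dist)
  also have "\<dots> \<in> borel_measurable (\<mu> \<Otimes>\<^sub>M \<mu>)"
    by (intro borel_measurable_enn2real borel_measurable_INF countable_dense_points) measurable
  finally show ?thesis .
qed

lemma measurable_dist_compose [measurable (raw)]:
  assumes "f \<in> measurable M \<mu>" "g \<in> measurable M \<mu>"
  shows "(\<lambda>w. dist (f w) (g w)) \<in> borel_measurable M"
  using measurable_compose[OF measurable_Pair[OF assms] measurable_dist_pair] by simp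

text \<open>The dominating function need not be measurable in its first argument. The kernel below is
  measurable and symmetric, and off the diagonal it is comparable to \<open>1 / lam x (dist x y)\<close>
  at all scales above \<open>1 / 2 ^ N\<close>.\<close>

definition lam_kernel :: "nat \<Rightarrow> 'a \<Rightarrow> 'a \<Rightarrow> ennreal" where
  "lam_kernel N x y = (SUP (z, j)\<in>dense_points \<times> (UNIV :: nat set).
     indicator (ball z (2 ^ j / 2 ^ N)) x * indicator (ball z (2 ^ j / 2 ^ N)) y *
     ennreal (1 / lam z (2 ^ j / 2 ^ N)))"

lemma lam_kernel_measurable [measurable]:
  "(\<lambda>(x, y). lam_kernel N x y) \<in> borel_measurable (\<mu> \<Otimes>\<^sub>M \<mu>)"
proof -
  have "(\<lambda>p. SUP i\<in>dense_points \<times> (UNIV :: nat set).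
     indicator (ball (fst i) (2 ^ snd i / 2 ^ N)) (fst p) * indicator (ball (fst i) (2 ^ snd i / 2 ^ N)) (snd p) *
     ennreal (1 / lam (fst i) (2 ^ snd i / 2 ^ N))) \<in> borel_measurable (\<mu> \<Otimes>\<^sub>M \<mu>)"
    by (intro borel_measurable_SUP countable_SIGMA countable_dense_points) measurable
  then show ?thesis unfolding lam_kernel_def by (simp add: case_prod_beta')
qed

lemma lam_kernel_compose [measurable (raw)]:
  assumes "f \<in> measurable M \<mu>" "g \<in> measurable M \<mu>"
  shows "(\<lambda>w. lam_kernel N (f w) (g w)) \<in> borel_measurable M"
  using measurable_compose[OF measurable_Pair[OF assms] lam_kernel_measurable] by simp

lemma lam_kernel_sym: "lam_kernel N x y = lam_kernel N y x"
  unfolding lam_kernel_def by (simp add: mult_ac)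

lemma lam_kernel_leI:
  assumes "\<And>z j. z \<in> dense_points \<Longrightarrow> dist z x < 2 ^ j / 2 ^ N \<Longrightarrow> dist z y < 2 ^ j / 2 ^ N \<Longrightarrow>
    ennreal (1 / lam z (2 ^ j / 2 ^ N)) \<le> b"
  shows "lam_kernel N x y \<le> b"
  unfolding lam_kernel_def
  by (rule SUP_least) (use assms in \<open>auto simp: indicator_def\<close>)

lemma lam_kernel_gtE:
  assumes "b < lam_kernel N x y"
  obtains z j where "z \<in> dense_points" "dist z x < 2 ^ j / 2 ^ N" "dist z y < 2 ^ j / 2 ^ N"
    "b < ennreal (1 / lam z (2 ^ j / 2 ^ N))"
  using assms lam_kernel_leI[of x N y b] not_le by blast

lemma lam_kernel_geI:
  assumes "z \<in> dense_points" "dist z x < 2 ^ j / 2 ^ N" "dist z y < 2 ^ j / 2 ^ N"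
  shows "ennreal (1 / lam z (2 ^ j / 2 ^ N)) \<le> lam_kernel N x y"
  unfolding lam_kernel_def
  by (rule SUP_upper2[of "(z, j)"]) (use assms in auto)

lemma lam_kernel_Suc: "lam_kernel N x y \<le> lam_kernel (Suc N) x y"
  by (rule lam_kernel_leI) (use lam_kernel_geI[of _ x "Suc _" "Suc N" y] in simp)

lemma lam_kernel_mono: "incseq (\<lambda>N. lam_kernel N x y)"
  by (intro incseq_SucI lam_kernel_Suc)

text \<open>Every ball in the supremum contains \<open>x\<close> and \<open>y\<close> and has radius
  at least \<open>1 / 2 ^ N\<close>, so twice its radius dominates \<open>r\<close>. One factor
  \<open>C_lam\<close> pays for halving the radius, the other for moving the centre.\<close>

lemma lam_kernel_le:
  assumes r: "0 < r" "r \<le> max (dist x y) (1 / 2 ^ N)"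
  shows "lam_kernel N x y \<le> ennreal (C_lam\<^sup>2 / lam x r)"
proof (rule lam_kernel_leI)
  fix z j assume z: "dist z x < 2 ^ j / 2 ^ N" "dist z y < 2 ^ j / 2 ^ N"
  define u :: real where "u = 2 ^ j / 2 ^ N"
  have u: "0 < u" "1 / 2 ^ N \<le> u" by (simp_all add: u_def divide_right_mono)
  have "dist x y \<le> 2 * u" using z dist_triangle[of x y z] by (simp add: u_def dist_commute)
  then have "lam x r \<le> lam x (2 * u)" using r u by (intro lam_monoD) auto
  also have "\<dots> \<le> C_lam * lam x u" using C_lam(2)[of "2 * u" x] u by simp
  also have "\<dots> \<le> C_lam * (C_lam * lam z u)"
    using z C_lam_ge_1 u by (intro mult_left_mono C_lam(3)) (auto simp: u_def dist_commute)
  finally have "lam x r \<le> C_lam\<^sup>2 * lam z u" by (simp add: power2_eq_square)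
  then have "1 / lam z u \<le> C_lam\<^sup>2 / lam x r" using lam_pos[of u z] lam_pos[of r x] u r by (simp add: field_simps)
  then show "ennreal (1 / lam z (2 ^ j / 2 ^ N)) \<le> ennreal (C_lam\<^sup>2 / lam x r)" by (simp add: u_def ennreal_leI)
qed

lemma lam_kernel_ge:
  assumes d: "1 / 2 ^ N \<le> dist x y"
  shows "ennreal (1 / lam x (dist x y)) \<le> ennreal (C_lam\<^sup>2) * lam_kernel N x y"
proof -
  define d where "d = dist x y"
  have d0: "0 < d" using d by (metis d_def less_le_trans zero_less_divide_1_iff zero_less_numeral zero_less_power)
  have ex: "\<exists>j::nat. d < 2 ^ j / 2 ^ N"
    using real_arch_pow[of 2 "d * 2 ^ N"] by (auto simp: field_simps)
  \<comment> \<open>The least admissible scale is at most twice the distance. Because the distance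
    is at least \<open>1 / 2 ^ N\<close>, it is not the scale 0, so a preceding scale exists for the
    comparison.\<close>
  define j where "j = (LEAST j::nat. d < 2 ^ j / 2 ^ N)"
  have j: "d < 2 ^ j / 2 ^ N" unfolding j_def by (rule LeastI_ex[OF ex])
  have "j \<noteq> 0" using j d by (cases "j = 0") (auto simp: d_def)
  then obtain i where i: "j = Suc i" by (cases j) auto
  have "\<not> d < 2 ^ i / 2 ^ N" using not_less_Least[of i "\<lambda>j. d < 2 ^ j / 2 ^ N"] i j_def by auto
  then have j2: "2 ^ j / 2 ^ N \<le> 2 * d" by (simp add: i)
  define u :: real where "u = 2 ^ j / 2 ^ N"
  have u: "0 < u" "d < u" "u \<le> 2 * d" using j j2 by (auto simp: u_def)
  \<comment> \<open>The slack \<open>u - d\<close> puts both \<open>x\<close> and \<open>y\<close>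
    into the ball of radius \<open>u\<close> about \<open>z\<close>.\<close>
  obtain z where z: "z \<in> dense_points" "dist x z < u - d" using dense_pointsE[of "u - d" x] u by auto
  have zx: "dist z x < u" "dist z y < u"
    using z(2) d0 dist_triangle[of z y x] dist_commute[of x z] unfolding d_def by linarith+
  have "lam z u \<le> C_lam * lam x u" using zx u by (intro C_lam(3)) auto
  also have "\<dots> \<le> C_lam * lam x (2 * d)" using C_lam_ge_1 u by (intro mult_left_mono lam_monoD) auto
  also have "\<dots> \<le> C_lam * (C_lam * lam x d)" using C_lam(2)[of "2 * d" x] d0 C_lam_ge_1 by (intro mult_left_mono) auto
  finally have "1 / lam x d \<le> C_lam\<^sup>2 * (1 / lam z u)"
    using lam_pos[of u z] lam_pos[of d x] u d0 by (simp add: field_simps power2_eq_square)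
  then have "ennreal (1 / lam x d) \<le> ennreal (C_lam\<^sup>2) * ennreal (1 / lam z u)"
    by (simp add: ennreal_leI flip: ennreal_mult')
  also have "\<dots> \<le> ennreal (C_lam\<^sup>2) * lam_kernel N x y"
    unfolding u_def using z zx by (intro mult_left_mono lam_kernel_geI) (auto simp: u_def)
  finally show ?thesis by (simp add: d_def)
qed

text \<open>A ball containing \<open>x\<close> and \<open>y\<close> and one containing
  \<open>x\<close> and \<open>z\<close> intersect; the larger, dilated by 4, contains
  \<open>y\<close> and \<open>z\<close>, is again of dyadic radius, and the dilation costs
  \<open>C_lam\<^sup>2\<close>. The suprema need not be attained, so the argument is by
  contradiction: a strict inequality yields actual balls.\<close>

lemma lam_kernel_quasi_metric:
  "min (lam_kernel N x y) (lam_kernel N x z) \<le> ennreal (C_lam\<^sup>2) * lam_kernel N y z"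
proof (rule ccontr)
  let ?c = "ennreal (C_lam\<^sup>2) * lam_kernel N y z"
  assume "\<not> ?thesis"
  then have "?c < lam_kernel N x y" "?c < lam_kernel N x z" by (auto simp: not_le)
  then obtain w1 i1 w2 i2 where w:
    "w1 \<in> dense_points" "dist w1 x < 2 ^ i1 / 2 ^ N" "dist w1 y < 2 ^ i1 / 2 ^ N" "?c < ennreal (1 / lam w1 (2 ^ i1 / 2 ^ N))"
    "w2 \<in> dense_points" "dist w2 x < 2 ^ i2 / 2 ^ N" "dist w2 z < 2 ^ i2 / 2 ^ N" "?c < ennreal (1 / lam w2 (2 ^ i2 / 2 ^ N))"
    by (elim lam_kernel_gtE)
  have *: False
    if w: "w1 \<in> dense_points" "dist w1 x < 2 ^ i1 / 2 ^ N" "dist w1 y < 2 ^ i1 / 2 ^ N"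
      "w2 \<in> dense_points" "dist w2 x < 2 ^ i2 / 2 ^ N" "dist w2 z < 2 ^ i2 / 2 ^ N"
      "ennreal (C_lam\<^sup>2) * lam_kernel N y z < ennreal (1 / lam w2 (2 ^ i2 / 2 ^ N))"
      "i1 \<le> i2" for w1 x i1 y w2 i2 z
  proof -
    define u :: real where "u = 2 ^ i2 / 2 ^ N"
    have u: "0 < u" by (simp add: u_def)
    have "(2 ^ i1 / 2 ^ N :: real) \<le> u" unfolding u_def using that(8) by (intro divide_right_mono power_increasing) auto
    then have "dist w1 x < u" "dist w1 y < u" "dist w2 x < u" "dist w2 z < u" using w by (auto simp: u_def)
    moreover have "dist w2 y \<le> dist w2 x + dist w1 x + dist w1 y"
      using dist_triangle[of w2 y x] dist_triangle[of x y w1] by (simp add: dist_commute)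
    ultimately have d: "dist w2 y < 4 * u" "dist w2 z < 4 * u" using u by auto
    have 4: "4 * u = 2 ^ (i2 + 2) / 2 ^ N" by (simp add: u_def)
    have "lam w2 (4 * u) \<le> C_lam\<^sup>2 * lam w2 u" using lam_pow[OF u, of w2 2] by simp
    then have "1 / lam w2 u \<le> C_lam\<^sup>2 * (1 / lam w2 (4 * u))"
      using lam_pos[of u w2] lam_pos[of "4 * u" w2] u by (simp add: field_simps)
    then have "ennreal (1 / lam w2 u) \<le> ennreal (C_lam\<^sup>2) * ennreal (1 / lam w2 (4 * u))"
      by (simp add: ennreal_leI flip: ennreal_mult')
    also have "\<dots> \<le> ennreal (C_lam\<^sup>2) * lam_kernel N y z"
      unfolding 4 using w(4) d[unfolded 4] by (intro mult_left_mono lam_kernel_geI) auto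
    finally show False using w(7) by (simp add: u_def)
  qed
  show False
  proof (cases "i1 \<le> i2")
    case True
    then show False using *[of w1 x i1 y w2 i2 z] w by simp
  next
    case False
    then show False
      using *[of w2 x i2 z w1 i1 y] w by (simp add: lam_kernel_sym[of _ z y])
  qed
qed

text \<open>On a ball about \<open>c\<close> the values \<open>lam x (1 / 2 ^ N)\<close> stay away
  from 0: at a scale exceeding \<open>R\<close> they are comparable with the value at
  \<open>c\<close>, and descending to the cut-off scale costs \<open>m\<close> factors
  \<open>C_lam\<close>.\<close>

lemma lam_kernel_bounded:
  "\<exists>b. \<forall>x\<in>ball c R. \<forall>y. lam_kernel N x y \<le> ennreal b"
proof -
  define e :: real where "e = 1 / 2 ^ N"
  have e: "0 < e" by (simp add: e_def)
  obtain m where "R / e < 2 ^ m" using real_arch_pow[of 2 "R / e"] by auto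
  then have m: "R \<le> 2 ^ m * e" using e by (simp add: field_simps)
  define u where "u = lam c (2 ^ m * e) / (C_lam * C_lam ^ m)"
  have u: "0 < u" using lam_pos[of "2 ^ m * e" c] e C_lam_ge_1 by (auto simp: u_def)
  show ?thesis
  proof (intro exI ballI allI)
    fix x y assume "x \<in> ball c R"
    then have "lam c (2 ^ m * e) \<le> C_lam * lam x (2 ^ m * e)"
      using m e by (intro C_lam(3)) auto
    also have "\<dots> \<le> C_lam * (C_lam ^ m * lam x e)"
      using C_lam_ge_1 lam_pow[OF e] by (intro mult_left_mono) auto
    finally have "u \<le> lam x e" using C_lam_ge_1 by (simp add: u_def field_simps)
    then have "C_lam\<^sup>2 / lam x e \<le> C_lam\<^sup>2 / u" using u by (intro divide_left_mono) auto
    moreover have "lam_kernel N x y \<le> ennreal (C_lam\<^sup>2 / lam x e)"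
      using e by (intro lam_kernel_le) (auto simp: e_def)
    ultimately show "lam_kernel N x y \<le> ennreal (C_lam\<^sup>2 / u)" by (meson ennreal_leI order_trans)
  qed
qed

end

section \<open>The bilinear bound\<close>

text \<open>Membership of \<open>i\<close> and non-membership of \<open>j\<close> fix two of
  \<open>n\<close> binary choices. This quarter is the loss in the averaging over
  splittings.\<close>

lemma card_subsets_separating:
  assumes "i < n" "j < n" "i \<noteq> j"
  shows "4 * card {I \<in> Pow {..<n}. i \<in> I \<and> j \<notin> I} = 2 ^ n"
proof -
  have "bij_betw (insert i) (Pow ({..<n} - {i, j})) {I \<in> Pow {..<n}. i \<in> I \<and> j \<notin> I}"
    using assms by (intro bij_betw_byWitness[where f'="\<lambda>I. I - {i}"]) auto
  then have "card {I \<in> Pow {..<n}. i \<in> I \<and> j \<notin> I} = card (Pow ({..<n} - {i, j}))"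
    by (rule bij_betw_same_card[symmetric])
  also have "\<dots> = 2 ^ (n - 2)" using assms by (simp add: card_Pow card_Diff_subset)
  finally have "card {I \<in> Pow {..<n}. i \<in> I \<and> j \<notin> I} = 2 ^ (n - 2)" .
  moreover have "2 \<le> n" using assms by linarith
  then obtain m where "n = m + 2" using le_Suc_ex[of 2 n] by auto
  ultimately show ?thesis by simp
qed

context nonhomogeneous_space begin

lemma lam_kernel_section_measurable [measurable]: "lam_kernel N x \<in> borel_measurable \<mu>"
  using measurable_compose[OF measurable_Pair1' lam_kernel_measurable, of x] by (simp add: space_mu)

lemma dist_measurable [measurable]: "dist x \<in> borel_measurable \<mu>"
  using measurable_compose[OF measurable_Pair1' measurable_dist_pair, of x] by (simp add: space_mu)

text \<open>The spheres about \<open>z\<close> are the level sets of the distance from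
  \<open>z\<close>. Pushed forward to the line, \<open>\<mu>\<close> restricted to a ball is a
  finite measure and has only countably many atoms, while the interval of radii is
  uncountable.\<close>

lemma exists_null_sphere:
  assumes "a < b"
  shows "\<exists>r. a < r \<and> r < b \<and> (AE y in \<mu>. dist z y \<noteq> r)"
proof -
  define N where "N = distr (density \<mu> (indicator (ball z b))) borel (dist z)"
  have fin: "finite_measure (density \<mu> (indicator (ball z b)))"
    using emeasure_ball_finite[of z b]
    by (intro finite_measureI, subst emeasure_density) (auto simp: space_mu sets_mu)
  interpret N: finite_measure N unfolding N_def
    by (rule finite_measure.finite_measure_distr[OF fin]) simp
  have "uncountable {a<..<b}" using assms by (simp add: uncountable_open_interval)
  then have "\<not> {a<..<b} \<subseteq> {r. measure N {r} \<noteq> 0}" using N.countable_support countable_subset by blast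
  then obtain r where r: "a < r" "r < b" "measure N {r} = 0" by auto
  then have "emeasure N {r} = 0" by (simp add: N.emeasure_eq_measure)
  also have "emeasure N {r} = emeasure (density \<mu> (indicator (ball z b))) (dist z -` {r})"
    unfolding N_def by (subst emeasure_distr) (auto simp: space_mu)
  also have "\<dots> = emeasure \<mu> (ball z b \<inter> dist z -` {r})"
    using measurable_sets[OF dist_measurable, of "{r}" z]
    by (subst emeasure_density) (auto simp: space_mu indicator_inter_arith[symmetric])
  also have "ball z b \<inter> dist z -` {r} = {y \<in> space \<mu>. \<not> dist z y \<noteq> r}" using r by (auto simp: space_mu)
  finally have "AE y in \<mu>. dist z y \<noteq> r"
    by (intro AE_I[where N="{y \<in> space \<mu>. \<not> dist z y \<noteq> r}"]) auto
  with r show ?thesis by blast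
qed

text \<open>The formula for the operator is available only off a closed support, and disjoint cells
  may have touching closures. Cutting along null spheres puts almost every point into the interior
  of its own cell, hence off the closure of any union of other cells.\<close>

lemma exists_cell_index:
  assumes "0 < e"
  obtains ix :: "'a \<Rightarrow> nat" and n where
    "ix \<in> measurable \<mu> (count_space UNIV)"
    "\<And>x. x \<in> ball c R \<Longrightarrow> ix x < n"
    "\<And>x y. ix x < n \<Longrightarrow> ix x = ix y \<Longrightarrow> dist x y < e"
    "\<And>I. AE x in \<mu>. ix x < n \<longrightarrow> ix x \<notin> I \<longrightarrow> x \<notin> closure {y. ix y \<in> I}"
proof -
  obtain A where A: "finite A" "ball c R \<subseteq> (\<Union>z\<in>A. ball z (e / 4))"
    using finite_cover[of "e / 4" c R] assms by auto
  obtain z and n :: nat where z: "A = z ` {..<n}"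
    using finite_imp_nat_seg_image_inj_on[OF A(1)] by (metis lessThan_def)
  have "\<forall>i. \<exists>r. e / 4 < r \<and> r < e / 2 \<and> (AE y in \<mu>. dist (z i) y \<noteq> r)"
    using assms by (intro allI exists_null_sphere) auto
  then obtain r where r: "\<And>i. e / 4 < r i" "\<And>i. r i < e / 2" "\<And>i. AE y in \<mu>. dist (z i) y \<noteq> r i"
    by metis
  \<comment> \<open>A point belongs to the cell of the first ball containing it. The disjunct
    \<open>n \<le> i\<close> makes the least index exist; the index \<open>n\<close> collects the
    points outside all balls.\<close>
  define P where "P x i \<longleftrightarrow> n \<le> i \<or> x \<in> ball (z i) (r i)" for x i
  define ix where "ix x = (LEAST i. P x i)" for x
  have Pix: "P x (ix x)" for x unfolding ix_def by (rule LeastI[of _ n]) (simp add: P_def)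
  have ixI: "ix x = i" if "P x i" "\<And>j. j < i \<Longrightarrow> \<not> P x j" for x i
    unfolding ix_def using that by (intro Least_equality) (auto simp: not_less[symmetric])
  have notP: "\<not> P x j" if "j < ix x" for x j using that not_less_Least unfolding ix_def by blast
  show ?thesis
  proof
    show "ix \<in> measurable \<mu> (count_space UNIV)"
      unfolding ix_def by (rule measurable_Least) (unfold P_def, measurable)
    show "ix x < n" if x: "x \<in> ball c R" for x
    proof -
      obtain i where i: "i < n" "x \<in> ball (z i) (e / 4)" using A x z by auto
      then have "P x i" using r(1)[of i] by (auto simp: P_def)
      then have "ix x \<le> i" unfolding ix_def by (rule Least_le)
      then show ?thesis using i by simp
    qed
    show "dist x y < e" if "ix x < n" "ix x = ix y" for x y
    proof -
      have "x \<in> ball (z (ix x)) (r (ix x))" "y \<in> ball (z (ix x)) (r (ix x))"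
        using Pix[of x] Pix[of y] that by (auto simp: P_def)
      then show ?thesis using r(2)[of "ix x"] dist_triangle[of x y "z (ix x)"] by (auto simp: dist_commute)
    qed
    show "AE x in \<mu>. ix x < n \<longrightarrow> ix x \<notin> I \<longrightarrow> x \<notin> closure {y. ix y \<in> I}" for I
    proof -
      have "AE x in \<mu>. \<forall>i. dist (z i) x \<noteq> r i" using r(3) by (simp add: AE_all_countable)
      then show ?thesis
      proof (eventually_elim, intro impI notI)
        fix x assume x: "\<forall>i. dist (z i) x \<noteq> r i" "ix x < n" "ix x \<notin> I" "x \<in> closure {y. ix y \<in> I}"
        \<comment> \<open>The open part of the cell of \<open>x\<close>: its ball without the
          earlier closed balls. It contains \<open>x\<close> because \<open>x\<close> lies on none
          of the spheres.\<close>
        define U where "U = ball (z (ix x)) (r (ix x)) - (\<Union>i<ix x. cball (z i) (r i))"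
        have "open U" unfolding U_def by (intro open_Diff closed_UN) auto
        moreover have "x \<in> U" using Pix[of x] notP[of _ x] x unfolding U_def P_def
          by (auto simp: order_le_less)
        ultimately have "U \<inter> {y. ix y \<in> I} \<noteq> {}" using x(4) open_Int_closure_eq_empty by blast
        then obtain y where y: "y \<in> U" "ix y \<in> I" by auto
        have "\<not> P y j" if "j < ix x" for j
        proof -
          have "y \<notin> cball (z j) (r j)" using y(1) that by (auto simp: U_def)
          then show ?thesis using that x(2) by (auto simp: P_def)
        qed
        then have "ix y = ix x" using y(1) by (intro ixI) (auto simp: U_def P_def)
        then show False using y x by simp
      qed
    qed
  qed
qed

text \<open>For nonnegative \<open>f\<close> there is no cancellation, so the norm of the complex
  integral is the integral of the positive integrand, and this dominates the kernel up to
  \<open>C_lam\<^sup>2\<close>.\<close>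

lemma lam_kernel_section_le_T_lam:
  fixes f :: "'a \<Rightarrow> real"
  assumes f [measurable]: "f \<in> borel_measurable \<mu>" and f0: "\<And>y. 0 \<le> f y" and fb: "\<And>y. f y \<le> b"
    and supp: "\<And>y. y \<notin> ball c R \<Longrightarrow> f y = 0" and x: "x \<notin> closure {y. f y \<noteq> 0}"
  shows "(\<integral>\<^sup>+y. lam_kernel N x y * ennreal (f y) \<partial>\<mu>)
    \<le> ennreal (C_lam\<^sup>2 * norm (T_lam \<mu> lam (\<lambda>y. complex_of_real (f y)) x))"
proof -
  obtain d where d: "0 < d" "ball x d \<inter> {y. f y \<noteq> 0} = {}"
  proof -
    obtain e where e: "0 < e" "\<And>y. f y \<noteq> 0 \<Longrightarrow> \<not> dist y x < e"
      using x unfolding closure_approachable by auto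
    then have "ball x e \<inter> {y. f y \<noteq> 0} = {}"
      by (metis (mono_tags, lifting) disjoint_iff dist_commute mem_Collect_eq mem_ball)
    then show ?thesis using that e(1) by blast
  qed
  \<comment> \<open>Extension by 0 makes the dominating function monotone on the whole line, hence
    Borel in the radius.\<close>
  define L where "L r = (if 0 < r then lam x r else 0)" for r
  have "mono L" using lam_monoD lam_pos by (auto simp: mono_def L_def less_eq_real_def[of 0])
  then have [measurable]: "L \<in> borel_measurable borel" by (rule borel_measurable_mono)
  define h where "h y = f y / L (dist x y)" for y
  have [measurable]: "h \<in> borel_measurable \<mu>" unfolding h_def by measurable
  have far: "d \<le> dist x y" if "f y \<noteq> 0" for y using d that by (force simp: not_less[symmetric])
  have b0: "0 \<le> b" using f0 fb by (meson order_trans)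
  have h: "0 \<le> h y" "h y \<le> b / lam x d * indicator (ball c R) y" for y
  proof -
    show "0 \<le> h y" using f0[of y] lam_pos[of "dist x y" x] by (auto simp: h_def L_def less_eq_real_def)
    show "h y \<le> b / lam x d * indicator (ball c R) y"
    proof (cases "f y = 0")
      case True then show ?thesis using b0 lam_pos[OF d(1), of x] by (auto simp: h_def indicator_def)
    next
      case False
      then have "0 < dist x y" "y \<in> ball c R" using far[OF False] d supp by (force, blast)
      moreover have "f y / lam x (dist x y) \<le> b / lam x d"
        using far[OF False] d fb b0 lam_pos[of d x] lam_monoD[of d "dist x y" x]
        by (intro frac_le) auto
      ultimately show ?thesis by (simp add: h_def L_def)
    qed
  qed
  \<comment> \<open>Integrability must be checked since a non-integrable function would have
    integral 0 by convention. It holds because \<open>f\<close> is bounded, supported in a ball, and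
    vanishes within distance \<open>d\<close> of \<open>x\<close>.\<close>
  have int: "integrable \<mu> h"
  proof (rule Bochner_Integration.integrable_bound)
    show "integrable \<mu> (\<lambda>y. b / lam x d * indicator (ball c R) y)"
      using emeasure_ball_finite[of c R] by simp
    show "AE y in \<mu>. norm (h y) \<le> norm (b / lam x d * indicator (ball c R) y)"
      by (intro AE_I2) (metis abs_of_nonneg h order_trans real_norm_def)
  qed simp
  have "T_lam \<mu> lam (\<lambda>y. complex_of_real (f y)) x = (LINT y|\<mu>. complex_of_real (h y))"
    unfolding T_lam_def
  proof (rule Bochner_Integration.integral_cong)
    fix y show "complex_of_real (f y) / complex_of_real (lam x (dist x y)) = complex_of_real (h y)"
      using far[of y] d by (cases "f y = 0") (auto simp: h_def L_def)
  qed simp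
  also have "\<dots> = complex_of_real (LINT y|\<mu>. h y)" by (rule integral_complex_of_real)
  finally have T: "norm (T_lam \<mu> lam (\<lambda>y. complex_of_real (f y)) x) = (LINT y|\<mu>. h y)"
    using h by (simp add: abs_of_nonneg)
  have "(\<integral>\<^sup>+y. lam_kernel N x y * ennreal (f y) \<partial>\<mu>) \<le> (\<integral>\<^sup>+y. ennreal (C_lam\<^sup>2) * ennreal (h y) \<partial>\<mu>)"
  proof (rule nn_integral_mono)
    fix y
    show "lam_kernel N x y * ennreal (f y) \<le> ennreal (C_lam\<^sup>2) * ennreal (h y)"
    proof (cases "f y = 0")
      case False
      then have dy: "0 < dist x y" using far d by force
      have "lam_kernel N x y * ennreal (f y) \<le> ennreal (C_lam\<^sup>2 / lam x (dist x y)) * ennreal (f y)"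
        by (intro mult_right_mono lam_kernel_le) (use dy in auto)
      also have "\<dots> = ennreal (C_lam\<^sup>2) * ennreal (h y)"
        using dy f0[of y] lam_pos[OF dy, of x] by (simp add: h_def L_def flip: ennreal_mult')
      finally show ?thesis .
    qed simp
  qed
  also have "\<dots> = ennreal (C_lam\<^sup>2 * (LINT y|\<mu>. h y))"
    using int h by (simp add: nn_integral_cmult nn_integral_eq_integral ennreal_mult')
  finally show ?thesis by (simp add: T)
qed

definition T_lam_L2 :: "(('a \<Rightarrow> complex) \<Rightarrow> 'a \<Rightarrow> complex) \<Rightarrow> real \<Rightarrow> bool" where
  "T_lam_L2 T C \<longleftrightarrow>
     (\<forall>f\<in>L2_space \<mu>. T f \<in> L2_space \<mu> \<and> L2_fun_norm \<mu> (T f) \<le> C * L2_fun_norm \<mu> f) \<and>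
     (\<forall>f\<in>Linf_c \<mu>. AE x in \<mu>. x \<notin> supp f \<longrightarrow> T f x = T_lam \<mu> lam f x)"

text \<open>Almost everywhere on the set where \<open>g\<close> is nonzero, \<open>T\<close> is
  given by its integral formula and dominates the potential of \<open>f\<close>. The product of
  \<open>g\<close> with it is estimated by the sum of squares; \<open>1 + C\<^sup>2\<close> covers
  both terms. A later rescaling of \<open>f\<close> recovers a norm bound from this additive
  form.\<close>

lemma lam_kernel_separated_bound:
  fixes f g :: "'a \<Rightarrow> real"
  assumes T: "T_lam_L2 T C"
    and f [measurable]: "f \<in> borel_measurable \<mu>" and f0: "\<And>y. 0 \<le> f y" and fb: "\<And>y. f y \<le> b"
    and supp: "\<And>y. y \<notin> ball c R \<Longrightarrow> f y = 0"
    and g [measurable]: "g \<in> borel_measurable \<mu>" and g0: "\<And>y. 0 \<le> g y"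
    and sep: "AE x in \<mu>. g x \<noteq> 0 \<longrightarrow> x \<notin> closure {y. f y \<noteq> 0}"
  shows "(\<integral>\<^sup>+x. ennreal (g x) * (\<integral>\<^sup>+y. lam_kernel N x y * ennreal (f y) \<partial>\<mu>) \<partial>\<mu>)
    \<le> ennreal (C_lam\<^sup>2 * (1 + C\<^sup>2)) * ((\<integral>\<^sup>+y. ennreal ((f y)\<^sup>2) \<partial>\<mu>) + (\<integral>\<^sup>+x. ennreal ((g x)\<^sup>2) \<partial>\<mu>))"
proof -
  let ?F = "(\<integral>\<^sup>+y. ennreal ((f y)\<^sup>2) \<partial>\<mu>)"
  let ?G = "(\<integral>\<^sup>+x. ennreal ((g x)\<^sup>2) \<partial>\<mu>)"
  let ?Sf = "\<lambda>x. (\<integral>\<^sup>+y. lam_kernel N x y * ennreal (f y) \<partial>\<mu>)"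
  define h where "h y = complex_of_real (f y)" for y
  have [measurable]: "h \<in> borel_measurable \<mu>" unfolding h_def by measurable
  have b0: "0 \<le> b" using f0 fb by (meson order_trans)
  have "integrable \<mu> (\<lambda>y. (f y)\<^sup>2)"
  proof (rule Bochner_Integration.integrable_bound)
    show "integrable \<mu> (\<lambda>y. b\<^sup>2 * indicator (ball c R) y)"
      using emeasure_ball_finite[of c R] by simp
    have "(f y)\<^sup>2 \<le> b\<^sup>2 * indicator (ball c R) y" for y
      using supp[of y] f0 fb by (cases "y \<in> ball c R") (auto intro: power_mono)
    then show "AE y in \<mu>. norm ((f y)\<^sup>2) \<le> norm (b\<^sup>2 * indicator (ball c R) y)" by simp
  qed simp
  note f2 = this
  then have h2: "h \<in> L2_space \<mu>" by (simp add: L2_space_def h_def norm_mult)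
  have supp_h: "supp h = closure {y. f y \<noteq> 0}" by (simp add: supp_def h_def)
  have "h \<in> Linf_c \<mu>"
  proof -
    have "{y. f y \<noteq> 0} \<subseteq> cball c R" using supp by force
    then have "closure {y. f y \<noteq> 0} \<subseteq> cball c R" by (simp add: closure_minimal)
    also have "\<dots> \<subseteq> ball c (R + 1)" by auto
    finally have "supp h \<subseteq> ball c (R + 1)" by (simp add: supp_h)
    moreover have "AE x in \<mu>. norm (h x) \<le> b" using f0 fb by (simp add: h_def abs_of_nonneg)
    ultimately show ?thesis unfolding Linf_c_def by auto
  qed
  then have Th: "AE x in \<mu>. x \<notin> supp h \<longrightarrow> T h x = T_lam \<mu> lam h x"
    and TL2: "T h \<in> L2_space \<mu>" "L2_fun_norm \<mu> (T h) \<le> C * L2_fun_norm \<mu> h"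
    using T h2 by (auto simp: T_lam_L2_def)
  have [measurable]: "T h \<in> borel_measurable \<mu>" and iT: "integrable \<mu> (\<lambda>x. (norm (T h x))\<^sup>2)"
    using TL2(1) by (auto simp: L2_space_def)
  let ?H = "(\<integral>\<^sup>+x. ennreal ((norm (T h x))\<^sup>2) \<partial>\<mu>)"
  have "(L2_fun_norm \<mu> (T h))\<^sup>2 \<le> (C * L2_fun_norm \<mu> h)\<^sup>2"
    using TL2(2) by (intro power_mono) (auto simp: L2_fun_norm_def)
  then have "(LINT x|\<mu>. (norm (T h x))\<^sup>2) \<le> C\<^sup>2 * (LINT x|\<mu>. (f x)\<^sup>2)"
    by (simp add: L2_fun_norm_def power_mult_distrib h_def)
  then have nT: "?H \<le> ennreal (C\<^sup>2) * ?F"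
    using iT f2 by (simp add: nn_integral_eq_integral ennreal_leI flip: ennreal_mult')
  have "(\<integral>\<^sup>+x. ennreal (g x) * ?Sf x \<partial>\<mu>)
    \<le> (\<integral>\<^sup>+x. ennreal (C_lam\<^sup>2) * (ennreal ((g x)\<^sup>2) + ennreal ((norm (T h x))\<^sup>2)) \<partial>\<mu>)"
  proof (rule nn_integral_mono_AE)
    from sep Th show "AE x in \<mu>. ennreal (g x) * ?Sf x
      \<le> ennreal (C_lam\<^sup>2) * (ennreal ((g x)\<^sup>2) + ennreal ((norm (T h x))\<^sup>2))"
    proof eventually_elim
      fix x assume x: "g x \<noteq> 0 \<longrightarrow> x \<notin> closure {y. f y \<noteq> 0}" "x \<notin> supp h \<longrightarrow> T h x = T_lam \<mu> lam h x"
      show "ennreal (g x) * ?Sf x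
        \<le> ennreal (C_lam\<^sup>2) * (ennreal ((g x)\<^sup>2) + ennreal ((norm (T h x))\<^sup>2))"
      proof (cases "g x = 0")
        case False
        then have xs: "x \<notin> closure {y. f y \<noteq> 0}" using x by simp
        have "?Sf x \<le> ennreal (C_lam\<^sup>2 * norm (T h x))"
        proof -
          have "T h x = T_lam \<mu> lam h x" using x(2) xs by (simp add: supp_h)
          moreover have "h = (\<lambda>y. complex_of_real (f y))" by (rule ext) (simp add: h_def)
          ultimately show ?thesis
            using lam_kernel_section_le_T_lam[of f b c R x N, OF f f0 fb supp xs] by simp
        qed
        then have "ennreal (g x) * ?Sf x
          \<le> ennreal (g x) * ennreal (C_lam\<^sup>2 * norm (T h x))" by (rule mult_left_mono) simp
        also have "\<dots> = ennreal (C_lam\<^sup>2 * (g x * norm (T h x)))"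
          using g0[of x] by (simp add: ennreal_mult'[symmetric] mult_ac)
        also have "\<dots> \<le> ennreal (C_lam\<^sup>2 * ((g x)\<^sup>2 + (norm (T h x))\<^sup>2))"
          using sum_squares_bound[of "g x" "norm (T h x)"] g0[of x]
          by (intro ennreal_leI mult_left_mono) (auto intro: order_trans[rotated])
        also have "\<dots> = ennreal (C_lam\<^sup>2) * (ennreal ((g x)\<^sup>2) + ennreal ((norm (T h x))\<^sup>2))"
          by (simp add: ennreal_mult')
        finally show ?thesis .
      qed simp
    qed
  qed
  also have "\<dots> = ennreal (C_lam\<^sup>2) * (?G + ?H)"
    by (simp add: nn_integral_cmult nn_integral_add)
  also have "\<dots> \<le> ennreal (C_lam\<^sup>2) * (ennreal (1 + C\<^sup>2) * ?G + ennreal (1 + C\<^sup>2) * ?F)"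
  proof (intro mult_left_mono add_mono)
    have "1 * ?G \<le> ennreal (1 + C\<^sup>2) * ?G"
      by (intro mult_right_mono) (auto simp flip: ennreal_1 intro: ennreal_leI)
    then show "?G \<le> ennreal (1 + C\<^sup>2) * ?G" by simp
    show "?H \<le> ennreal (1 + C\<^sup>2) * ?F"
      by (rule order_trans[OF nT]) (intro mult_right_mono ennreal_leI, auto)
  qed auto
  also have "\<dots> = ennreal (C_lam\<^sup>2 * (1 + C\<^sup>2)) * (?F + ?G)"
    by (subst ennreal_mult') (auto simp: distrib_left mult.assoc add.commute simp del: ennreal_plus)
  finally show ?thesis .
qed

text \<open>Schur's test: with \<open>e = 1 / 2 ^ N\<close>, the kernel on the ball of radius
  \<open>e\<close> about \<open>x\<close> is at most \<open>C_lam\<^sup>2 / lam x e\<close>, and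
  that ball has measure at most \<open>lam x e\<close>. So each row, and by symmetry each column,
  has integral at most \<open>C_lam\<^sup>2\<close>.\<close>

lemma lam_kernel_near_bound:
  fixes f g :: "'a \<Rightarrow> real"
  assumes f [measurable]: "f \<in> borel_measurable \<mu>" and f0: "\<And>y. 0 \<le> f y"
    and g [measurable]: "g \<in> borel_measurable \<mu>" and g0: "\<And>y. 0 \<le> g y"
  shows "(\<integral>\<^sup>+x. \<integral>\<^sup>+y. lam_kernel N x y * (if dist x y < 1 / 2 ^ N then ennreal (f y * g x) else 0) \<partial>\<mu> \<partial>\<mu>)
    \<le> ennreal (C_lam\<^sup>2) * ((\<integral>\<^sup>+y. ennreal ((f y)\<^sup>2) \<partial>\<mu>) + (\<integral>\<^sup>+x. ennreal ((g x)\<^sup>2) \<partial>\<mu>))"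
proof -
  interpret pair_sigma_finite \<mu> \<mu> ..
  define e :: real where "e = 1 / 2 ^ N"
  have e: "0 < e" by (simp add: e_def)
  define k where "k x y = lam_kernel N x y * (if dist x y < e then 1 else 0)" for x y
  have [measurable]: "(\<lambda>(x, y). k x y) \<in> borel_measurable (\<mu> \<Otimes>\<^sub>M \<mu>)"
    unfolding k_def case_prod_beta' by measurable
  have k_section [measurable]: "k x \<in> borel_measurable \<mu>" for x
    unfolding k_def by measurable
  have ksym: "k x y = k y x" for x y by (simp add: k_def lam_kernel_sym dist_commute)
  have row: "(\<integral>\<^sup>+y. k x y \<partial>\<mu>) \<le> ennreal (C_lam\<^sup>2)" for x
  proof -
    have "(\<integral>\<^sup>+y. k x y \<partial>\<mu>) \<le> (\<integral>\<^sup>+y. ennreal (C_lam\<^sup>2 / lam x e) * indicator (ball x e) y \<partial>\<mu>)"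
      using lam_kernel_le[of e x _ N] e by (intro nn_integral_mono) (auto simp: k_def e_def)
    also have "\<dots> = ennreal (C_lam\<^sup>2 / lam x e) * emeasure \<mu> (ball x e)" by (simp add: nn_integral_cmult_indicator)
    also have "\<dots> \<le> ennreal (C_lam\<^sup>2 / lam x e) * ennreal (lam x e)" using C_lam(1)[OF e] by (intro mult_left_mono) auto
    also have "\<dots> = ennreal (C_lam\<^sup>2)" using lam_pos[OF e, of x] by (simp flip: ennreal_mult')
    finally show ?thesis .
  qed
  have sq: "(\<integral>\<^sup>+x. \<integral>\<^sup>+y. k x y * ennreal ((u x)\<^sup>2) \<partial>\<mu> \<partial>\<mu>) \<le> ennreal (C_lam\<^sup>2) * (\<integral>\<^sup>+x. ennreal ((u x)\<^sup>2) \<partial>\<mu>)"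
    if [measurable]: "u \<in> borel_measurable \<mu>" for u :: "'a \<Rightarrow> real"
  proof -
    have "(\<integral>\<^sup>+x. \<integral>\<^sup>+y. k x y * ennreal ((u x)\<^sup>2) \<partial>\<mu> \<partial>\<mu>) = (\<integral>\<^sup>+x. (\<integral>\<^sup>+y. k x y \<partial>\<mu>) * ennreal ((u x)\<^sup>2) \<partial>\<mu>)"
      by (intro nn_integral_cong nn_integral_multc k_section)
    also have "\<dots> \<le> (\<integral>\<^sup>+x. ennreal (C_lam\<^sup>2) * ennreal ((u x)\<^sup>2) \<partial>\<mu>)"
      using row by (intro nn_integral_mono mult_right_mono) auto
    also have "\<dots> = ennreal (C_lam\<^sup>2) * (\<integral>\<^sup>+x. ennreal ((u x)\<^sup>2) \<partial>\<mu>)" by (simp add: nn_integral_cmult)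
    finally show ?thesis .
  qed
  have "(\<integral>\<^sup>+x. \<integral>\<^sup>+y. lam_kernel N x y * (if dist x y < e then ennreal (f y * g x) else 0) \<partial>\<mu> \<partial>\<mu>)
     \<le> (\<integral>\<^sup>+x. \<integral>\<^sup>+y. k x y * ennreal ((f y)\<^sup>2) + k x y * ennreal ((g x)\<^sup>2) \<partial>\<mu> \<partial>\<mu>)"
  proof (intro nn_integral_mono)
    fix x y
    have "f y * g x \<le> (f y)\<^sup>2 + (g x)\<^sup>2"
      using sum_squares_bound[of "f y" "g x"] mult_nonneg_nonneg[OF f0[of y] g0[of x]] by linarith
    then have "ennreal (f y * g x) \<le> ennreal ((f y)\<^sup>2) + ennreal ((g x)\<^sup>2)"
      by (simp add: ennreal_leI flip: ennreal_plus)
    then have "k x y * ennreal (f y * g x) \<le> k x y * (ennreal ((f y)\<^sup>2) + ennreal ((g x)\<^sup>2))"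
      by (rule mult_left_mono) simp
    then show "lam_kernel N x y * (if dist x y < e then ennreal (f y * g x) else 0)
      \<le> k x y * ennreal ((f y)\<^sup>2) + k x y * ennreal ((g x)\<^sup>2)"
      by (auto simp: k_def distrib_left)
  qed
  also have "\<dots> = (\<integral>\<^sup>+x. \<integral>\<^sup>+y. k x y * ennreal ((f y)\<^sup>2) \<partial>\<mu> \<partial>\<mu>) + (\<integral>\<^sup>+x. \<integral>\<^sup>+y. k x y * ennreal ((g x)\<^sup>2) \<partial>\<mu> \<partial>\<mu>)"
  proof -
    have "(\<integral>\<^sup>+y. k x y * ennreal ((f y)\<^sup>2) + k x y * ennreal ((g x)\<^sup>2) \<partial>\<mu>) = 
      (\<integral>\<^sup>+y. k x y * ennreal ((f y)\<^sup>2) \<partial>\<mu>) + (\<integral>\<^sup>+y. k x y * ennreal ((g x)\<^sup>2) \<partial>\<mu>)" for x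
      by (intro nn_integral_add borel_measurable_times_ennreal k_section) measurable
    then show ?thesis by (simp add: nn_integral_add)
  qed
  also have "(\<integral>\<^sup>+x. \<integral>\<^sup>+y. k x y * ennreal ((f y)\<^sup>2) \<partial>\<mu> \<partial>\<mu>) = (\<integral>\<^sup>+y. \<integral>\<^sup>+x. k y x * ennreal ((f y)\<^sup>2) \<partial>\<mu> \<partial>\<mu>)"
    by (subst Fubini') (simp_all add: ksym)
  finally show ?thesis using sq[OF f] sq[OF g] unfolding e_def
    by (simp add: distrib_left) (meson add_mono order_trans)
qed

lemma lam_kernel_bilinear_bound:
  fixes f g :: "'a \<Rightarrow> real"
  assumes T: "T_lam_L2 T C"
    and f [measurable]: "f \<in> borel_measurable \<mu>" and f0: "\<And>y. 0 \<le> f y" and fb: "\<And>y. f y \<le> b"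
    and f_supp: "\<And>y. y \<notin> ball c R \<Longrightarrow> f y = 0"
    and g [measurable]: "g \<in> borel_measurable \<mu>" and g0: "\<And>y. 0 \<le> g y"
    and g_supp: "\<And>y. y \<notin> ball c R \<Longrightarrow> g y = 0"
  shows "(\<integral>\<^sup>+x. ennreal (g x) * (\<integral>\<^sup>+y. lam_kernel N x y * ennreal (f y) \<partial>\<mu>) \<partial>\<mu>)
    \<le> ennreal (5 * C_lam\<^sup>2 * (1 + C\<^sup>2)) * ((\<integral>\<^sup>+y. ennreal ((f y)\<^sup>2) \<partial>\<mu>) + (\<integral>\<^sup>+x. ennreal ((g x)\<^sup>2) \<partial>\<mu>))"
proof -
  define D where "D = C_lam\<^sup>2 * (1 + C\<^sup>2)"
  have D: "0 \<le> D" "C_lam\<^sup>2 \<le> D" by (auto simp: D_def algebra_simps)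
  define Q where "Q = (\<integral>\<^sup>+y. ennreal ((f y)\<^sup>2) \<partial>\<mu>) + (\<integral>\<^sup>+x. ennreal ((g x)\<^sup>2) \<partial>\<mu>)"
  \<comment> \<open>The mesh is the cut-off scale of the kernel, so two points of one cell fall
    under the near estimate.\<close>
  define e :: real where "e = 1 / 2 ^ N"
  obtain ix :: "'a \<Rightarrow> nat" and n where ix [measurable]: "ix \<in> measurable \<mu> (count_space UNIV)"
    and ix_less: "\<And>x. x \<in> ball c R \<Longrightarrow> ix x < n"
    and ix_close: "\<And>x y. ix x < n \<Longrightarrow> ix x = ix y \<Longrightarrow> dist x y < e"
    and ix_closure: "\<And>I. AE x in \<mu>. ix x < n \<longrightarrow> ix x \<notin> I \<longrightarrow> x \<notin> closure {y. ix y \<in> I}"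
    using exists_cell_index[of e c R] by (auto simp: e_def)
  define fI where "fI I y = (if ix y \<in> I then f y else 0)" for I y
  define gI where "gI I x = (if ix x \<in> I then 0 else g x)" for I x
  have [measurable]: "fI I \<in> borel_measurable \<mu>" "gI I \<in> borel_measurable \<mu>" for I
    unfolding fI_def gI_def by measurable
  have pull: "(\<integral>\<^sup>+x. ennreal (v x) * (\<integral>\<^sup>+y. lam_kernel N x y * ennreal (u y) \<partial>\<mu>) \<partial>\<mu>) =
     (\<integral>\<^sup>+x. \<integral>\<^sup>+y. lam_kernel N x y * ennreal (u y * v x) \<partial>\<mu> \<partial>\<mu>)"
    if [measurable]: "u \<in> borel_measurable \<mu>" and u0: "\<And>y. 0 \<le> u y" for u v :: "'a \<Rightarrow> real"
    by (intro nn_integral_cong, subst nn_integral_cmult[symmetric])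
       (auto simp: ennreal_mult'[OF u0] mult_ac)
  have cut: "(\<integral>\<^sup>+x. \<integral>\<^sup>+y. lam_kernel N x y * ennreal (fI I y * gI I x) \<partial>\<mu> \<partial>\<mu>) \<le> ennreal D * Q"
    for I :: "nat set"
  proof -
    have "(\<integral>\<^sup>+x. ennreal (gI I x) * (\<integral>\<^sup>+y. lam_kernel N x y * ennreal (fI I y) \<partial>\<mu>) \<partial>\<mu>)
      \<le> ennreal D * ((\<integral>\<^sup>+y. ennreal ((fI I y)\<^sup>2) \<partial>\<mu>) + (\<integral>\<^sup>+x. ennreal ((gI I x)\<^sup>2) \<partial>\<mu>))"
      unfolding D_def
    proof (rule lam_kernel_separated_bound[OF T, where b="max b 0" and c=c and R=R])
      show "AE x in \<mu>. gI I x \<noteq> 0 \<longrightarrow> x \<notin> closure {y. fI I y \<noteq> 0}"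
        using ix_closure[of I]
      proof eventually_elim
        fix x assume x: "ix x < n \<longrightarrow> ix x \<notin> I \<longrightarrow> x \<notin> closure {y. ix y \<in> I}"
        have "closure {y. fI I y \<noteq> 0} \<subseteq> closure {y. ix y \<in> I}"
          by (intro closure_mono) (auto simp: fI_def)
        then show "gI I x \<noteq> 0 \<longrightarrow> x \<notin> closure {y. fI I y \<noteq> 0}"
          using x g_supp[of x] ix_less[of x] by (auto simp: gI_def)
      qed
    qed (use f0 fb f_supp g0 in \<open>auto simp: fI_def gI_def le_max_iff_disj\<close>)
    also have "\<dots> \<le> ennreal D * Q" unfolding Q_def
      by (intro mult_left_mono add_mono nn_integral_mono ennreal_leI) (auto simp: fI_def gI_def)
    also have "(\<integral>\<^sup>+x. ennreal (gI I x) * (\<integral>\<^sup>+y. lam_kernel N x y * ennreal (fI I y) \<partial>\<mu>) \<partial>\<mu>) =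
       (\<integral>\<^sup>+x. \<integral>\<^sup>+y. lam_kernel N x y * ennreal (fI I y * gI I x) \<partial>\<mu> \<partial>\<mu>)"
      by (rule pull) (auto simp: fI_def f0)
    finally show ?thesis .
  qed
  let ?near = "\<lambda>x y. lam_kernel N x y * (if dist x y < e then ennreal (f y * g x) else 0)"
  \<comment> \<open>A set \<open>I\<close> of cells keeps \<open>f\<close> on \<open>I\<close> and
    \<open>g\<close> off \<open>I\<close>. Points of different cells are separated by exactly a
    quarter of the \<open>2 ^ n\<close> sets, so the average must be multiplied by 4.\<close>
  have pointwise: "ennreal (f y * g x) \<le> (if dist x y < e then ennreal (f y * g x) else 0) +
      ennreal (4 / 2 ^ n) * (\<Sum>I\<in>Pow {..<n}. ennreal (fI I y * gI I x))" for x y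
  proof (cases "f y * g x = 0 \<or> dist x y < e")
    case False
    then have ixs: "ix x < n" "ix y < n" "ix x \<noteq> ix y"
      using ix_less f_supp g_supp ix_close[of x y] by auto
    have "(\<Sum>I\<in>Pow {..<n}. fI I y * gI I x) = (\<Sum>I\<in>Pow {..<n}. if ix y \<in> I \<and> ix x \<notin> I then f y * g x else 0)"
      by (intro sum.cong) (auto simp: fI_def gI_def)
    also have "\<dots> = real (card {I \<in> Pow {..<n}. ix y \<in> I \<and> ix x \<notin> I}) * (f y * g x)"
      by (subst sum.inter_filter[symmetric]) auto
    finally have "4 / 2 ^ n * (\<Sum>I\<in>Pow {..<n}. fI I y * gI I x) =
       real (4 * card {I \<in> Pow {..<n}. ix y \<in> I \<and> ix x \<notin> I}) / 2 ^ n * (f y * g x)" by simp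
    also have "\<dots> = f y * g x" using card_subsets_separating[OF ixs(2,1)] ixs(3) by simp
    finally have "ennreal (f y * g x) = ennreal (4 / 2 ^ n) * ennreal (\<Sum>I\<in>Pow {..<n}. fI I y * gI I x)"
      by (simp flip: ennreal_mult')
    also have "ennreal (\<Sum>I\<in>Pow {..<n}. fI I y * gI I x) = (\<Sum>I\<in>Pow {..<n}. ennreal (fI I y * gI I x))"
      by (rule sum_ennreal[symmetric]) (auto simp: fI_def gI_def f0 g0)
    finally show ?thesis using False by simp
  qed auto
  have "(\<integral>\<^sup>+x. ennreal (g x) * (\<integral>\<^sup>+y. lam_kernel N x y * ennreal (f y) \<partial>\<mu>) \<partial>\<mu>)
     = (\<integral>\<^sup>+x. \<integral>\<^sup>+y. lam_kernel N x y * ennreal (f y * g x) \<partial>\<mu> \<partial>\<mu>)" by (rule pull[OF f f0])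
  also have "\<dots> \<le> (\<integral>\<^sup>+x. \<integral>\<^sup>+y. ?near x y +
      ennreal (4 / 2 ^ n) * (\<Sum>I\<in>Pow {..<n}. lam_kernel N x y * ennreal (fI I y * gI I x)) \<partial>\<mu> \<partial>\<mu>)"
  proof (intro nn_integral_mono)
    fix x y
    show "lam_kernel N x y * ennreal (f y * g x) \<le> ?near x y +
      ennreal (4 / 2 ^ n) * (\<Sum>I\<in>Pow {..<n}. lam_kernel N x y * ennreal (fI I y * gI I x))"
      using mult_left_mono[OF pointwise[where x=x and y=y] zero_le[of "lam_kernel N x y"]]
      by (simp only: distrib_left sum_distrib_left mult.left_commute[of "lam_kernel N x y" "ennreal (4 / 2 ^ n)"] zero_le)
  qed
  also have "\<dots> = (\<integral>\<^sup>+x. \<integral>\<^sup>+y. ?near x y \<partial>\<mu> \<partial>\<mu>)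
     + ennreal (4 / 2 ^ n) * (\<Sum>I\<in>Pow {..<n}. \<integral>\<^sup>+x. \<integral>\<^sup>+y. lam_kernel N x y * ennreal (fI I y * gI I x) \<partial>\<mu> \<partial>\<mu>)"
  proof -
    have [measurable]: "(\<lambda>p. dist (fst p) (snd p)) \<in> borel_measurable (\<mu> \<Otimes>\<^sub>M \<mu>)"
      using measurable_dist_pair by (simp add: case_prod_beta')
    have [measurable]: "(\<lambda>p. lam_kernel N (fst p) (snd p)) \<in> borel_measurable (\<mu> \<Otimes>\<^sub>M \<mu>)"
      using lam_kernel_measurable by (simp add: case_prod_beta')
    have m1: "(\<lambda>y. ?near x y) \<in> borel_measurable \<mu>" for x
      by measurable
    have m2: "(\<lambda>(x, y). ?near x y) \<in> borel_measurable (\<mu> \<Otimes>\<^sub>M \<mu>)"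
      unfolding case_prod_beta' by measurable
    have m3: "(\<lambda>y. lam_kernel N x y * ennreal (fI I y * gI I x)) \<in> borel_measurable \<mu>" for x I by measurable
    have m4: "(\<lambda>(x, y). lam_kernel N x y * ennreal (fI I y * gI I x)) \<in> borel_measurable (\<mu> \<Otimes>\<^sub>M \<mu>)" for I
      unfolding case_prod_beta' by measurable
    note [measurable] = borel_measurable_nn_integral[OF m2] borel_measurable_nn_integral[OF m4]
    show ?thesis
      by (simp add: nn_integral_add nn_integral_cmult nn_integral_sum m1 m3)
  qed
  \<comment> \<open>The near part contributes \<open>D\<close> and the average \<open>4 * D\<close>,
    whatever the number of cells; this is the 5 in the statement.\<close>
  also have "\<dots> \<le> ennreal D * Q + ennreal (4 / 2 ^ n) * (\<Sum>I\<in>Pow {..<n}. ennreal D * Q)"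
  proof (intro add_mono mult_left_mono sum_mono cut)
    show "(\<integral>\<^sup>+x. \<integral>\<^sup>+y. ?near x y \<partial>\<mu> \<partial>\<mu>) \<le> ennreal D * Q"
      unfolding e_def using lam_kernel_near_bound[OF f f0 g g0, of N] D(2)
      unfolding Q_def[symmetric] by (meson ennreal_leI mult_right_mono order_trans zero_le)
  qed simp
  also have "\<dots> = ennreal D * Q + ennreal (4 / 2 ^ n) * ennreal (2 ^ n) * (ennreal D * Q)"
    by (simp add: card_Pow mult.assoc ennreal_power[symmetric])
  also have "ennreal (4 / 2 ^ n) * ennreal (2 ^ n) = 4" by (simp flip: ennreal_mult')
  also have "ennreal D * Q + 4 * (ennreal D * Q) = (1 + 4) * (ennreal D * Q)" by (simp only: distrib_right mult_1)
  also have "\<dots> = ennreal (5 * D) * Q" using D(1) by (simp add: ennreal_mult mult.assoc)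
  finally show ?thesis by (simp add: D_def Q_def mult.assoc)
qed

section \<open>The bound on Lebesgue spaces\<close>

text \<open>One index cuts off small scales and distant points together. The indicators in both
  variables preserve symmetry and the quasi-metric condition, the latter with the constant
  \<open>C_lam\<^sup>2\<close> for every \<open>n\<close>.\<close>

definition truncated_kernel :: "'a \<Rightarrow> nat \<Rightarrow> 'a \<Rightarrow> 'a \<Rightarrow> real" where
  "truncated_kernel c n x y =
     enn2real (lam_kernel n x y) * indicator (ball c (real n)) x * indicator (ball c (real n)) y"

abbreviation ball_measure :: "'a \<Rightarrow> nat \<Rightarrow> 'a measure" where
  "ball_measure c n \<equiv> density \<mu> (indicator (ball c (real n)))"

lemma lam_kernel_finite: "lam_kernel N x y < \<infinity>"
  using lam_kernel_le[of "1 / 2 ^ N" x y N] by (auto intro: le_less_trans)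

lemma quasi_metric_truncated_kernel:
  "quasi_metric_kernel (ball_measure c n) (truncated_kernel c n) (C_lam\<^sup>2)"
proof -
  interpret finite_measure "ball_measure c n"
    using emeasure_ball_finite[of c "real n"]
    by (intro finite_measureI, subst emeasure_density) (auto simp: space_mu sets_mu)
  show ?thesis
  proof
    have [measurable]: "(\<lambda>p. lam_kernel n (fst p) (snd p)) \<in> borel_measurable (\<mu> \<Otimes>\<^sub>M \<mu>)"
      using lam_kernel_measurable by (simp add: case_prod_beta')
    have "(\<lambda>(x, y). truncated_kernel c n x y) \<in> borel_measurable (\<mu> \<Otimes>\<^sub>M \<mu>)"
      unfolding truncated_kernel_def case_prod_beta' by measurable
    also have "borel_measurable (\<mu> \<Otimes>\<^sub>M \<mu>) = borel_measurable (ball_measure c n \<Otimes>\<^sub>M ball_measure c n)"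
      by (intro measurable_cong_sets sets_pair_measure_cong) auto
    finally show "(\<lambda>(x, y). truncated_kernel c n x y) \<in> borel_measurable (ball_measure c n \<Otimes>\<^sub>M ball_measure c n)" .
    show "0 \<le> truncated_kernel c n x y" for x y by (simp add: truncated_kernel_def)
    show "\<exists>b. \<forall>x y. truncated_kernel c n x y \<le> b"
    proof -
      obtain b where b: "\<And>x y. x \<in> ball c (real n) \<Longrightarrow> lam_kernel n x y \<le> ennreal b"
        using lam_kernel_bounded[of c "real n" n] by blast
      have "truncated_kernel c n x y \<le> max b 0" for x y
      proof (cases "x \<in> ball c (real n)")
        case True
        have "enn2real (lam_kernel n x y) \<le> max b 0"
          using b[OF True, of y] by (intro enn2real_leI) (auto intro: order_trans ennreal_leI)
        then show ?thesis by (auto simp: truncated_kernel_def indicator_def)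
      qed (simp add: truncated_kernel_def)
      then show ?thesis by blast
    qed
    show "truncated_kernel c n x y = truncated_kernel c n y x" for x y
      by (simp add: truncated_kernel_def lam_kernel_sym mult_ac)
    show "min (truncated_kernel c n x y) (truncated_kernel c n x z) \<le> C_lam\<^sup>2 * truncated_kernel c n y z" for x y z
    proof -
      have "enn2real (min (lam_kernel n x y) (lam_kernel n x z)) \<le> enn2real (ennreal (C_lam\<^sup>2) * lam_kernel n y z)"
        using lam_kernel_finite[of n y z]
        by (intro enn2real_mono lam_kernel_quasi_metric) (auto simp: ennreal_mult_less_top)
      moreover have "enn2real (min (lam_kernel n x y) (lam_kernel n x z)) = min (enn2real (lam_kernel n x y)) (enn2real (lam_kernel n x z))"
        using lam_kernel_finite[of n x y] lam_kernel_finite[of n x z]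
        by (auto simp: min_def enn2real_mono dest: enn2real_mono intro: antisym)
      ultimately show ?thesis
        by (auto simp: truncated_kernel_def indicator_def enn2real_mult)
    qed
    show "1 \<le> C_lam\<^sup>2" using C_lam_ge_1 by (simp add: one_le_power)
  qed
qed

lemma measurable_ball_measure: "borel_measurable (ball_measure c n) = borel_measurable \<mu>"
  by (rule measurable_cong_sets) auto

lemma ennreal_truncated_potential:
  assumes f: "f \<in> quasi_metric_kernel.bounded_nonneg (ball_measure c n)"
    and x: "x \<in> ball c (real n)"
  shows "ennreal (quasi_metric_kernel.potential (ball_measure c n) (truncated_kernel c n) f x) =
    (\<integral>\<^sup>+y. lam_kernel n x y * ennreal (f y * indicator (ball c (real n)) y) \<partial>\<mu>)"
proof -
  interpret K: quasi_metric_kernel "ball_measure c n" "truncated_kernel c n" "C_lam\<^sup>2"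
    by (rule quasi_metric_truncated_kernel)
  have "(\<lambda>y. truncated_kernel c n x y * f y) \<in> K.bounded_nonneg"
    by (intro K.bounded_nonneg_mult K.k_section_bounded_nonneg f) (simp add: space_mu)
  note b = this K.bounded_nonneg_measurable[OF this, unfolded measurable_ball_measure]
  note [measurable] = b(2)
  have "ennreal (K.potential f x) = (\<integral>\<^sup>+y. ennreal (truncated_kernel c n x y * f y) \<partial>ball_measure c n)"
    unfolding K.potential_def
    using K.bounded_nonnegD[OF b(1)] by (intro nn_integral_eq_integral[symmetric] K.integrable_bounded_nonneg b) auto
  also have "\<dots> = (\<integral>\<^sup>+y. indicator (ball c (real n)) y * ennreal (truncated_kernel c n x y * f y) \<partial>\<mu>)"
    by (rule nn_integral_density) auto
  also have "\<dots> = (\<integral>\<^sup>+y. lam_kernel n x y * ennreal (f y * indicator (ball c (real n)) y) \<partial>\<mu>)"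
    using x lam_kernel_finite[of n x] K.bounded_nonnegD[OF f]
    by (intro nn_integral_cong) (auto simp: indicator_def truncated_kernel_def ennreal_mult'')
  finally show ?thesis .
qed

text \<open>The bilinear bound is applied to \<open>t * f\<close> and to the potential of
  \<open>f\<close>. With \<open>X\<close> and \<open>Y\<close> the squared norms of the potential
  and of \<open>f\<close> it reads \<open>t * X \<le> D * (t\<^sup>2 * Y + X)\<close>; for
  \<open>t = 2 * D\<close> the finite \<open>X\<close> is absorbed and
  \<open>X \<le> 4 * D\<^sup>2 * Y\<close> remains.\<close>

lemma truncated_kernel_L2_bound:
  assumes T: "T_lam_L2 T C"
  shows "quasi_metric_kernel.Lp_bound (ball_measure c n) (truncated_kernel c n) 2
    (4 * (5 * C_lam\<^sup>2 * (1 + C\<^sup>2))\<^sup>2)"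
proof -
  interpret K: quasi_metric_kernel "ball_measure c n" "truncated_kernel c n" "C_lam\<^sup>2"
    by (rule quasi_metric_truncated_kernel)
  define D where "D = 5 * C_lam\<^sup>2 * (1 + C\<^sup>2)"
  have D: "0 < D" using C_lam_ge_1 by (auto simp: D_def zero_less_mult_iff add_pos_nonneg)
  let ?I = "indicator (ball c (real n)) :: 'a \<Rightarrow> real"
  have int_eq: "(\<integral>\<^sup>+x. ennreal ((u x * ?I x)\<^sup>2) \<partial>\<mu>) = ennreal (LINT x|ball_measure c n. (u x)\<^sup>2)"
    if u: "u \<in> K.bounded_nonneg" for u
  proof -
    have u2: "(\<lambda>x. u x * u x) \<in> K.bounded_nonneg" by (intro K.bounded_nonneg_mult u)
    note [measurable] = K.bounded_nonneg_measurable[OF u2, unfolded measurable_ball_measure]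
    have "ennreal (LINT x|ball_measure c n. (u x)\<^sup>2) = (\<integral>\<^sup>+x. ennreal (u x * u x) \<partial>ball_measure c n)"
      unfolding power2_eq_square
      by (intro nn_integral_eq_integral[symmetric] K.integrable_bounded_nonneg u2) auto
    also have "\<dots> = (\<integral>\<^sup>+x. indicator (ball c (real n)) x * ennreal (u x * u x) \<partial>\<mu>)"
      by (rule nn_integral_density) auto
    also have "\<dots> = (\<integral>\<^sup>+x. ennreal ((u x * ?I x)\<^sup>2) \<partial>\<mu>)"
      by (intro nn_integral_cong) (auto simp: indicator_def power2_eq_square)
    finally show ?thesis by simp
  qed
  show ?thesis unfolding K.Lp_bound_def D_def[symmetric]
  proof
    fix f assume f: "f \<in> K.bounded_nonneg"
    let ?w = "K.potential f"
    have w: "?w \<in> K.bounded_nonneg" by (rule K.potential_bounded_nonneg[OF f])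
    note [measurable] = K.bounded_nonneg_measurable[OF f, unfolded measurable_ball_measure]
      K.bounded_nonneg_measurable[OF w, unfolded measurable_ball_measure]
    obtain b where b: "0 \<le> b" "\<And>x. f x \<le> b" using K.bounded_nonneg_bound[OF f] by blast
    define X where "X = (LINT x|ball_measure c n. (?w x)\<^sup>2)"
    define Y where "Y = (LINT x|ball_measure c n. (f x)\<^sup>2)"
    have XY: "0 \<le> X" "0 \<le> Y" by (auto simp: X_def Y_def)
    define t where "t = 2 * D"
    have t: "0 < t" using D by (simp add: t_def)
    define F where "F y = t * f y * ?I y" for y
    have tf: "(\<lambda>y. t * f y) \<in> K.bounded_nonneg" using t by (intro K.bounded_nonneg_scale f) auto
    have "(\<integral>\<^sup>+x. ennreal (?w x * ?I x) * (\<integral>\<^sup>+y. lam_kernel n x y * ennreal (F y) \<partial>\<mu>) \<partial>\<mu>)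
      \<le> ennreal D * ((\<integral>\<^sup>+y. ennreal ((F y)\<^sup>2) \<partial>\<mu>) + (\<integral>\<^sup>+x. ennreal ((?w x * ?I x)\<^sup>2) \<partial>\<mu>))"
      unfolding D_def F_def
      using K.bounded_nonnegD[OF f] K.bounded_nonnegD[OF w] t b
      by (intro lam_kernel_bilinear_bound[OF T, where b="t * b" and c=c and R="real n"])
         (auto simp: indicator_def)
    also have "(\<integral>\<^sup>+y. ennreal ((F y)\<^sup>2) \<partial>\<mu>) = ennreal (t\<^sup>2 * Y)"
      using int_eq[OF tf] by (simp add: F_def power_mult_distrib Y_def mult_ac)
    also have "(\<integral>\<^sup>+x. ennreal ((?w x * ?I x)\<^sup>2) \<partial>\<mu>) = ennreal X" using int_eq[OF w] by (simp add: X_def)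
    also have "ennreal D * (ennreal (t\<^sup>2 * Y) + ennreal X) = ennreal (D * (t\<^sup>2 * Y + X))"
      using XY D by (simp add: ennreal_mult' ennreal_plus)
    also have "(\<integral>\<^sup>+x. ennreal (?w x * ?I x) * (\<integral>\<^sup>+y. lam_kernel n x y * ennreal (F y) \<partial>\<mu>) \<partial>\<mu>)
       = (\<integral>\<^sup>+x. ennreal t * ennreal ((?w x * ?I x)\<^sup>2) \<partial>\<mu>)"
    proof (rule nn_integral_cong)
      fix x
      show "ennreal (?w x * ?I x) * (\<integral>\<^sup>+y. lam_kernel n x y * ennreal (F y) \<partial>\<mu>) = ennreal t * ennreal ((?w x * ?I x)\<^sup>2)"
      proof (cases "x \<in> ball c (real n)")
        case True
        have "(\<integral>\<^sup>+y. lam_kernel n x y * ennreal (F y) \<partial>\<mu>) = (\<integral>\<^sup>+y. ennreal t * (lam_kernel n x y * ennreal (f y * ?I y)) \<partial>\<mu>)"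
          using t K.bounded_nonnegD[OF f] by (intro nn_integral_cong) (simp add: F_def mult_ac ennreal_mult')
        also have "\<dots> = ennreal t * (\<integral>\<^sup>+y. lam_kernel n x y * ennreal (f y * ?I y) \<partial>\<mu>)"
          by (rule nn_integral_cmult) measurable
        also have "\<dots> = ennreal t * ennreal (?w x)" using ennreal_truncated_potential[OF f True] by simp
        finally show ?thesis
          using True t K.bounded_nonnegD[OF w, of x]
          by (simp add: power2_eq_square mult.left_commute flip: ennreal_mult')
      qed simp
    qed
    also have "\<dots> = ennreal (t * X)"
      using int_eq[OF w] t XY by (simp add: nn_integral_cmult X_def ennreal_mult')
    finally have "t * X \<le> D * (t\<^sup>2 * Y + X)" using XY D by (subst (asm) ennreal_le_iff) auto
    then have "X \<le> 4 * D\<^sup>2 * Y" using D by (simp add: t_def algebra_simps power2_eq_square)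
    then show "(LINT x|ball_measure c n. ?w x powr 2) \<le> 4 * D\<^sup>2 * (LINT x|ball_measure c n. f x powr 2)"
      using K.bounded_nonnegD[OF f] K.bounded_nonnegD[OF w] by (simp add: X_def Y_def)
  qed
qed

text \<open>The operator \<open>S\<close> of the overview with a measurable substitute for its
  kernel. Values in \<open>ennreal\<close> make it meaningful before its finiteness is
  known.\<close>

definition lam_potential :: "('a \<Rightarrow> real) \<Rightarrow> 'a \<Rightarrow> ennreal" where
  "lam_potential u x = (\<integral>\<^sup>+y. (SUP N. lam_kernel N x y) * ennreal (u y) \<partial>\<mu>)"

lemma lam_potential_measurable [measurable]:
  assumes [measurable]: "u \<in> borel_measurable \<mu>"
  shows "lam_potential u \<in> borel_measurable \<mu>"
proof -
  have [measurable]: "(\<lambda>p. lam_kernel N (fst p) (snd p)) \<in> borel_measurable (\<mu> \<Otimes>\<^sub>M \<mu>)" for N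
    using lam_kernel_measurable by (simp add: case_prod_beta')
  have "(\<lambda>(x, y). (SUP N. lam_kernel N x y) * ennreal (u y)) \<in> borel_measurable (\<mu> \<Otimes>\<^sub>M \<mu>)"
    unfolding case_prod_beta' by measurable
  from borel_measurable_nn_integral[OF this] show ?thesis by (simp add: lam_potential_def[abs_def])
qed

text \<open>The truncated operators share one constant, and the truncated potentials increase to the
  full one, so monotone convergence transfers the bound.\<close>

lemma lam_potential_Lp:
  assumes T: "T_lam_L2 T C" and p: "1 < p"
  obtains A where "0 \<le> A"
    "\<And>u. u \<in> borel_measurable \<mu> \<Longrightarrow> (\<And>x. 0 \<le> u x) \<Longrightarrow> (\<integral>\<^sup>+x. ennreal (u x powr p) \<partial>\<mu>) < \<infinity> \<Longrightarrow>
       (AE x in \<mu>. lam_potential u x < \<infinity>) \<and>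
       (\<integral>\<^sup>+x. ennreal (enn2real (lam_potential u x) powr p) \<partial>\<mu>) \<le> ennreal A * (\<integral>\<^sup>+x. ennreal (u x powr p) \<partial>\<mu>)"
proof -
  fix c :: 'a
  obtain B where B: "\<And>(M :: 'a measure) k. quasi_metric_kernel M k (C_lam\<^sup>2) \<Longrightarrow>
           quasi_metric_kernel.Lp_bound M k 2 (4 * (5 * C_lam\<^sup>2 * (1 + C\<^sup>2))\<^sup>2) \<Longrightarrow>
           quasi_metric_kernel.Lp_bound M k p B"
    using Lp_bound_gt_1[OF p, of "4 * (5 * C_lam\<^sup>2 * (1 + C\<^sup>2))\<^sup>2" "C_lam\<^sup>2"] by auto
  define A where "A = max B 0"
  have A: "0 \<le> A" by (simp add: A_def)
  have Lp: "quasi_metric_kernel.Lp_bound (ball_measure c n) (truncated_kernel c n) p A" for n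
    by (rule quasi_metric_kernel.Lp_bound_mono[OF quasi_metric_truncated_kernel
          B[OF quasi_metric_truncated_kernel truncated_kernel_L2_bound[OF T]]]) (simp add: A_def)
  show ?thesis
  proof (rule that[OF A], goal_cases)
    case (1 u)
    note u0 = 1(2)
    note [measurable] = 1(1)
    define U where "U = (\<integral>\<^sup>+x. ennreal (u x powr p) \<partial>\<mu>)"
    \<comment> \<open>Height, support and kernel are truncated with the same \<open>n\<close>, so
      the potentials \<open>v n\<close> form a single increasing sequence.\<close>
    define a where "a n y = min (u y) (real n) * indicator (ball c (real n)) y" for n y
    have a0: "0 \<le> a n y" "a n y \<le> real n" "a n y \<le> u y" for n y using u0[of y] by (auto simp: a_def indicator_def)
    have [measurable]: "a n \<in> borel_measurable \<mu>" for n unfolding a_def by measurable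
    define v where "v n x = indicator (ball c (real n)) x * (\<integral>\<^sup>+y. lam_kernel n x y * ennreal (a n y) \<partial>\<mu>)" for n x
    let ?w = "\<lambda>n x y. indicator (ball c (real n)) x * (lam_kernel n x y * ennreal (a n y))"
    have v_eq: "v n x = (\<integral>\<^sup>+y. ?w n x y \<partial>\<mu>)" for n x
      unfolding v_def by (rule nn_integral_cmult[symmetric]) measurable
    have ind_mono: "indicator (ball c (real n)) x \<le> (indicator (ball c (real (Suc n))) x :: 'b :: linordered_semidom)" for n x
      by (auto simp: indicator_def)
    have a_mono: "a n y \<le> a (Suc n) y" for n y
      unfolding a_def using u0[of y] by (intro mult_mono ind_mono) auto
    have inner_mono: "?w n x y
       \<le> indicator (ball c (real (Suc n))) x * (lam_kernel (Suc n) x y * ennreal (a (Suc n) y))" for n x y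
      by (intro mult_mono lam_kernel_Suc ennreal_leI a_mono) (auto simp: indicator_def)
    have v_mono: "incseq (\<lambda>n. v n x)" for x
      unfolding v_eq by (intro incseq_SucI nn_integral_mono inner_mono)
    have v_sup: "(SUP n. v n x) = lam_potential u x" for x
    proof -
      have "(SUP n. v n x) = (\<integral>\<^sup>+y. (SUP n. ?w n x y) \<partial>\<mu>)"
        unfolding v_eq
        by (intro nn_integral_monotone_convergence_SUP[symmetric] incseq_SucI le_funI inner_mono) measurable
      also have "\<dots> = lam_potential u x" unfolding lam_potential_def
      proof (rule nn_integral_cong)
        fix y
        have "lam_kernel m x y * ennreal (u y) \<le> (SUP n. ?w n x y)" for m
        proof -
          obtain k :: nat where "max (max (dist c x) (dist c y)) (u y) < real k" using reals_Archimedean2 by blast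
          then have "lam_kernel m x y * ennreal (u y) \<le> indicator (ball c (real (max m k))) x * (lam_kernel (max m k) x y * ennreal (a (max m k) y))"
            using incseqD[OF lam_kernel_mono[of x y], of m "max m k"]
            by (auto simp: a_def intro!: mult_right_mono)
          then show ?thesis by (meson SUP_upper2 UNIV_I)
        qed
        moreover have "?w n x y \<le> (SUP N. lam_kernel N x y) * ennreal (u y)" for n
          using mult_mono[OF SUP_upper[of n UNIV "\<lambda>N. lam_kernel N x y"] ennreal_leI[OF a0(3)[of n y]]]
          by (auto simp: indicator_def)
        ultimately show "(SUP n. ?w n x y) = (SUP N. lam_kernel N x y) * ennreal (u y)"
          by (intro antisym) (auto intro!: SUP_least simp: SUP_mult_right_ennreal)
      qed
      finally show ?thesis .
    qed
    have step: "(\<forall>x. v n x < \<infinity>) \<and> v n \<in> borel_measurable \<mu> \<and> (\<integral>\<^sup>+x. ennreal (enn2real (v n x) powr p) \<partial>\<mu>) \<le> ennreal A * U" for n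
    proof -
      interpret K: quasi_metric_kernel "ball_measure c n" "truncated_kernel c n" "C_lam\<^sup>2"
        by (rule quasi_metric_truncated_kernel)
      have a: "a n \<in> K.bounded_nonneg"
        using a0 by (intro K.bounded_nonnegI[where b="real n"]) (auto simp: measurable_ball_measure)
      have v: "v n x = ennreal (indicator (ball c (real n)) x * K.potential (a n) x)" for x
        using ennreal_truncated_potential[OF a, of x] by (auto simp: v_def a_def indicator_def intro!: nn_integral_cong)
      have w: "K.potential (a n) \<in> K.bounded_nonneg" by (rule K.potential_bounded_nonneg[OF a])
      note [measurable] = K.bounded_nonneg_measurable[OF w, unfolded measurable_ball_measure]
      have p0: "0 \<le> p" using p by simp
      have "(\<integral>\<^sup>+x. ennreal (enn2real (v n x) powr p) \<partial>\<mu>) = (\<integral>\<^sup>+x. indicator (ball c (real n)) x * ennreal (K.potential (a n) x powr p) \<partial>\<mu>)"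
        using K.bounded_nonnegD[OF w] p by (intro nn_integral_cong) (auto simp: v indicator_def)
      also have "\<dots> = (\<integral>\<^sup>+x. ennreal (K.potential (a n) x powr p) \<partial>ball_measure c n)"
        by (rule nn_integral_density[symmetric]) auto
      also have "\<dots> = ennreal (LINT x|ball_measure c n. K.potential (a n) x powr p)"
        by (intro nn_integral_eq_integral K.integrable_bounded_nonneg K.bounded_nonneg_powr w p0) auto
      also have "\<dots> \<le> ennreal (A * (LINT x|ball_measure c n. a n x powr p))"
        using Lp[of n] a unfolding K.Lp_bound_def by (intro ennreal_leI) blast
      also have "\<dots> = ennreal A * (\<integral>\<^sup>+x. ennreal (a n x powr p) \<partial>ball_measure c n)"
        unfolding ennreal_mult'[OF A]
        by (subst nn_integral_eq_integral) (auto intro!: K.integrable_bounded_nonneg K.bounded_nonneg_powr a p0)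
      also have "(\<integral>\<^sup>+x. ennreal (a n x powr p) \<partial>ball_measure c n) = (\<integral>\<^sup>+x. indicator (ball c (real n)) x * ennreal (a n x powr p) \<partial>\<mu>)"
        by (rule nn_integral_density) auto
      also have "ennreal A * \<dots> \<le> ennreal A * U" unfolding U_def
        using a0 p by (intro mult_left_mono nn_integral_mono) (auto simp: indicator_def intro!: ennreal_leI powr_mono2)
      finally have "(\<integral>\<^sup>+x. ennreal (enn2real (v n x) powr p) \<partial>\<mu>) \<le> ennreal A * U" .
      moreover have "v n \<in> borel_measurable \<mu>" unfolding v by measurable
      ultimately show ?thesis by (simp add: v)
    qed
    note [measurable] = step[THEN conjunct2, THEN conjunct1]
    define V where "V x = (SUP n. ennreal (enn2real (v n x) powr p))" for x
    have [measurable]: "V \<in> borel_measurable \<mu>" unfolding V_def by measurable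
    have "(\<integral>\<^sup>+x. V x \<partial>\<mu>) = (SUP n. \<integral>\<^sup>+x. ennreal (enn2real (v n x) powr p) \<partial>\<mu>)" unfolding V_def
    proof (rule nn_integral_monotone_convergence_SUP)
      show "incseq (\<lambda>n x. ennreal (enn2real (v n x) powr p))"
        using step p incseqD[OF v_mono] by (auto simp: incseq_def le_fun_def intro!: ennreal_leI powr_mono2 enn2real_mono)
    qed measurable
    also have "\<dots> \<le> ennreal A * U" using step by (auto intro: SUP_least)
    finally have V: "(\<integral>\<^sup>+x. V x \<partial>\<mu>) \<le> ennreal A * U" .
    also have "\<dots> < \<infinity>" using 1(3) by (simp add: U_def ennreal_mult_less_top)
    finally have "AE x in \<mu>. V x \<noteq> \<infinity>" by (intro nn_integral_noteq_infinite) auto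
    \<comment> \<open>\<open>enn2real\<close> maps infinity to 0, so an integral bound for the
      right-hand potential would not show finiteness. It is read off from the supremum
      \<open>V\<close> of the powers, which is finite almost everywhere.\<close>
    then have *: "AE x in \<mu>. lam_potential u x < \<infinity> \<and> ennreal (enn2real (lam_potential u x) powr p) \<le> V x"
    proof eventually_elim
      fix x assume Vx: "V x \<noteq> \<infinity>"
      define W where "W = enn2real (V x)"
      have W: "V x = ennreal W" "0 \<le> W" using Vx by (auto simp: W_def less_top)
      have "v n x \<le> ennreal (W powr (1 / p))" for n
      proof -
        have "ennreal (enn2real (v n x) powr p) \<le> ennreal W"
          unfolding W(1)[symmetric] V_def by (rule SUP_upper) simp
        then have "enn2real (v n x) powr p \<le> W" using W by simp
        then have "(enn2real (v n x) powr p) powr (1 / p) \<le> W powr (1 / p)" using p by (intro powr_mono2) auto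
        then have "enn2real (v n x) \<le> W powr (1 / p)" using p by (simp add: powr_powr)
        moreover have "v n x = ennreal (enn2real (v n x))" using step[of n] by simp
        ultimately show ?thesis by (metis ennreal_leI)
      qed
      then have le: "lam_potential u x \<le> ennreal (W powr (1 / p))" unfolding v_sup[symmetric] by (rule SUP_least)
      then have "enn2real (lam_potential u x) \<le> W powr (1 / p)" by (rule enn2real_leI[rotated]) simp
      then have "enn2real (lam_potential u x) powr p \<le> (W powr (1 / p)) powr p" using p by (intro powr_mono2) auto
      also have "\<dots> = W" using p W by (simp add: powr_powr)
      finally show "lam_potential u x < \<infinity> \<and> ennreal (enn2real (lam_potential u x) powr p) \<le> V x"
        using le W by (auto simp: ennreal_leI intro: le_less_trans)
    qed
    have "(\<integral>\<^sup>+x. ennreal (enn2real (lam_potential u x) powr p) \<partial>\<mu>) \<le> (\<integral>\<^sup>+x. V x \<partial>\<mu>)"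
      using * by (intro nn_integral_mono_AE) auto
    also note V
    finally show ?case using * unfolding U_def by auto
  qed
qed

section \<open>Doubling\<close>

lemma G_dec_decreasing:
  assumes "\<phi> \<in> G_dec \<mu> \<delta>" "1 < e"
  shows "\<exists>c>0. \<forall>x\<^sub>1 r\<^sub>1 x\<^sub>2 r\<^sub>2. 0 < r\<^sub>1 \<longrightarrow> 0 < r\<^sub>2 \<longrightarrow> ball x\<^sub>1 r\<^sub>1 \<subseteq> ball x\<^sub>2 r\<^sub>2 \<longrightarrow>
    c * (\<phi> x\<^sub>2 r\<^sub>2 * measure \<mu> (ball x\<^sub>2 (e * r\<^sub>2)) powr \<delta>) \<le> \<phi> x\<^sub>1 r\<^sub>1 * measure \<mu> (ball x\<^sub>1 (e * r\<^sub>1)) powr \<delta>"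
  using assms(1)[unfolded G_dec_def mem_Collect_eq, THEN conjunct2, THEN conjunct2, rule_format, OF assms(2)]
  by (elim exE conjE) (rule exI, rule conjI, assumption, simp)

lemma G_dec_increasing:
  assumes "\<phi> \<in> G_dec \<mu> \<delta>" "1 < e"
  shows "\<exists>C>0. \<forall>x\<^sub>1 r\<^sub>1 x\<^sub>2 r\<^sub>2. 0 < r\<^sub>1 \<longrightarrow> 0 < r\<^sub>2 \<longrightarrow> ball x\<^sub>1 r\<^sub>1 \<subseteq> ball x\<^sub>2 r\<^sub>2 \<longrightarrow>
    \<phi> x\<^sub>1 r\<^sub>1 * measure \<mu> (ball x\<^sub>1 (e * r\<^sub>1)) \<le> C * (\<phi> x\<^sub>2 r\<^sub>2 * measure \<mu> (ball x\<^sub>2 (e * r\<^sub>2)))"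
  using assms(1)[unfolded G_dec_def mem_Collect_eq, THEN conjunct2, THEN conjunct2, rule_format, OF assms(2)]
  by (elim exE conjE) (rule exI, rule conjI, assumption, simp)

lemma G_dec_pos: "\<phi> \<in> G_dec \<mu> \<delta> \<Longrightarrow> 0 < r \<Longrightarrow> 0 < \<phi> x r"
  by (auto simp: G_dec_def)

text \<open>The decreasing condition bounds the measure of a large ball by that of a small one
  inside it, up to positive factors. Hence either all balls are null or none is, and the doubling
  argument may divide by measures.\<close>

lemma G_dec_measure_ball_zero:
  assumes \<phi>: "\<phi> \<in> G_dec \<mu> \<delta>" and r: "0 < r" and 0: "measure \<mu> (ball x r) = 0"
  shows "measure \<mu> (ball y s) = 0"
proof -
  obtain c where c: "0 < c" and
    *: "\<And>x\<^sub>1 r\<^sub>1 x\<^sub>2 r\<^sub>2. 0 < r\<^sub>1 \<Longrightarrow> 0 < r\<^sub>2 \<Longrightarrow> ball x\<^sub>1 r\<^sub>1 \<subseteq> ball x\<^sub>2 r\<^sub>2 \<Longrightarrow>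
       c * (\<phi> x\<^sub>2 r\<^sub>2 * measure \<mu> (ball x\<^sub>2 (2 * r\<^sub>2)) powr \<delta>) \<le> \<phi> x\<^sub>1 r\<^sub>1 * measure \<mu> (ball x\<^sub>1 (2 * r\<^sub>1)) powr \<delta>"
    using G_dec_decreasing[OF \<phi>, of 2] by auto
  define R where "R = max s (dist x y + r)"
  have R: "0 < R" using r zero_le_dist[of x y] unfolding R_def by linarith
  have sub: "ball x (r / 2) \<subseteq> ball y R"
  proof
    fix z assume "z \<in> ball x (r / 2)"
    then show "z \<in> ball y R" using dist_triangle[of y z x] r by (auto simp: R_def dist_commute)
  qed
  have "c * (\<phi> y R * measure \<mu> (ball y (2 * R)) powr \<delta>) \<le> 0"
    using *[OF _ R sub] r 0 by simp
  then have "measure \<mu> (ball y (2 * R)) powr \<delta> \<le> 0"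
    using c G_dec_pos[OF \<phi> R, of y] by (simp add: mult_le_0_iff)
  then have "measure \<mu> (ball y (2 * R)) = 0" by (metis powr_gt_zero not_le measure_nonneg less_eq_real_def)
  moreover have "measure \<mu> (ball y s) \<le> measure \<mu> (ball y (2 * R))"
  proof -
    have "s \<le> R" by (simp add: R_def)
    then show ?thesis using R by (intro measure_ball_mono subset_ball) auto
  qed
  ultimately show ?thesis by (simp add: measure_le_0_iff)
qed

text \<open>Both conditions are used for the same pair of concentric balls but with different
  dilations, and \<open>\<phi>\<close> cancels. What remains transports a large ratio of measures
  from one range of radii to another.\<close>

lemma G_dec_ratio_bound:
  assumes \<phi>: "\<phi> \<in> G_dec \<mu> \<delta>" and e: "1 < e" "1 < e'"
    and pos: "\<And>x r. 0 < r \<Longrightarrow> 0 < measure \<mu> (ball x r)"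
  shows "\<exists>C>0. \<forall>x r\<^sub>1 r\<^sub>2. 0 < r\<^sub>1 \<longrightarrow> r\<^sub>1 \<le> r\<^sub>2 \<longrightarrow>
    (measure \<mu> (ball x (e * r\<^sub>2)) / measure \<mu> (ball x (e * r\<^sub>1))) powr \<delta>
      \<le> C * (measure \<mu> (ball x (e' * r\<^sub>2)) / measure \<mu> (ball x (e' * r\<^sub>1)))"
proof -
  obtain c where c: "0 < c" and
    1: "\<And>x\<^sub>1 r\<^sub>1 x\<^sub>2 r\<^sub>2. 0 < r\<^sub>1 \<Longrightarrow> 0 < r\<^sub>2 \<Longrightarrow> ball x\<^sub>1 r\<^sub>1 \<subseteq> ball x\<^sub>2 r\<^sub>2 \<Longrightarrow>
       c * (\<phi> x\<^sub>2 r\<^sub>2 * measure \<mu> (ball x\<^sub>2 (e * r\<^sub>2)) powr \<delta>) \<le> \<phi> x\<^sub>1 r\<^sub>1 * measure \<mu> (ball x\<^sub>1 (e * r\<^sub>1)) powr \<delta>"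
    using G_dec_decreasing[OF \<phi> e(1)] by blast
  obtain C where C: "0 < C" and
    2: "\<And>x\<^sub>1 r\<^sub>1 x\<^sub>2 r\<^sub>2. 0 < r\<^sub>1 \<Longrightarrow> 0 < r\<^sub>2 \<Longrightarrow> ball x\<^sub>1 r\<^sub>1 \<subseteq> ball x\<^sub>2 r\<^sub>2 \<Longrightarrow>
       \<phi> x\<^sub>1 r\<^sub>1 * measure \<mu> (ball x\<^sub>1 (e' * r\<^sub>1)) \<le> C * (\<phi> x\<^sub>2 r\<^sub>2 * measure \<mu> (ball x\<^sub>2 (e' * r\<^sub>2)))"
    using G_dec_increasing[OF \<phi> e(2)] by blast
  show ?thesis
  proof (intro exI[of _ "C / c"] conjI allI impI)
    fix x and r\<^sub>1 r\<^sub>2 :: real assume r: "0 < r\<^sub>1" "r\<^sub>1 \<le> r\<^sub>2"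
    then have r2: "0 < r\<^sub>2" by simp
    define a1 where "a1 = measure \<mu> (ball x (e * r\<^sub>1))"
    define a2 where "a2 = measure \<mu> (ball x (e * r\<^sub>2))"
    define b1 where "b1 = measure \<mu> (ball x (e' * r\<^sub>1))"
    define b2 where "b2 = measure \<mu> (ball x (e' * r\<^sub>2))"
    have p: "0 < a1" "0 < a2" "0 < b1" "0 < b2" using pos e r r2 by (auto simp: a1_def a2_def b1_def b2_def)
    have f: "0 < \<phi> x r\<^sub>1" "0 < \<phi> x r\<^sub>2" using G_dec_pos[OF \<phi>] r r2 by auto
    have sub: "ball x r\<^sub>1 \<subseteq> ball x r\<^sub>2" using r by (intro subset_ball)
    have "(c * (\<phi> x r\<^sub>2 * a2 powr \<delta>)) * b1 \<le> (\<phi> x r\<^sub>1 * a1 powr \<delta>) * b1"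
      using 1[OF r(1) r2 sub] p by (intro mult_right_mono) (auto simp: a1_def a2_def)
    also have "\<dots> = a1 powr \<delta> * (\<phi> x r\<^sub>1 * b1)" by simp
    also have "\<dots> \<le> a1 powr \<delta> * (C * (\<phi> x r\<^sub>2 * b2))"
      using 2[OF r(1) r2 sub] by (intro mult_left_mono) (auto simp: b1_def b2_def)
    finally have "\<phi> x r\<^sub>2 * (c * a2 powr \<delta> * b1) \<le> \<phi> x r\<^sub>2 * (C * a1 powr \<delta> * b2)" by (simp add: mult_ac)
    then have "c * a2 powr \<delta> * b1 \<le> C * a1 powr \<delta> * b2" using f by simp
    then have "(a2 / a1) powr \<delta> \<le> C / c * (b2 / b1)" using p c by (simp add: powr_divide field_simps)
    then show "(measure \<mu> (ball x (e * r\<^sub>2)) / measure \<mu> (ball x (e * r\<^sub>1))) powr \<delta>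
      \<le> C / c * (measure \<mu> (ball x (e' * r\<^sub>2)) / measure \<mu> (ball x (e' * r\<^sub>1)))"
      by (simp add: a1_def a2_def b1_def b2_def)
  qed (use c C in auto)
qed

text \<open>By the ratio bound a large ratio \<open>Q\<close> of the measures of two concentric balls forces
  ratios of order \<open>Q powr \<delta>\<^sup>2\<close> over \<open>j\<close> consecutive scales around a nearby
  centre, whereas geometric doubling bounds the product of these by a constant times \<open>Q\<close>
  for a suitable centre. Taking \<open>j * \<delta>\<^sup>2 \<ge> 2\<close> bounds \<open>Q\<close>.\<close>

lemma G_dec_imp_doubling:
  assumes \<phi>: "\<phi> \<in> G_dec \<mu> \<delta>" and \<delta>: "0 < \<delta>"
  shows "\<exists>D\<ge>1. \<forall>x r. 0 < r \<longrightarrow> measure \<mu> (ball x (4 * r)) \<le> D * measure \<mu> (ball x r)"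
proof (cases "\<exists>x r. 0 < r \<and> measure \<mu> (ball x r) = 0")
  case True
  then have "measure \<mu> (ball y s) = 0" for y s using G_dec_measure_ball_zero[OF \<phi>] by blast
  then show ?thesis by auto
next
  case False
  let ?m = "\<lambda>x r. measure \<mu> (ball x r)"
  have pos: "0 < ?m x r" if "0 < r" for x r using False that by (metis less_eq_real_def measure_nonneg)
  obtain j :: nat where j: "2 / \<delta>\<^sup>2 \<le> real j" using real_arch_simple by blast
  then have j: "2 \<le> \<delta> * \<delta> * real j" using \<delta> by (simp add: field_simps power2_eq_square)
  \<comment> \<open>Used with the radii \<open>r / 2\<close> and \<open>2 * r\<close>, this carries
    the ratio for the radii \<open>4 * r\<close> and \<open>r\<close> to the radii
    \<open>64 * r\<close> and \<open>16 * r\<close>, where moving the centre by \<open>2 * r\<close>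
    is harmless.\<close>
  obtain C0 where C0: "0 < C0" "\<And>x r1 r2. 0 < r1 \<Longrightarrow> r1 \<le> r2 \<Longrightarrow>
    (?m x (2 * r2) / ?m x (2 * r1)) powr \<delta> \<le> C0 * (?m x (32 * r2) / ?m x (32 * r1))"
    using G_dec_ratio_bound[OF \<phi> _ _ pos, of 2 32] by auto
  \<comment> \<open>With the radii \<open>r / 8 ^ i / 2\<close> and
    \<open>r / 8 ^ Suc i / 2\<close>, the dilation \<open>20 * 8 ^ Suc i\<close> gives
    \<open>80 * r\<close> and \<open>10 * r\<close> for every \<open>i\<close>, while the dilation 2
    gives the consecutive radii \<open>r / 8 ^ i\<close> and \<open>r / 8 ^ Suc i\<close>. Each
    dilation has its own constant, and only the first \<open>j\<close> of them enter.\<close>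
  have "\<exists>C>0. \<forall>x r1 r2. 0 < r1 \<longrightarrow> r1 \<le> r2 \<longrightarrow>
    (?m x (20 * 8 ^ Suc i * r2) / ?m x (20 * 8 ^ Suc i * r1)) powr \<delta> \<le> C * (?m x (2 * r2) / ?m x (2 * r1))" for i :: nat
  proof -
    have "(1::real) < 20 * 8 ^ Suc i" using one_le_power[of "8::real" "Suc i"] by linarith
    then show ?thesis by (intro G_dec_ratio_bound[OF \<phi> _ _ pos]) auto
  qed
  then obtain C where C: "\<And>i. 0 < C i" "\<And>i x r1 r2. 0 < r1 \<Longrightarrow> r1 \<le> r2 \<Longrightarrow>
    (?m x (20 * 8 ^ Suc i * r2) / ?m x (20 * 8 ^ Suc i * r1)) powr \<delta> \<le> C i * (?m x (2 * r2) / ?m x (2 * r1))"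
    by metis
  define P where "P = (\<Prod>i<j. C i)"
  have P: "0 < P" unfolding P_def using C(1) by (intro prod_pos) auto
  obtain N where N: "\<And>x r. 0 < r \<Longrightarrow> \<exists>A. finite A \<and> card A \<le> N \<and> ball (x :: 'a) r \<subseteq> (\<Union>z\<in>A. ball z (r / 2 ^ (3 * j)))"
    using iterated_cover[of "3 * j"] by blast
  define D where "D = max 1 (C0 powr (\<delta> * real j) * P * real N)"
  show ?thesis
  proof (intro exI[of _ D] conjI allI impI)
    show "1 \<le> D" by (simp add: D_def)
    fix x0 :: 'a and r :: real assume r: "0 < r"
    obtain A where A: "finite A" "card A \<le> N" "ball x0 r \<subseteq> (\<Union>z\<in>A. ball z (r / 8 ^ j))"
      using N[OF r, of x0] by (auto simp: power_mult)
    define A' where "A' = {z \<in> A. ball z (r / 8 ^ j) \<inter> ball x0 r \<noteq> {}}"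
    have A': "finite A'" "card A' \<le> N"
      using A card_mono[OF A(1), of A'] by (auto simp: A'_def)
    have A'_cover: "ball x0 r \<subseteq> (\<Union>z\<in>A'. ball z (r / 8 ^ j))"
      using A(3) unfolding A'_def by blast
    \<comment> \<open>Pigeonhole: one of at most \<open>N\<close> small balls carries at least the
      fraction \<open>1 / N\<close> of the measure. Those in \<open>A'\<close> meet the original
      ball, which keeps the centre within \<open>2 * r\<close>.\<close>
    have "\<exists>x\<in>A'. ?m x0 r \<le> real N * ?m x (r / 8 ^ j)"
    proof (rule ccontr)
      assume "\<not> ?thesis"
      then have less: "real N * ?m x (r / 8 ^ j) < ?m x0 r" if "x \<in> A'" for x using that by force
      have "A' \<noteq> {}" using A'_cover r by auto
      then have N0: "0 < card A'" using A'(1) by (simp add: card_gt_0_iff)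
      have "?m x0 r \<le> measure \<mu> (\<Union>z\<in>A'. ball z (r / 8 ^ j))"
      proof (rule measure_mono_fmeasurable[OF A'_cover])
        show "(\<Union>z\<in>A'. ball z (r / 8 ^ j)) \<in> fmeasurable \<mu>"
          using A'(1) emeasure_ball_finite by (intro fmeasurable.finite_UN) (auto simp: fmeasurable_def)
      qed auto
      also have "\<dots> \<le> (\<Sum>z\<in>A'. ?m z (r / 8 ^ j))"
        using emeasure_ball_finite by (intro measure_UNION_le A') auto
      finally have "real N * ?m x0 r \<le> (\<Sum>z\<in>A'. real N * ?m z (r / 8 ^ j))"
        by (simp add: mult_left_mono flip: sum_distrib_left)
      also have "\<dots> < (\<Sum>z\<in>A'. ?m x0 r)" using less \<open>A' \<noteq> {}\<close> A'(1) by (intro sum_strict_mono) auto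
      also have "\<dots> \<le> real N * ?m x0 r" using A'(2) by (simp add: mult_right_mono)
      finally show False by simp
    qed
    then obtain x where x: "x \<in> A'" "?m x0 r \<le> real N * ?m x (r / 8 ^ j)" by blast
    have dx: "dist x x0 < 2 * r"
    proof -
      obtain y where "dist x y < r / 8 ^ j" "dist x0 y < r" using x(1) by (auto simp: A'_def)
      moreover have "r / 8 ^ j \<le> r" using r by (simp add: field_simps)
      ultimately show ?thesis using dist_triangle2[of x x0 y] by linarith
    qed
    have sub: "ball x0 (64 * r) \<subseteq> ball x (80 * r)" "ball x (10 * r) \<subseteq> ball x0 (16 * r)" "ball x r \<subseteq> ball x0 (4 * r)"
      using dx r by (auto simp: subset_iff) (smt (verit) dist_triangle dist_commute)+
    define Q where "Q = ?m x0 (4 * r) / ?m x0 r"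
    define q where "q = ?m x (80 * r) / ?m x (10 * r)"
    have Q1: "1 \<le> Q" using pos[OF r, of x0] measure_ball_mono[of x0 r x0 "4 * r"] subset_ball[of r "4 * r" x0] r
      by (simp add: Q_def)
    have q0: "0 < q" using pos r by (simp add: q_def)
    have "Q powr \<delta> \<le> C0 * (?m x0 (64 * r) / ?m x0 (16 * r))"
      using C0(2)[of "r / 2" "2 * r" x0] r by (simp add: Q_def)
    also have "\<dots> \<le> C0 * q" unfolding q_def
      using C0(1) pos r measure_ball_mono[OF sub(1)] measure_ball_mono[OF sub(2)]
      by (intro mult_left_mono frac_le) auto
    finally have Qq: "Q powr \<delta> \<le> C0 * q" .
    \<comment> \<open>The ratios over consecutive scales telescope: each is at least
      \<open>q powr \<delta>\<close> up to its constant.\<close>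
    have chain: "(q powr \<delta>) ^ n * ?m x (r / 8 ^ n) \<le> (\<Prod>i<n. C i) * ?m x r" for n
    proof (induction n)
      case (Suc n)
      have "(?m x (20 * 8 ^ Suc n * (r / 8 ^ n / 2)) / ?m x (20 * 8 ^ Suc n * (r / 8 ^ Suc n / 2))) powr \<delta>
         \<le> C n * (?m x (2 * (r / 8 ^ n / 2)) / ?m x (2 * (r / 8 ^ Suc n / 2)))"
        using r by (intro C(2)) (auto simp: field_simps)
      then have "q powr \<delta> \<le> C n * (?m x (r / 8 ^ n) / ?m x (r / 8 ^ Suc n))"
        by (simp add: q_def mult_ac)
      then have "q powr \<delta> * ?m x (r / 8 ^ Suc n) \<le> C n * ?m x (r / 8 ^ n)"
        using pos[of "r / 8 ^ Suc n" x] r by (simp add: field_simps)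
      then have "(q powr \<delta>) ^ n * (q powr \<delta> * ?m x (r / 8 ^ Suc n)) \<le> (q powr \<delta>) ^ n * (C n * ?m x (r / 8 ^ n))"
        by (intro mult_left_mono) auto
      also have "\<dots> \<le> C n * ((\<Prod>i<n. C i) * ?m x r)"
        using mult_left_mono[OF Suc.IH, of "C n"] C(1)[of n] by (simp add: mult_ac)
      finally show ?case by (simp add: mult_ac)
    qed simp
    \<comment> \<open>The choice of \<open>j\<close> makes the accumulated lower bound quadratic in
      \<open>Q\<close>, while the measure of the ball of radius \<open>4 * r\<close> is only linear
      in \<open>Q\<close>; comparing the two bounds \<open>Q\<close>.\<close>
    have "Q\<^sup>2 \<le> Q powr (\<delta> * \<delta> * real j)"
      using powr_mono[OF j Q1] Q1 by simp
    also have "\<dots> = (Q powr \<delta>) powr (\<delta> * real j)" by (simp add: powr_powr mult_ac)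
    also have "\<dots> \<le> (C0 * q) powr (\<delta> * real j)" using Qq \<delta> by (intro powr_mono2) auto
    also have "\<dots> = C0 powr (\<delta> * real j) * (q powr \<delta>) ^ j"
      using C0(1) q0 by (simp add: powr_mult powr_powr flip: powr_realpow)
    finally have "Q\<^sup>2 \<le> C0 powr (\<delta> * real j) * (q powr \<delta>) ^ j" .
    then have "Q\<^sup>2 * ?m x (r / 8 ^ j) \<le> C0 powr (\<delta> * real j) * ((q powr \<delta>) ^ j * ?m x (r / 8 ^ j))"
      by (simp add: mult_right_mono flip: mult.assoc)
    also have "\<dots> \<le> C0 powr (\<delta> * real j) * (P * ?m x0 (4 * r))"
      using chain[of j] measure_ball_mono[OF sub(3)] P
      by (intro mult_left_mono) (auto simp: P_def intro: order_trans mult_left_mono)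
    finally have "real N * (Q\<^sup>2 * ?m x (r / 8 ^ j)) \<le> real N * (C0 powr (\<delta> * real j) * (P * ?m x0 (4 * r)))"
      by (intro mult_left_mono) auto
    then have "Q\<^sup>2 * (real N * ?m x (r / 8 ^ j)) \<le> C0 powr (\<delta> * real j) * P * real N * ?m x0 (4 * r)"
      by (simp add: mult_ac)
    moreover have "Q\<^sup>2 * ?m x0 r \<le> Q\<^sup>2 * (real N * ?m x (r / 8 ^ j))" using x(2) by (intro mult_left_mono) auto
    moreover have "?m x0 (4 * r) = Q * ?m x0 r" using pos[OF r, of x0] by (simp add: Q_def)
    ultimately have "Q * (Q * ?m x0 r) \<le> (C0 powr (\<delta> * real j) * P * real N) * (Q * ?m x0 r)"
      by (simp add: power2_eq_square mult_ac)
    then have "Q \<le> C0 powr (\<delta> * real j) * P * real N" using Q1 pos[OF r, of x0] by (simp add: mult_le_cancel_right)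
    then have "Q \<le> D" by (simp add: D_def)
    then show "?m x0 (4 * r) \<le> D * ?m x0 r" using pos[OF r, of x0] by (simp add: Q_def field_simps)
  qed
qed

end

section \<open>The bound on Morrey spaces\<close>

text \<open>Hoelder's inequality up to the factor 2:
  \<open>u \<le> t + t powr (1 - p) * u powr p\<close> for every positive \<open>t\<close>, and
  \<open>t = L powr (1 / p)\<close> makes the two contributions equal.\<close>

lemma nn_integral_le_of_powr:
  fixes u :: "'a \<Rightarrow> real"
  assumes [measurable]: "u \<in> borel_measurable M" "B \<in> sets M" and u0: "\<And>x. 0 \<le> u x"
    and p: "1 < p" and L: "0 \<le> L" and m: "0 \<le> m"
    and up: "(\<integral>\<^sup>+x. ennreal (u x powr p) * indicator B x \<partial>M) \<le> ennreal (L * m)"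
    and B: "emeasure M B \<le> ennreal m"
  shows "(\<integral>\<^sup>+x. ennreal (u x) * indicator B x \<partial>M) \<le> ennreal (2 * L powr (1 / p) * m)"
proof (cases "L = 0")
  case True
  then have "(\<integral>\<^sup>+x. ennreal (u x powr p) * indicator B x \<partial>M) = 0" using up by simp
  then have "AE x in M. ennreal (u x powr p) * indicator B x = 0" by (subst (asm) nn_integral_0_iff_AE) auto
  then have "AE x in M. ennreal (u x) * indicator B x = 0"
    by eventually_elim (use u0 in \<open>auto simp: indicator_def ennreal_eq_0_iff split: if_splits\<close>)
  then have "(\<integral>\<^sup>+x. ennreal (u x) * indicator B x \<partial>M) = 0" by (subst nn_integral_0_iff_AE) auto
  then show ?thesis by simp
next
  case False
  then have L: "0 < L" using assms by simp
  define t where "t = L powr (1 / p)"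
  have t: "0 < t" using L by (simp add: t_def)
  have tp: "t powr (1 - p) * L = t"
  proof -
    have "L = t powr p" using L p by (simp add: t_def powr_powr)
    then show ?thesis using t by (simp flip: powr_add)
  qed
  have "(\<integral>\<^sup>+x. ennreal (u x) * indicator B x \<partial>M) \<le> (\<integral>\<^sup>+x. ennreal t * indicator B x + ennreal (t powr (1 - p)) * (ennreal (u x powr p) * indicator B x) \<partial>M)"
  proof (rule nn_integral_mono)
    fix x
    have "u x \<le> t + t powr (1 - p) * u x powr p"
    proof (cases "u x \<le> t")
      case True then show ?thesis by (simp add: add_increasing2)
    next
      case False
      then have "u x = u x powr (1 - p) * u x powr p" using t by (simp flip: powr_add)
      also have "\<dots> \<le> t powr (1 - p) * u x powr p"
        using False t p by (intro mult_right_mono powr_mono2') auto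
      finally show ?thesis using t by simp
    qed
    then have "ennreal (u x) \<le> ennreal t + ennreal (t powr (1 - p)) * ennreal (u x powr p)"
      using t by (simp add: ennreal_leI flip: ennreal_plus ennreal_mult')
    then show "ennreal (u x) * indicator B x \<le> ennreal t * indicator B x + ennreal (t powr (1 - p)) * (ennreal (u x powr p) * indicator B x)"
      by (auto simp: indicator_def)
  qed
  also have "\<dots> = ennreal t * emeasure M B + ennreal (t powr (1 - p)) * (\<integral>\<^sup>+x. ennreal (u x powr p) * indicator B x \<partial>M)"
    by (simp add: nn_integral_add nn_integral_cmult nn_integral_cmult_indicator)
  also have "\<dots> \<le> ennreal t * ennreal m + ennreal (t powr (1 - p)) * ennreal (L * m)"
    by (intro add_mono mult_left_mono up B) auto
  also have "\<dots> = ennreal (t * m + t powr (1 - p) * (L * m))"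
    using t m L by (simp add: ennreal_mult' ennreal_plus)
  also have "t * m + t powr (1 - p) * (L * m) = 2 * t * m" using tp by (metis mult.assoc mult_2 distrib_right)
  finally show ?thesis by (simp add: t_def)
qed

context nonhomogeneous_space begin

text \<open>The Morrey condition for \<open>p\<close>-th powers without quotients: \<open>F\<close>
  stands for the \<open>p\<close>-th power of the norm, and the extended integral avoids
  integrability conditions and division by null balls.\<close>

definition morrey_growth :: "('a \<Rightarrow> real \<Rightarrow> real) \<Rightarrow> real \<Rightarrow> real \<Rightarrow> ('a \<Rightarrow> real) \<Rightarrow> real \<Rightarrow> bool" where
  "morrey_growth \<phi> \<eta> p u F \<longleftrightarrow> (\<forall>x R. 0 < R \<longrightarrow>
     (\<integral>\<^sup>+z. ennreal (u z powr p) * indicator (ball x R) z \<partial>\<mu>) \<le> ennreal (F * \<phi> x R * measure \<mu> (ball x (\<eta> * R))))"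

text \<open>Seen from the ball, the kernel on each dyadic annulus is of order
  \<open>1 / lam x (R k)\<close>. The mean of \<open>u\<close> there is controlled by Hoelder's
  inequality and the growth condition, and the decay of \<open>\<phi>\<close> turns these estimates
  into terms of a convergent series.\<close>

lemma lam_potential_far_bound:
  assumes \<phi>: "\<phi> \<in> G_dec \<mu> \<delta>" and \<delta>: "0 < \<delta>" "\<delta> < 1" and \<eta>: "1 < \<eta>" and p: "1 < p"
    and \<sigma>0: "0 < \<sigma>" and \<sigma>: "\<sigma> < \<delta> / p" and rd: "weak_reverse_doubling \<sigma> lam"
  obtains A where "0 \<le> A"
    "\<And>u F x r y. u \<in> borel_measurable \<mu> \<Longrightarrow> (\<And>z. 0 \<le> u z) \<Longrightarrow> 0 \<le> F \<Longrightarrow> 0 < r \<Longrightarrow>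
      morrey_growth \<phi> \<eta> p u F \<Longrightarrow> y \<in> ball x r \<Longrightarrow>
      lam_potential (\<lambda>z. u z * indicator (- ball x (2 * r)) z) y \<le> ennreal (A * (F * \<phi> x r) powr (1 / p))"
proof -
  obtain W :: "real \<Rightarrow> real" where W: "\<And>a. 1 < a \<Longrightarrow> 0 < W a"
    and W_lam: "\<And>x r a. 0 < r \<Longrightarrow> ereal r < 2 * space_diam TYPE('a) \<Longrightarrow> 1 < a \<Longrightarrow>
       ereal a < 2 * space_diam TYPE('a) / ereal r \<Longrightarrow> W a * lam x r \<le> lam x (a * r)"
    and W_sum: "\<And>a. 1 < a \<Longrightarrow> summable (\<lambda>j. W (a ^ Suc j) powr (- \<sigma>))"
    using rd unfolding weak_reverse_doubling_def by blast
  define s where "s k = W (2 ^ Suc k) powr (- (\<delta> / p))" for k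
  have s0: "0 \<le> s k" for k by (simp add: s_def)
  have s_sum: "summable s"
  proof (rule summable_comparison_test_ev[OF _ W_sum[of 2]])
    \<comment> \<open>The terms of the given series tend to 0, so \<open>W\<close> is eventually at
      least 1. From then on the larger exponent \<open>\<delta> / p\<close> only decreases the
      terms.\<close>
    have "(\<lambda>j. W (2 ^ Suc j) powr (- \<sigma>)) \<longlonglongrightarrow> 0" using W_sum[of 2] by (intro summable_LIMSEQ_zero) auto
    then have "\<forall>\<^sub>F j in sequentially. W (2 ^ Suc j) powr (- \<sigma>) < 1" by (rule order_tendstoD(2)) simp
    moreover have "\<forall>\<^sub>F j in sequentially. 0 \<le> j" by simp
    ultimately show "\<forall>\<^sub>F j in sequentially. norm (s j) \<le> W (2 ^ Suc j) powr (- \<sigma>)"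
    proof eventually_elim
      case (elim j)
      have Wj: "0 < W (2 ^ Suc j)" using one_less_power[of "2::real" "Suc j"] by (intro W) auto
      show ?case
      proof (cases "1 \<le> W (2 ^ Suc j)")
        case True
        then show ?thesis using \<sigma> by (auto simp: s_def intro: powr_mono)
      next
        case False
        then have "W (2 ^ Suc j) powr \<sigma> < 1 powr \<sigma>" using Wj \<sigma>0 by (intro powr_less_mono2) auto
        then have False using elim Wj by (simp add: powr_minus_divide field_simps)
        then show ?thesis ..
      qed
    qed
  qed simp
  obtain c where c: "0 < c" and
    dec: "\<And>x\<^sub>1 r\<^sub>1 x\<^sub>2 r\<^sub>2. 0 < r\<^sub>1 \<Longrightarrow> 0 < r\<^sub>2 \<Longrightarrow> ball x\<^sub>1 r\<^sub>1 \<subseteq> ball x\<^sub>2 r\<^sub>2 \<Longrightarrow>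
       c * (\<phi> x\<^sub>2 r\<^sub>2 * measure \<mu> (ball x\<^sub>2 (\<eta> * r\<^sub>2)) powr \<delta>) \<le> \<phi> x\<^sub>1 r\<^sub>1 * measure \<mu> (ball x\<^sub>1 (\<eta> * r\<^sub>1)) powr \<delta>"
    using G_dec_decreasing[OF \<phi> \<eta>] by blast
  \<comment> \<open>All dilations up to \<open>2 * \<eta>\<close> are absorbed by \<open>m\<close>
    doublings of \<open>lam\<close>.\<close>
  obtain m :: nat where m: "2 * \<eta> < 2 ^ m" using real_arch_pow[of 2 "2 * \<eta>"] by auto
  define G where "G = C_lam ^ m"
  have G: "1 \<le> G" using C_lam_ge_1 by (simp add: G_def one_le_power)
  define E where "E = 2 * C_lam ^ 4 * c powr (- (1 / p)) * G"
  have E: "0 \<le> E" using C_lam_ge_1 G by (simp add: E_def)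
  have lamG: "measure \<mu> (ball x (t * R)) \<le> G * lam x R" if "0 < R" "0 < t" "t \<le> 2 * \<eta>" for x t R
  proof -
    have "measure \<mu> (ball x (t * R)) \<le> lam x (t * R)" using that by (intro measure_ball_le_lam) auto
    also have "\<dots> \<le> lam x (2 ^ m * R)" using that m by (intro lam_monoD) auto
    also have "\<dots> \<le> G * lam x R" using lam_pow[OF that(1)] by (simp add: G_def)
    finally show ?thesis .
  qed
  show ?thesis
  proof (rule that[of "E * suminf s"], goal_cases)
    case 1
    show ?case using E suminf_nonneg[OF s_sum s0] by simp
  next
    case (2 u F x r y)
    note [measurable] = 2(1)
    note u0 = 2(2) and F = 2(3) and r = 2(4) and up = 2(5)[unfolded morrey_growth_def, rule_format] and y = 2(6)
    define R where "R k = 2 ^ Suc k * r" for k :: nat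
    have R: "0 < R k" "2 * r \<le> R k" for k
      using r one_le_power[of "2::real" k] by (auto simp: R_def)
    define Ann where "Ann k = ball x (2 * R k) - ball x (R k)" for k
    have [measurable]: "Ann k \<in> sets \<mu>" for k unfolding Ann_def by measurable
    define q where "q z = (SUP N. lam_kernel N y z)" for z
    have [measurable]: "q \<in> borel_measurable \<mu>" unfolding q_def by measurable
    let ?K = "E * (F * \<phi> x r) powr (1 / p)"
    have \<phi>0: "0 < \<phi> x t" if "0 < t" for t using G_dec_pos[OF \<phi> that] .
    have annulus: "(\<integral>\<^sup>+z. q z * (ennreal (u z) * indicator (Ann k) z) \<partial>\<mu>) \<le> ennreal (?K * s k)" for k
    proof (cases "Ann k = {}")
      \<comment> \<open>Weak reverse doubling is assumed only for radii below twice the diameter. A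
        point of the annulus shows that \<open>R k\<close> is at most the diameter; an empty annulus
        contributes nothing.\<close>
      case False
      then obtain w where "w \<in> Ann k" by blast
      then have w: "R k \<le> dist x w" by (simp add: Ann_def)
      define l0 where "l0 = lam x r"
      define lk where "lk = lam x (R k)"
      have l: "0 < l0" "0 < lk" using lam_pos r R by (auto simp: l0_def lk_def)
      have "ereal (dist x w) \<le> space_diam TYPE('a)"
        unfolding space_diam_def by (rule SUP_upper2[of "(x, w)"]) auto
      then have diam: "ereal (R k) \<le> space_diam TYPE('a)" using w by (meson ereal_less_eq(3) order_trans)
      have d1: "ereal r < 2 * space_diam TYPE('a)"
      proof -
        have "ereal r < ereal (2 * R k)" using R[of k] r by simp
        also have "\<dots> = 2 * ereal (R k)" by simp
        also have "\<dots> \<le> 2 * space_diam TYPE('a)" using diam by (intro ereal_mult_left_mono) auto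
        finally show ?thesis .
      qed
      have d2: "ereal (2 ^ Suc k) < 2 * space_diam TYPE('a) / ereal r"
      proof -
        have "ereal (2 ^ Suc k) < ereal (2 * R k / r)" using r by (simp add: R_def)
        also have "\<dots> = 2 * ereal (R k) / ereal r" using r by simp
        also have "\<dots> \<le> 2 * space_diam TYPE('a) / ereal r"
          using diam r by (intro ereal_divide_right_mono ereal_mult_left_mono) auto
        finally show ?thesis .
      qed
      have a1: "(1::real) < 2 ^ Suc k" using one_less_power[of "2::real" "Suc k"] by simp
      have Wl: "W (2 ^ Suc k) * l0 \<le> lk"
        using W_lam[OF r d1 a1 d2, of x] by (simp add: l0_def lk_def R_def)
      have sk: "(l0 / lk) powr (\<delta> / p) \<le> s k"
      proof -
        have "l0 / lk \<le> 1 / W (2 ^ Suc k)" using Wl l W[OF a1] by (simp add: field_simps)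
        then have "(l0 / lk) powr (\<delta> / p) \<le> (1 / W (2 ^ Suc k)) powr (\<delta> / p)"
          using l \<delta> p by (intro powr_mono2) auto
        also have "\<dots> = s k" using W[OF a1] by (simp add: s_def powr_divide powr_minus_divide)
        finally show ?thesis .
      qed
      define \<mu>0 where "\<mu>0 = measure \<mu> (ball x (\<eta> * r))"
      define \<mu>k where "\<mu>k = measure \<mu> (ball x (\<eta> * (2 * R k)))"
      have \<mu>: "0 \<le> \<mu>0" "0 \<le> \<mu>k" "\<mu>0 \<le> G * l0" "\<mu>k \<le> G * lk"
        using lamG[OF r, of \<eta> x] lamG[OF R(1), of "2 * \<eta>" x k] \<eta>
        by (auto simp: \<mu>0_def \<mu>k_def l0_def lk_def mult_ac)
      have dk: "c * (\<phi> x (2 * R k) * \<mu>k powr \<delta>) \<le> \<phi> x r * \<mu>0 powr \<delta>"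
        unfolding \<mu>0_def \<mu>k_def using r R[of k] by (intro dec subset_ball) auto
      define t where "t = (F * \<phi> x (2 * R k)) powr (1 / p)"
      let ?c = "c powr (- (1 / p)) * (F * \<phi> x r) powr (1 / p)"
      \<comment> \<open>The decay of \<open>\<phi>\<close> exchanges its value on the large ball for
        that on the small one at the price \<open>(\<mu>0 / \<mu>k) powr \<delta>\<close>. After the
        \<open>p\<close>-th root, \<open>\<mu>0\<close> and \<open>\<mu>k\<close> carry the
        nonnegative exponents \<open>\<delta> / p\<close> and \<open>1 - \<delta> / p\<close>, so
        both may be replaced by their upper bounds in terms of \<open>lam\<close>.\<close>
      have tm: "t * \<mu>k \<le> ?c * (G * lk * s k)"
      proof (cases "\<mu>k = 0")
        case True then show ?thesis using G l s0 by simp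
      next
        case False
        then have mk: "0 < \<mu>k" using \<mu> by simp
        have "F * \<phi> x (2 * R k) \<le> F * \<phi> x r / c * (\<mu>0 powr \<delta> / \<mu>k powr \<delta>)"
          using mult_left_mono[OF dk F] mk c by (simp add: field_simps)
        then have "t \<le> (F * \<phi> x r / c * (\<mu>0 powr \<delta> / \<mu>k powr \<delta>)) powr (1 / p)"
          unfolding t_def using F \<phi>0[of "2 * R k"] R[of k] p by (intro powr_mono2) auto
        also have "\<dots> = ?c * (\<mu>0 powr (\<delta> / p) / \<mu>k powr (\<delta> / p))"
          using F \<phi>0[OF r] c mk \<mu> by (simp add: powr_mult powr_divide powr_powr powr_minus_divide)
        finally have "t * \<mu>k \<le> ?c * (\<mu>0 powr (\<delta> / p) / \<mu>k powr (\<delta> / p)) * \<mu>k"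
          using mk by (intro mult_right_mono) auto
        also have "\<dots> = ?c * (\<mu>0 powr (\<delta> / p) * \<mu>k powr (1 - \<delta> / p))"
          using mk by (simp add: powr_diff)
        also have "\<dots> \<le> ?c * ((G * l0) powr (\<delta> / p) * (G * lk) powr (1 - \<delta> / p))"
          using \<mu> \<delta> p by (intro mult_left_mono mult_mono powr_mono2) auto
        also have "(G * l0) powr (\<delta> / p) * (G * lk) powr (1 - \<delta> / p) = G * lk * (l0 / lk) powr (\<delta> / p)"
          using G l by (simp add: powr_mult powr_diff powr_divide)
        also have "?c * (G * lk * (l0 / lk) powr (\<delta> / p))
          \<le> ?c * (G * lk * s k)"
          using sk G l by (intro mult_left_mono) auto
        finally show ?thesis .
      qed
      \<comment> \<open>Of the four factors \<open>C_lam\<close>, two come from the kernel estimate,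
        one from halving \<open>R k\<close> and one from moving the centre from \<open>x\<close> to
        \<open>y\<close>.\<close>
      have q_le: "q z \<le> ennreal (C_lam ^ 4 / lk)" if z: "z \<in> Ann k" for z
        unfolding q_def
      proof (rule SUP_least)
        fix N
        have dz: "R k / 2 \<le> dist y z"
          using z y R(2)[of k] dist_triangle[of x z y] by (auto simp: Ann_def)
        have "lam_kernel N y z \<le> ennreal (C_lam\<^sup>2 / lam y (R k / 2))"
          using dz R(1)[of k] by (intro lam_kernel_le) auto
        also have "\<dots> \<le> ennreal (C_lam ^ 4 / lk)"
        proof (rule ennreal_leI)
          have "lk \<le> C_lam * lam x (R k / 2)" unfolding lk_def by (rule C_lam(2)[OF R(1)])
          also have "\<dots> \<le> C_lam * (C_lam * lam y (R k / 2))"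
            using y R[of k] C_lam_ge_1 by (intro mult_left_mono C_lam(3)) auto
          finally show "C_lam\<^sup>2 / lam y (R k / 2) \<le> C_lam ^ 4 / lk"
            using l lam_pos[of "R k / 2" y] R(1)[of k] mult_left_mono[of lk "C_lam * (C_lam * lam y (R k / 2))" "C_lam\<^sup>2"]
            by (simp add: field_simps power2_eq_square power4_eq_xxxx)
        qed
        finally show "lam_kernel N y z \<le> ennreal (C_lam ^ 4 / lk)" .
      qed
      have "(\<integral>\<^sup>+z. q z * (ennreal (u z) * indicator (Ann k) z) \<partial>\<mu>)
        \<le> (\<integral>\<^sup>+z. ennreal (C_lam ^ 4 / lk) * (ennreal (u z) * indicator (ball x (2 * R k)) z) \<partial>\<mu>)"
        using q_le by (intro nn_integral_mono) (auto simp: indicator_def Ann_def intro: mult_right_mono)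
      also have "\<dots> = ennreal (C_lam ^ 4 / lk) * (\<integral>\<^sup>+z. ennreal (u z) * indicator (ball x (2 * R k)) z \<partial>\<mu>)"
        by (rule nn_integral_cmult) measurable
      also have "\<dots> \<le> ennreal (C_lam ^ 4 / lk) * ennreal (2 * t * \<mu>k)"
        unfolding t_def
      proof (intro mult_left_mono nn_integral_le_of_powr u0 p)
        show "0 \<le> F * \<phi> x (2 * R k)" using F \<phi>0[of "2 * R k"] R[of k] by simp
        show "(\<integral>\<^sup>+z. ennreal (u z powr p) * indicator (ball x (2 * R k)) z \<partial>\<mu>) \<le> ennreal (F * \<phi> x (2 * R k) * \<mu>k)"
          unfolding \<mu>k_def using R(1)[of k] by (intro up) auto
        have "measure \<mu> (ball x (2 * R k)) \<le> \<mu>k"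
          unfolding \<mu>k_def using \<eta> R(1)[of k] by (intro measure_ball_mono subset_ball) auto
        then show "emeasure \<mu> (ball x (2 * R k)) \<le> ennreal \<mu>k" by (simp add: emeasure_ball ennreal_leI)
      qed (use \<mu> in auto)
      also have "\<dots> = ennreal (2 * C_lam ^ 4 / lk * (t * \<mu>k))"
        using l C_lam_ge_1 by (subst ennreal_mult'[symmetric]) (auto simp: mult_ac)
      also have "\<dots> \<le> ennreal (2 * C_lam ^ 4 / lk * (?c * (G * lk * s k)))"
        using tm l C_lam_ge_1 by (intro ennreal_leI mult_left_mono) auto
      also have "2 * C_lam ^ 4 / lk * (?c * (G * lk * s k)) = ?K * s k"
        using l by (simp add: E_def)
      finally show ?thesis .
    qed simp
    have "lam_potential (\<lambda>z. u z * indicator (- ball x (2 * r)) z) y \<le> (\<integral>\<^sup>+z. (\<Sum>k. q z * (ennreal (u z) * indicator (Ann k) z)) \<partial>\<mu>)"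
      unfolding lam_potential_def q_def[symmetric]
    proof (rule nn_integral_mono)
      fix z
      show "q z * ennreal (u z * indicator (- ball x (2 * r)) z) \<le> (\<Sum>k. q z * (ennreal (u z) * indicator (Ann k) z))"
      proof (cases "z \<in> ball x (2 * r)")
        case False
        then have far: "2 * r \<le> dist x z" by simp
        have ex: "\<exists>k. dist x z < 2 * R k"
        proof -
          obtain k where "dist x z / r < 2 ^ k" using real_arch_pow[of 2 "dist x z / r"] by auto
          then have "dist x z < 2 ^ k * r" using r by (simp add: field_simps)
          also have "\<dots> \<le> 2 * R k" using r by (simp add: R_def)
          finally show ?thesis ..
        qed
        define k where "k = (LEAST k. dist x z < 2 * R k)"
        have k1: "dist x z < 2 * R k" unfolding k_def by (rule LeastI_ex[OF ex])
        have k2: "R k \<le> dist x z"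
        proof (cases k)
          case 0 then show ?thesis using far by (simp add: R_def)
        next
          case (Suc i)
          then have "\<not> dist x z < 2 * R i" using not_less_Least[of i "\<lambda>k. dist x z < 2 * R k"] by (simp add: k_def)
          then show ?thesis by (simp add: R_def Suc mult_ac)
        qed
        have "q z * ennreal (u z * indicator (- ball x (2 * r)) z) = (\<Sum>k\<in>{k}. q z * (ennreal (u z) * indicator (Ann k) z))"
          using k1 k2 False by (simp add: Ann_def)
        also have "\<dots> \<le> (\<Sum>k. q z * (ennreal (u z) * indicator (Ann k) z))"
          by (rule sum_le_suminf) auto
        finally show ?thesis .
      qed simp
    qed
    also have "\<dots> = (\<Sum>k. \<integral>\<^sup>+z. q z * (ennreal (u z) * indicator (Ann k) z) \<partial>\<mu>)"
      by (rule nn_integral_suminf) measurable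
    also have "\<dots> \<le> (\<Sum>k. ennreal (?K * s k))" by (intro suminf_le annulus) auto
    also have "\<dots> = ennreal (\<Sum>k. ?K * s k)"
      using E s0 by (intro suminf_ennreal2 summable_mult s_sum) auto
    also have "(\<Sum>k. ?K * s k) = E * suminf s * (F * \<phi> x r) powr (1 / p)"
      by (subst suminf_mult[OF s_sum]) (simp add: mult_ac)
    finally show ?case .
  qed
qed

lemma lam_potential_split:
  assumes [measurable]: "u \<in> borel_measurable \<mu>" "B \<in> sets \<mu>" and u0: "\<And>z. 0 \<le> u z"
  shows "lam_potential u x = lam_potential (\<lambda>z. u z * indicator B z) x + lam_potential (\<lambda>z. u z * indicator (- B) z) x"
  unfolding lam_potential_def
proof (subst nn_integral_add[symmetric])
  show "(\<lambda>z. (SUP N. lam_kernel N x z) * ennreal (u z * indicator (- B) z)) \<in> borel_measurable \<mu>"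
    using sets.compl_sets[of B \<mu>] by (simp add: space_mu Compl_eq_Diff_UNIV[symmetric])
  show "(\<integral>\<^sup>+z. (SUP N. lam_kernel N x z) * ennreal (u z) \<partial>\<mu>) =
    (\<integral>\<^sup>+z. (SUP N. lam_kernel N x z) * ennreal (u z * indicator B z) + (SUP N. lam_kernel N x z) * ennreal (u z * indicator (- B) z) \<partial>\<mu>)"
    by (intro nn_integral_cong) (auto simp: indicator_def)
qed measurable

text \<open>The increasing condition compares these two balls in the opposite direction. Splitting
  the measure of the large ball into its powers \<open>\<delta>\<close> and
  \<open>1 - \<delta>\<close>, the decreasing condition treats the first together with
  \<open>\<phi>\<close>, and doubling treats the second.\<close>

lemma G_dec_double_ball:
  assumes \<phi>: "\<phi> \<in> G_dec \<mu> \<delta>" and \<delta>: "0 < \<delta>" "\<delta> < 1" and \<eta>: "1 < \<eta>"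
  shows "\<exists>C\<ge>0. \<forall>x r. 0 < r \<longrightarrow>
    \<phi> x (2 * r) * measure \<mu> (ball x (\<eta> * (2 * r))) \<le> C * (\<phi> x r * measure \<mu> (ball x (\<eta> * r)))"
proof -
  obtain D where D: "1 \<le> D" "\<And>x r. 0 < r \<Longrightarrow> measure \<mu> (ball x (4 * r)) \<le> D * measure \<mu> (ball x r)"
    using G_dec_imp_doubling[OF \<phi> \<delta>(1)] by blast
  obtain c where c: "0 < c" and
    dec: "\<And>x\<^sub>1 r\<^sub>1 x\<^sub>2 r\<^sub>2. 0 < r\<^sub>1 \<Longrightarrow> 0 < r\<^sub>2 \<Longrightarrow> ball x\<^sub>1 r\<^sub>1 \<subseteq> ball x\<^sub>2 r\<^sub>2 \<Longrightarrow>
       c * (\<phi> x\<^sub>2 r\<^sub>2 * measure \<mu> (ball x\<^sub>2 (\<eta> * r\<^sub>2)) powr \<delta>) \<le> \<phi> x\<^sub>1 r\<^sub>1 * measure \<mu> (ball x\<^sub>1 (\<eta> * r\<^sub>1)) powr \<delta>"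
    using G_dec_decreasing[OF \<phi> \<eta>] by blast
  show ?thesis
  proof (intro exI[of _ "D powr (1 - \<delta>) / c"] conjI allI impI)
    fix x and r :: real assume r: "0 < r"
    define m1 where "m1 = measure \<mu> (ball x (\<eta> * r))"
    define m2 where "m2 = measure \<mu> (ball x (\<eta> * (2 * r)))"
    have m0: "0 \<le> m1" "0 \<le> m2" by (auto simp: m1_def m2_def)
    have f: "0 < \<phi> x r" "0 < \<phi> x (2 * r)" using G_dec_pos[OF \<phi>] r by auto
    have "m2 \<le> measure \<mu> (ball x (4 * (\<eta> * r)))"
      unfolding m2_def using \<eta> r by (intro measure_ball_mono subset_ball) auto
    also have "\<dots> \<le> D * m1" unfolding m1_def using \<eta> r by (intro D) auto
    finally have m2: "m2 \<le> D * m1" .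
    have "\<phi> x (2 * r) * m2 = \<phi> x (2 * r) * m2 powr \<delta> * m2 powr (1 - \<delta>)"
      using m0 by (cases "m2 = 0") (auto simp: mult.assoc simp flip: powr_add)
    also have "\<dots> \<le> (\<phi> x r * m1 powr \<delta> / c) * (D * m1) powr (1 - \<delta>)"
    proof (rule mult_mono)
      have "c * (\<phi> x (2 * r) * m2 powr \<delta>) \<le> \<phi> x r * m1 powr \<delta>"
        unfolding m1_def m2_def using r by (intro dec subset_ball) auto
      then show "\<phi> x (2 * r) * m2 powr \<delta> \<le> \<phi> x r * m1 powr \<delta> / c" using c by (simp add: field_simps)
    qed (use m2 m0 \<delta> c f in \<open>auto intro: powr_mono2\<close>)
    also have "\<dots> = D powr (1 - \<delta>) / c * (\<phi> x r * (m1 powr \<delta> * m1 powr (1 - \<delta>)))"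
      using D m0 by (simp add: powr_mult)
    also have "m1 powr \<delta> * m1 powr (1 - \<delta>) = m1"
      using m0 by (cases "m1 = 0") (auto simp flip: powr_add)
    finally show "\<phi> x (2 * r) * m2 \<le> D powr (1 - \<delta>) / c * (\<phi> x r * m1)" .
  qed (use c in auto)
qed

text \<open>On a fixed ball, the part of \<open>u\<close> inside twice the ball is handled by the
  Lebesgue bound. The rest has a potential bounded there by a constant whose \<open>p\<close>-th
  power, times the measure of the ball, is again of the size allowed by the growth
  condition.\<close>

lemma lam_potential_Morrey_bound:
  assumes T: "T_lam_L2 T C"
    and \<phi>: "\<phi> \<in> G_dec \<mu> \<delta>" and \<delta>: "0 < \<delta>" "\<delta> < 1" and \<eta>: "1 < \<eta>" and p: "1 < p"
    and \<sigma>: "0 < \<sigma>" "\<sigma> < \<delta> / p" and rd: "weak_reverse_doubling \<sigma> lam"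
  obtains A where "0 \<le> A"
    "\<And>u F. u \<in> borel_measurable \<mu> \<Longrightarrow> (\<And>z. 0 \<le> u z) \<Longrightarrow> 0 \<le> F \<Longrightarrow>
      morrey_growth \<phi> \<eta> p u F \<Longrightarrow>
      (AE z in \<mu>. lam_potential u z < \<infinity>) \<and> morrey_growth \<phi> \<eta> p (\<lambda>z. enn2real (lam_potential u z)) (A * F)"
proof -
  obtain A1 where A1: "0 \<le> A1"
    "\<And>u. u \<in> borel_measurable \<mu> \<Longrightarrow> (\<And>x. 0 \<le> u x) \<Longrightarrow> (\<integral>\<^sup>+x. ennreal (u x powr p) \<partial>\<mu>) < \<infinity> \<Longrightarrow>
       (AE x in \<mu>. lam_potential u x < \<infinity>) \<and>
       (\<integral>\<^sup>+x. ennreal (enn2real (lam_potential u x) powr p) \<partial>\<mu>) \<le> ennreal A1 * (\<integral>\<^sup>+x. ennreal (u x powr p) \<partial>\<mu>)"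
  proof (rule lam_potential_Lp[OF T p], goal_cases)
    case (1 A)
    show ?case by (rule 1(1)[OF 1(2)]) (rule 1(3); assumption)
  qed
  obtain A2 where A2: "0 \<le> A2"
    "\<And>u F x r y. u \<in> borel_measurable \<mu> \<Longrightarrow> (\<And>z. 0 \<le> u z) \<Longrightarrow> 0 \<le> F \<Longrightarrow> 0 < r \<Longrightarrow>
      morrey_growth \<phi> \<eta> p u F \<Longrightarrow> y \<in> ball x r \<Longrightarrow>
      lam_potential (\<lambda>z. u z * indicator (- ball x (2 * r)) z) y \<le> ennreal (A2 * (F * \<phi> x r) powr (1 / p))"
  proof (rule lam_potential_far_bound[OF \<phi> \<delta> \<eta> p \<sigma> rd], goal_cases)
    case (1 A)
    show ?case by (rule 1(1)[OF 1(2)]) (rule 1(3); assumption)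
  qed
  obtain C' where C': "0 \<le> C'" "\<And>x r. 0 < r \<Longrightarrow>
    \<phi> x (2 * r) * measure \<mu> (ball x (\<eta> * (2 * r))) \<le> C' * (\<phi> x r * measure \<mu> (ball x (\<eta> * r)))"
    using G_dec_double_ball[OF \<phi> \<delta> \<eta>] by blast
  \<comment> \<open>The factor \<open>2 powr p\<close> comes from
    \<open>(a + b) powr p \<le> 2 powr p * (a powr p + b powr p)\<close>, \<open>A1 * C'\<close>
    from the near part and \<open>A2 powr p\<close> from the far part.\<close>
  define A where "A = 2 powr p * (A1 * C' + A2 powr p)"
  show ?thesis
  proof (rule that[of A], goal_cases)
    case 1
    show ?case using A1 C' by (simp add: A_def)
  next
    case (2 u F)
    note [measurable] = 2(1)
    note u0 = 2(2) and F = 2(3) and growth = 2(4) and up = 2(4)[unfolded morrey_growth_def, rule_format]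
    have main: "(AE z in \<mu>. z \<in> ball x r \<longrightarrow> lam_potential u z < \<infinity>) \<and>
       (\<integral>\<^sup>+z. ennreal (enn2real (lam_potential u z) powr p) * indicator (ball x r) z \<partial>\<mu>)
         \<le> ennreal (A * (F * \<phi> x r * measure \<mu> (ball x (\<eta> * r))))"
      if r: "0 < r" for x r
    proof -
      define u1 where "u1 z = u z * indicator (ball x (2 * r)) z" for z
      define u2 where "u2 z = u z * indicator (- ball x (2 * r)) z" for z
      have [measurable]: "u1 \<in> borel_measurable \<mu>" unfolding u1_def by measurable
      have u10: "0 \<le> u1 z" for z using u0 by (simp add: u1_def)
      define m where "m = measure \<mu> (ball x (\<eta> * r))"
      define V where "V = F * \<phi> x r * m"
      have \<phi>0: "0 < \<phi> x r" by (rule G_dec_pos[OF \<phi> r])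
      have V: "0 \<le> V" using F \<phi>0 by (simp add: V_def m_def)
      have "(\<integral>\<^sup>+z. ennreal (u1 z powr p) \<partial>\<mu>) = (\<integral>\<^sup>+z. ennreal (u z powr p) * indicator (ball x (2 * r)) z \<partial>\<mu>)"
        by (intro nn_integral_cong) (auto simp: u1_def indicator_def)
      also have "\<dots> \<le> ennreal (F * \<phi> x (2 * r) * measure \<mu> (ball x (\<eta> * (2 * r))))" using r by (intro up) auto
      also have "\<dots> \<le> ennreal (C' * V)"
        using mult_left_mono[OF C'(2)[OF r, of x] F] by (intro ennreal_leI) (simp add: V_def m_def mult_ac)
      finally have u1p: "(\<integral>\<^sup>+z. ennreal (u1 z powr p) \<partial>\<mu>) \<le> ennreal (C' * V)" .
      then have "(\<integral>\<^sup>+z. ennreal (u1 z powr p) \<partial>\<mu>) < \<infinity>" by (rule le_less_trans) simp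
      then have near: "AE z in \<mu>. lam_potential u1 z < \<infinity>"
        and near_int: "(\<integral>\<^sup>+z. ennreal (enn2real (lam_potential u1 z) powr p) \<partial>\<mu>) \<le> ennreal A1 * (\<integral>\<^sup>+z. ennreal (u1 z powr p) \<partial>\<mu>)"
        using A1(2)[of u1] u10 by auto
      define H where "H = A2 * (F * \<phi> x r) powr (1 / p)"
      have H: "0 \<le> H" using A2 by (simp add: H_def)
      have far: "lam_potential u2 z \<le> ennreal H" if "z \<in> ball x r" for z
        unfolding u2_def[abs_def] H_def using that r by (intro A2(2) u0 F growth) auto
      have split: "lam_potential u z = lam_potential u1 z + lam_potential u2 z" for z
        unfolding u1_def[abs_def] u2_def[abs_def] by (intro lam_potential_split u0) auto
      have fin: "AE z in \<mu>. z \<in> ball x r \<longrightarrow> lam_potential u z < \<infinity>"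
        using near
      proof eventually_elim
        fix z assume "lam_potential u1 z < \<infinity>"
        then show "z \<in> ball x r \<longrightarrow> lam_potential u z < \<infinity>"
          using le_less_trans[OF far[of z], of \<infinity>] by (simp add: split)
      qed
      let ?l = "\<lambda>z. ennreal (enn2real (lam_potential u z) powr p) * indicator (ball x r) z"
      let ?r = "\<lambda>z. ennreal (2 powr p) * ennreal (enn2real (lam_potential u1 z) powr p) + ennreal (2 powr p * H powr p) * indicator (ball x r) z"
      have "(\<integral>\<^sup>+z. ?l z \<partial>\<mu>)
        \<le> (\<integral>\<^sup>+z. ?r z \<partial>\<mu>)"
      proof (rule nn_integral_mono_AE)
        show "AE z in \<mu>. ?l z
          \<le> ?r z"
          using near
        proof eventually_elim
          fix z assume n: "lam_potential u1 z < \<infinity>"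
          show "?l z
          \<le> ?r z"
          proof (cases "z \<in> ball x r")
            case True
            define a where "a = enn2real (lam_potential u1 z)"
            have a: "0 \<le> a" "lam_potential u1 z = ennreal a" using n by (auto simp: a_def)
            have "lam_potential u z \<le> ennreal (a + H)"
              using far[OF True] a H by (simp add: split add_left_mono)
            then have "enn2real (lam_potential u z) \<le> a + H" using a H by (intro enn2real_leI) auto
            also have "\<dots> \<le> 2 * max a H" by simp
            finally have "enn2real (lam_potential u z) powr p \<le> (2 * max a H) powr p" using p by (intro powr_mono2) auto
            also have "\<dots> = 2 powr p * (max a H) powr p" using a by (simp add: powr_mult)
            also have "\<dots> \<le> 2 powr p * (a powr p + H powr p)" by (intro mult_left_mono) (auto simp: max_def)
            finally have "ennreal (enn2real (lam_potential u z) powr p) \<le> ennreal (2 powr p * a powr p + 2 powr p * H powr p)"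
              by (simp add: ennreal_leI distrib_left del: ennreal_plus)
            also have "\<dots> = ennreal (2 powr p) * ennreal (a powr p) + ennreal (2 powr p * H powr p)"
              by (simp add: ennreal_mult')
            finally show ?thesis using True by (simp add: a_def)
          qed simp
        qed
      qed
      also have "\<dots> = ennreal (2 powr p) * (\<integral>\<^sup>+z. ennreal (enn2real (lam_potential u1 z) powr p) \<partial>\<mu>)
         + ennreal (2 powr p * H powr p) * emeasure \<mu> (ball x r)"
        by (simp add: nn_integral_add nn_integral_cmult nn_integral_cmult_indicator)
      also have "\<dots> \<le> ennreal (2 powr p) * (ennreal A1 * ennreal (C' * V)) + ennreal (2 powr p * H powr p) * ennreal m"
      proof (intro add_mono mult_left_mono order_trans[OF near_int] u1p)
        have "measure \<mu> (ball x r) \<le> m" unfolding m_def using r \<eta> by (intro measure_ball_mono subset_ball) auto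
        then show "emeasure \<mu> (ball x r) \<le> ennreal m" by (simp add: emeasure_ball ennreal_leI)
      qed auto
      also have "\<dots> = ennreal (2 powr p * (A1 * (C' * V)) + 2 powr p * H powr p * m)"
        using A1 C' V by (simp add: ennreal_mult' ennreal_plus m_def)
      also have "2 powr p * (A1 * (C' * V)) + 2 powr p * H powr p * m = A * V"
        using A2 F \<phi>0 p by (simp add: A_def H_def V_def powr_mult powr_powr distrib_left distrib_right mult_ac)
      finally show ?thesis using fin by (simp add: V_def m_def)
    qed
    have "AE z in \<mu>. lam_potential u z < \<infinity>"
    proof -
      fix c :: 'a
      have "AE z in \<mu>. z \<in> ball c (real (Suc n)) \<longrightarrow> lam_potential u z < \<infinity>" for n
        by (rule main[THEN conjunct1]) simp
      then have "AE z in \<mu>. \<forall>n. z \<in> ball c (real (Suc n)) \<longrightarrow> lam_potential u z < \<infinity>"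
        unfolding AE_all_countable by blast
      then show ?thesis
      proof eventually_elim
        fix z assume z: "\<forall>n. z \<in> ball c (real (Suc n)) \<longrightarrow> lam_potential u z < \<infinity>"
        obtain n where "dist c z < real n" using reals_Archimedean2 by blast
        then show "lam_potential u z < \<infinity>" using z[rule_format, of n] by simp
      qed
    qed
    moreover have "morrey_growth \<phi> \<eta> p (\<lambda>z. enn2real (lam_potential u z)) (A * F)"
      unfolding morrey_growth_def
    proof (intro allI impI)
      fix x and R :: real assume "0 < R"
      from main[OF this, THEN conjunct2]
      show "(\<integral>\<^sup>+z. ennreal (enn2real (lam_potential u z) powr p) * indicator (ball x R) z \<partial>\<mu>)
        \<le> ennreal (A * F * \<phi> x R * measure \<mu> (ball x (\<eta> * R)))"
        by (simp only: mult.assoc)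
    qed
    ultimately show ?case by (rule conjI)
  qed
qed

end

section \<open>The Marcinkiewicz integral\<close>

text \<open>The weight that a fixed point \<open>y\<close> at distance \<open>d\<close> receives
  when the truncations over all \<open>t \<ge> d\<close> are integrated.\<close>

lemma nn_integral_powr_tail:
  assumes "0 < a" "0 < d"
  shows "(\<integral>\<^sup>+t. ennreal (t powr (- a - 1)) * indicator {d..} t \<partial>lborel) = ennreal (d powr (- a) / a)"
proof -
  have "(\<integral>\<^sup>+t. ennreal (t powr (- a - 1)) * indicator {d..} t \<partial>lborel) = 0 - (- (d powr (- a) / a))"
  proof (rule nn_integral_FTC_atLeast)
    show "((\<lambda>t. - (t powr (- a) / a)) has_real_derivative t powr (- a - 1)) (at t)" if "d \<le> t" for t
      using that assms by (auto intro!: derivative_eq_intros simp: powr_diff)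
    have "((\<lambda>t::real. t powr (- a)) \<longlongrightarrow> 0) at_top" using assms by (intro tendsto_neg_powr filterlim_ident) auto
    then have "((\<lambda>t::real. - (t powr (- a) / a)) \<longlongrightarrow> - (0 / a)) at_top" using assms by (intro tendsto_intros) auto
    then show "((\<lambda>t::real. - (t powr (- a) / a)) \<longlongrightarrow> 0) at_top" by simp
  qed (auto simp: measurable_lborel1)
  then show ?thesis by simp
qed

context nonhomogeneous_space begin

text \<open>Local integrability gives measurability only on small boxes. Boxes about dense points
  with radii \<open>1 / Suc n\<close> are countable in number and those contained in such a box
  cover the complement of the diagonal; on the diagonal \<open>K\<close> is unspecified and replaced
  by 0.\<close>

lemma locally_integrable_off_diagonal_measurable:
  assumes K: "locally_integrable_off_diagonal \<mu> K"
  shows "(\<lambda>(x, y). if x = y then 0 else K x y) \<in> borel_measurable (\<mu> \<Otimes>\<^sub>M \<mu>)"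
proof -
  define bx where "bx = (\<lambda>(z, w, n::nat). ball z (1 / real (Suc n)) \<times> ball w (1 / real (Suc n)) :: ('a \<times> 'a) set)"
  define good where "good = {i \<in> dense_points \<times> dense_points \<times> UNIV.
     (\<lambda>p. indicator (bx i) p *\<^sub>R K (fst p) (snd p)) \<in> borel_measurable (\<mu> \<Otimes>\<^sub>M \<mu>) \<and> (\<forall>p\<in>bx i. fst p \<noteq> snd p)}"
  define diag where "diag = {p :: 'a \<times> 'a. dist (fst p) (snd p) = 0}"
  have bx_sets: "bx i \<in> sets (\<mu> \<Otimes>\<^sub>M \<mu>)" for i
    unfolding bx_def case_prod_beta' by (intro pair_measureI ball_sets)
  have cover: "p \<in> diag \<or> p \<in> \<Union> (bx ` good)" for p
  proof (cases "fst p = snd p")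
    case False
    define x y where "x = fst p" and "y = snd p"
    have "x \<noteq> y" using False by (simp add: x_def y_def)
    then obtain U V where UV: "open U" "open V" "x \<in> U" "y \<in> V" "U \<inter> V = {}"
      "set_integrable (\<mu> \<Otimes>\<^sub>M \<mu>) (U \<times> V) (\<lambda>(u, v). K u v)"
      using K unfolding locally_integrable_off_diagonal_def by metis
    obtain a where "0 < a" "ball x a \<subseteq> U" using UV(1,3) by (rule openE)
    moreover obtain b where "0 < b" "ball y b \<subseteq> V" using UV(2,4) by (rule openE)
    ultimately have ab: "0 < a" "ball x a \<subseteq> U" "0 < b" "ball y b \<subseteq> V" by simp_all
    obtain n where n: "1 / real (Suc n) < min a b / 2" using nat_approx_posE[of "min a b / 2"] ab by auto
    define q where "q = 1 / real (Suc n)"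
    have q: "0 < q" "2 * q < a" "2 * q < b" using n by (auto simp: q_def)
    obtain z where z: "z \<in> dense_points" "dist x z < q" using dense_pointsE[OF q(1)] by blast
    obtain w where w: "w \<in> dense_points" "dist y w < q" using dense_pointsE[OF q(1)] by blast
    have "ball z q \<subseteq> ball x a" "ball w q \<subseteq> ball y b"
    proof -
      have "dist x v < a" if "dist z v < q" for v using dist_triangle[of x v z] that z q by linarith
      then show "ball z q \<subseteq> ball x a" by auto
      have "dist y v < b" if "dist w v < q" for v using dist_triangle[of y v w] that w q by linarith
      then show "ball w q \<subseteq> ball y b" by auto
    qed
    then have sub: "bx (z, w, n) \<subseteq> U \<times> V" using ab by (auto simp: bx_def q_def)
    have "(\<lambda>p. indicator (U \<times> V) p *\<^sub>R K (fst p) (snd p)) \<in> borel_measurable (\<mu> \<Otimes>\<^sub>M \<mu>)"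
      using UV(6) borel_measurable_integrable unfolding set_integrable_def case_prod_beta' by blast
    note [measurable] = this bx_sets
    have "(\<lambda>p. indicator (bx (z, w, n)) p *\<^sub>R (indicator (U \<times> V) p *\<^sub>R K (fst p) (snd p))) \<in> borel_measurable (\<mu> \<Otimes>\<^sub>M \<mu>)"
      by measurable
    also have "(\<lambda>p. indicator (bx (z, w, n)) p *\<^sub>R (indicator (U \<times> V) p *\<^sub>R K (fst p) (snd p)))
       = (\<lambda>p. indicator (bx (z, w, n)) p *\<^sub>R K (fst p) (snd p))"
      using sub by (auto simp: fun_eq_iff indicator_def)
    finally have "(z, w, n) \<in> good" using z w sub UV(5) by (auto simp: good_def)
    moreover have "p \<in> bx (z, w, n)" using z w by (auto simp: bx_def q_def x_def y_def dist_commute mem_Times_iff)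
    ultimately show ?thesis by blast
  qed (simp add: diag_def)
  have "(\<lambda>p. if fst p = snd p then 0 else K (fst p) (snd p)) \<in> borel_measurable (\<mu> \<Otimes>\<^sub>M \<mu>)"
  proof (rule measurable_piecewise_restrict[of "insert diag (bx ` good)"])
    have "countable good"
      unfolding good_def by (rule countable_subset[of _ "dense_points \<times> dense_points \<times> UNIV"])
        (auto intro: countable_dense_points)
    then show "countable (insert diag (bx ` good))" by simp
    have "diag \<inter> space (\<mu> \<Otimes>\<^sub>M \<mu>) \<in> sets (\<mu> \<Otimes>\<^sub>M \<mu>)"
    proof -
      have "{p \<in> space (\<mu> \<Otimes>\<^sub>M \<mu>). dist (fst p) (snd p) = 0} \<in> sets (\<mu> \<Otimes>\<^sub>M \<mu>)" by measurable
      then show ?thesis by (simp add: diag_def Collect_conj_eq Int_commute)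
    qed
    then show "\<Omega> \<inter> space (\<mu> \<Otimes>\<^sub>M \<mu>) \<in> sets (\<mu> \<Otimes>\<^sub>M \<mu>)" if "\<Omega> \<in> insert diag (bx ` good)" for \<Omega>
      using that bx_sets by auto
    show "space (\<mu> \<Otimes>\<^sub>M \<mu>) \<subseteq> \<Union> (insert diag (bx ` good))" using cover by auto
    show "(\<lambda>p. if fst p = snd p then 0 else K (fst p) (snd p)) \<in> measurable (restrict_space (\<mu> \<Otimes>\<^sub>M \<mu>) \<Omega>) borel"
      if \<Omega>: "\<Omega> \<in> insert diag (bx ` good)" for \<Omega>
    proof -
      consider "\<Omega> = diag" | i where "i \<in> good" "\<Omega> = bx i" using \<Omega> by blast
      then show ?thesis
      proof cases
        case 1
        have "(\<lambda>p. 0) \<in> measurable (restrict_space (\<mu> \<Otimes>\<^sub>M \<mu>) \<Omega>) borel" by simp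
        then show ?thesis
          by (rule measurable_cong[THEN iffD1, rotated]) (auto simp: 1 space_restrict_space diag_def)
      next
        case 2
        have "(\<lambda>p. K (fst p) (snd p)) \<in> measurable (restrict_space (\<mu> \<Otimes>\<^sub>M \<mu>) \<Omega>) borel"
          using 2 bx_sets by (subst borel_measurable_restrict_space_iff) (auto simp: good_def)
        then show ?thesis
          by (rule measurable_cong[THEN iffD1, rotated]) (use 2 in \<open>auto simp: space_restrict_space good_def\<close>)
      qed
    qed
  qed
  then show ?thesis by (simp add: case_prod_beta')
qed

section \<open>Measurability and size of the Marcinkiewicz integral\<close>

lemma marcinkiewicz_integrand_measurable:
  assumes K: "locally_integrable_off_diagonal \<mu> K" and [measurable]: "f \<in> borel_measurable \<mu>"
  shows "(\<lambda>(x, y). marcinkiewicz_integrand \<rho> K f x y) \<in> borel_measurable (\<mu> \<Otimes>\<^sub>M \<mu>)"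
proof -
  have [measurable]: "(\<lambda>p. if fst p = snd p then 0 else K (fst p) (snd p)) \<in> borel_measurable (\<mu> \<Otimes>\<^sub>M \<mu>)"
    using locally_integrable_off_diagonal_measurable[OF K] by (simp add: case_prod_beta')
  have "(\<lambda>p. (if fst p = snd p then 0 else K (fst p) (snd p)) / complex_of_real (dist (fst p) (snd p) powr (1 - \<rho>)) * f (snd p))
     \<in> borel_measurable (\<mu> \<Otimes>\<^sub>M \<mu>)" by measurable
  also have "(\<lambda>p. (if fst p = snd p then 0 else K (fst p) (snd p)) / complex_of_real (dist (fst p) (snd p) powr (1 - \<rho>)) * f (snd p))
     = (\<lambda>(x, y). marcinkiewicz_integrand \<rho> K f x y)"
    \<comment> \<open>On the diagonal both sides are 0: \<open>0 powr (1 - \<rho>)\<close> is 0,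
      also for \<open>\<rho> = 1\<close>, and division by 0 yields 0.\<close>
    by (auto simp: fun_eq_iff marcinkiewicz_integrand_def)
  finally show ?thesis .
qed

lemma marcinkiewicz_inner_measurable:
  assumes K: "locally_integrable_off_diagonal \<mu> K" and f: "f \<in> borel_measurable \<mu>"
  shows "(\<lambda>(x, t). marcinkiewicz_inner \<mu> l \<rho> K f x t) \<in> borel_measurable (\<mu> \<Otimes>\<^sub>M lborel)"
proof -
  have integrand: "(\<lambda>p. marcinkiewicz_integrand \<rho> K f (fst p) (snd p)) \<in> borel_measurable (\<mu> \<Otimes>\<^sub>M \<mu>)"
    using marcinkiewicz_integrand_measurable[OF K f] by (simp add: case_prod_beta')
  have [measurable]: "(\<lambda>w. marcinkiewicz_integrand \<rho> K f (fst (fst w)) (snd w)) \<in> borel_measurable ((\<mu> \<Otimes>\<^sub>M lborel) \<Otimes>\<^sub>M \<mu>)"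
    using measurable_compose[of "\<lambda>w. (fst (fst w), snd w)" "(\<mu> \<Otimes>\<^sub>M lborel) \<Otimes>\<^sub>M \<mu>" "\<mu> \<Otimes>\<^sub>M \<mu>",
        OF _ integrand]
    by simp
  have "(\<lambda>(q, y). (if dist (fst q) y \<le> snd q then 1 else 0 :: real) *\<^sub>R marcinkiewicz_integrand \<rho> K f (fst q) y)
     \<in> borel_measurable ((\<mu> \<Otimes>\<^sub>M lborel) \<Otimes>\<^sub>M \<mu>)"
    unfolding case_prod_beta' by measurable
  from borel_measurable_lebesgue_integral[OF this]
  have [measurable]: "(\<lambda>q. LINT y|\<mu>. (if dist (fst q) y \<le> snd q then 1 else 0 :: real) *\<^sub>R marcinkiewicz_integrand \<rho> K f (fst q) y)
     \<in> borel_measurable (\<mu> \<Otimes>\<^sub>M lborel)" .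
  have "(\<lambda>q. complex_of_real (1 / snd q powr (l + \<rho>)) * (LINT y|\<mu>. (if dist (fst q) y \<le> snd q then 1 else 0 :: real) *\<^sub>R marcinkiewicz_integrand \<rho> K f (fst q) y))
     \<in> borel_measurable (\<mu> \<Otimes>\<^sub>M lborel)" by measurable
  then show ?thesis
    by (simp add: marcinkiewicz_inner_def set_lebesgue_integral_def indicator_def case_prod_beta')
qed

lemma marcinkiewicz_measurable:
  assumes K: "locally_integrable_off_diagonal \<mu> K" and f: "f \<in> borel_measurable \<mu>"
  shows "marcinkiewicz \<mu> l \<rho> s K f \<in> borel_measurable \<mu>"
proof -
  have [measurable]: "(\<lambda>q. marcinkiewicz_inner \<mu> l \<rho> K f (fst q) (snd q)) \<in> borel_measurable (\<mu> \<Otimes>\<^sub>M lborel)"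
    using marcinkiewicz_inner_measurable[OF K f] by (simp add: case_prod_beta')
  have "(\<lambda>(x, t). indicator {0<..} t *\<^sub>R (norm (marcinkiewicz_inner \<mu> l \<rho> K f x t) powr s / t)) \<in> borel_measurable (\<mu> \<Otimes>\<^sub>M lborel)"
    unfolding case_prod_beta' by measurable
  from sigma_finite_measure.borel_measurable_lebesgue_integral[OF sigma_finite_lborel this]
  show ?thesis unfolding marcinkiewicz_def[abs_def] set_lebesgue_integral_def by measurable
qed

text \<open>The powers of the distance combine to
  \<open>(1 + l) - (1 - \<rho>) = l + \<rho>\<close>, the exponent of the normalisation in
  \<open>t\<close>. Off the diagonal some cut-off lies below the distance, so the kernel bound
  applies.\<close>

lemma marcinkiewicz_integrand_le:
  assumes K: "\<And>x y. x \<noteq> y \<Longrightarrow> norm (K x y) \<le> B * (dist x y powr (1 + l) / lam x (dist x y))"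
    and B: "0 \<le> B"
  shows "ennreal (norm (marcinkiewicz_integrand \<rho> K f x y)) \<le>
    ennreal (B * C_lam\<^sup>2 * dist x y powr (l + \<rho>)) * ((SUP N. lam_kernel N x y) * ennreal (norm (f y)))"
proof (cases "x = y")
  case False
  define d where "d = dist x y"
  have d: "0 < d" using False by (simp add: d_def)
  have lp: "0 < lam x d" by (rule lam_pos[OF d])
  obtain N where N: "1 / 2 ^ N < d" using real_arch_pow_inv[OF d, of "1 / 2"] by (auto simp: power_one_over)
  have "ennreal (1 / lam x d) \<le> ennreal (C_lam\<^sup>2) * lam_kernel N x y"
    unfolding d_def using N by (intro lam_kernel_ge) (simp add: d_def)
  also have "\<dots> \<le> ennreal (C_lam\<^sup>2) * (SUP N. lam_kernel N x y)" by (intro mult_left_mono SUP_upper) auto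
  finally have k: "ennreal (1 / lam x d) \<le> ennreal (C_lam\<^sup>2) * (SUP N. lam_kernel N x y)" .
  have "norm (marcinkiewicz_integrand \<rho> K f x y) = norm (K x y) / d powr (1 - \<rho>) * norm (f y)"
    by (simp add: marcinkiewicz_integrand_def norm_mult norm_divide d_def)
  also have "\<dots> \<le> B * (d powr (1 + l) / lam x d) / d powr (1 - \<rho>) * norm (f y)"
    unfolding d_def using K[OF False] by (intro mult_right_mono divide_right_mono) auto
  also have "\<dots> = B * d powr (l + \<rho>) * (1 / lam x d) * norm (f y)"
  proof -
    have "d powr (1 + l) = d powr (l + \<rho>) * d powr (1 - \<rho>)" by (simp add: add.commute flip: powr_add)
    then show ?thesis using d by simp
  qed
  finally have "ennreal (norm (marcinkiewicz_integrand \<rho> K f x y)) \<le> ennreal (B * d powr (l + \<rho>) * (1 / lam x d) * norm (f y))"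
    by (rule ennreal_leI)
  also have "\<dots> = ennreal (B * d powr (l + \<rho>)) * ennreal (1 / lam x d) * ennreal (norm (f y))"
    using B lp by (simp flip: ennreal_mult)
  also have "\<dots> \<le> ennreal (B * d powr (l + \<rho>)) * (ennreal (C_lam\<^sup>2) * (SUP N. lam_kernel N x y)) * ennreal (norm (f y))"
    by (intro mult_right_mono mult_left_mono k) auto
  also have "\<dots> = ennreal (B * C_lam\<^sup>2 * dist x y powr (l + \<rho>)) * ((SUP N. lam_kernel N x y) * ennreal (norm (f y)))"
    using B by (simp add: d_def ennreal_mult mult_ac)
  finally show ?thesis .
qed (simp add: marcinkiewicz_integrand_def)

text \<open>The inner integral is bounded by a multiple of the potential, uniformly in \<open>t\<close>, and so
  is its integral with respect to \<open>dt / t\<close>; interpolating these two bounds gives all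
  exponents \<open>s \<ge> 1\<close> without Minkowski's integral inequality.\<close>

lemma marcinkiewicz_le_lam_potential:
  assumes K: "\<And>x y. x \<noteq> y \<Longrightarrow> norm (K x y) \<le> B * (dist x y powr (1 + l) / lam x (dist x y))"
    and Kloc: "locally_integrable_off_diagonal \<mu> K"
    and B: "0 \<le> B" and l: "0 \<le> l" and \<rho>: "0 < \<rho>" and s: "1 \<le> s"
    and f [measurable]: "f \<in> borel_measurable \<mu>"
    and fin: "lam_potential (\<lambda>y. norm (f y)) x < \<infinity>"
  shows "marcinkiewicz_converges \<mu> l \<rho> s K f x"
    and "marcinkiewicz \<mu> l \<rho> s K f x
      \<le> B * C_lam\<^sup>2 / (l + \<rho>) powr (1 / s) * enn2real (lam_potential (\<lambda>y. norm (f y)) x)"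
proof -
  interpret P: pair_sigma_finite \<mu> lborel
    by (intro pair_sigma_finite.intro sigma_finite_measure_axioms sigma_finite_lborel)
  define a where "a = l + \<rho>"
  have a: "0 < a" using l \<rho> by (simp add: a_def)
  define P where "P = enn2real (lam_potential (\<lambda>y. norm (f y)) x)"
  have P0: "0 \<le> P" by (simp add: P_def)
  have P: "lam_potential (\<lambda>y. norm (f y)) x = ennreal P" using fin by (simp add: P_def)
  define D where "D = B * C_lam\<^sup>2"
  have D: "0 \<le> D" using B by (simp add: D_def)
  define h where "h = marcinkiewicz_integrand \<rho> K f x"
  define inner where "inner = marcinkiewicz_inner \<mu> l \<rho> K f x"
  have "(\<lambda>p. marcinkiewicz_integrand \<rho> K f (fst p) (snd p)) \<in> borel_measurable (\<mu> \<Otimes>\<^sub>M \<mu>)"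
    using marcinkiewicz_integrand_measurable[OF Kloc f] by (simp add: case_prod_beta')
  from measurable_compose[OF measurable_Pair1' this, of x]
  have h_meas [measurable]: "h \<in> borel_measurable \<mu>" by (simp add: h_def space_mu)
  have "(\<lambda>p. marcinkiewicz_inner \<mu> l \<rho> K f (fst p) (snd p)) \<in> borel_measurable (\<mu> \<Otimes>\<^sub>M lborel)"
    using marcinkiewicz_inner_measurable[OF Kloc f] by (simp add: case_prod_beta')
  from measurable_compose[OF measurable_Pair1' this, of x]
  have inner_meas [measurable]: "inner \<in> borel_measurable lborel" by (simp add: inner_def space_mu)
  define k where "k y = (SUP N. lam_kernel N x y) * ennreal (norm (f y))" for y
  have [measurable]: "k \<in> borel_measurable \<mu>" unfolding k_def by measurable
  have k_int: "(\<integral>\<^sup>+y. k y \<partial>\<mu>) = ennreal P" using P by (simp add: lam_potential_def k_def)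
  have h_le: "ennreal (norm (h y)) \<le> ennreal (D * dist x y powr a) * k y" for y
    unfolding h_def k_def D_def a_def by (rule marcinkiewicz_integrand_le[OF K B])
  have h_diag: "h x = 0" by (simp add: h_def marcinkiewicz_integrand_def)
  have ball_sets': "{y. dist x y \<le> t} \<in> sets \<mu>" for t
    using measurable_sets[OF dist_measurable, of "{..t}" x] by (simp add: space_mu vimage_def)
  note [measurable] = ball_sets'
  let ?h = "\<lambda>t y. ennreal (norm (indicat_real {y. dist x y \<le> t} y *\<^sub>R h y))"
  let ?J = "\<lambda>t. \<integral>\<^sup>+y. ?h t y \<partial>\<mu>"
  let ?k = "\<lambda>t y. ennreal (t powr (- a - 1)) * indicator {0<..} t * (if dist x y \<le> t then ennreal (norm (h y)) else 0)"
  \<comment> \<open>On the domain of integration the distance is at most \<open>t\<close>, so its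
    power is bounded by \<open>t powr a\<close>, which the normalisation cancels. This gives the
    bound uniform in \<open>t\<close>.\<close>
  have trunc: "?J t \<le> ennreal (D * t powr a * P)" if t: "0 < t" for t
  proof -
    have "?J t \<le> (\<integral>\<^sup>+y. ennreal (D * t powr a) * k y \<partial>\<mu>)"
    proof (rule nn_integral_mono)
      fix y
      show "?h t y \<le> ennreal (D * t powr a) * k y"
      proof (cases "dist x y \<le> t")
        case True
        then have "D * dist x y powr a \<le> D * t powr a" using a D by (intro mult_left_mono powr_mono2) auto
        then have "ennreal (D * dist x y powr a) * k y \<le> ennreal (D * t powr a) * k y"
          by (intro mult_right_mono ennreal_leI) auto
        then show ?thesis using True order_trans[OF h_le] by simp
      qed simp
    qed
    also have "\<dots> = ennreal (D * t powr a) * ennreal P" by (simp add: nn_integral_cmult k_int)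
    finally show ?thesis using D P0 by (simp flip: ennreal_mult)
  qed
  have conv1: "set_integrable \<mu> {y. dist x y \<le> t} h" if t: "0 < t" for t
    unfolding set_integrable_def
  proof (rule integrableI_bounded)
    show "?J t < \<infinity>"
      using trunc[OF t] by (rule le_less_trans) simp
  qed measurable
  have norm_inner: "ennreal (norm (inner t)) \<le> ennreal (t powr (- a)) * ?J t"
    if t: "0 < t" for t
  proof -
    have "norm (inner t) = t powr (- a) * norm (LINT y|\<mu>. indicator {y. dist x y \<le> t} y *\<^sub>R h y)"
      using t by (simp add: inner_def marcinkiewicz_inner_def set_lebesgue_integral_def h_def norm_mult a_def[symmetric] powr_minus_divide norm_divide)
    also have "ennreal \<dots> = ennreal (t powr (- a)) * ennreal (norm (LINT y|\<mu>. indicator {y. dist x y \<le> t} y *\<^sub>R h y))"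
      by (simp add: ennreal_mult)
    also have "\<dots> \<le> ennreal (t powr (- a)) * ?J t"
      using conv1[OF t] unfolding set_integrable_def by (intro mult_left_mono integral_norm_bound_ennreal) auto
    finally show ?thesis .
  qed
  have inner_le: "norm (inner t) \<le> D * P" if t: "0 < t" for t
  proof -
    have "ennreal (norm (inner t)) \<le> ennreal (t powr (- a)) * ennreal (D * t powr a * P)"
      by (rule order_trans[OF norm_inner[OF t]]) (intro mult_left_mono trunc t, simp)
    also have "\<dots> = ennreal (t powr (- a) * (D * t powr a * P))" using D P0 by (simp add: ennreal_mult)
    also have "t powr (- a) * (D * t powr a * P) = D * P" using t by (simp add: powr_minus field_simps)
    finally show ?thesis using D P0 by simp
  qed
  \<comment> \<open>After exchanging the integrals, a point \<open>y\<close> collects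
    \<open>t powr (- a - 1)\<close> over all \<open>t\<close> above its distance \<open>d\<close>
    from \<open>x\<close>. This equals \<open>d powr (- a) / a\<close> and cancels the factor
    \<open>d powr a\<close> of the integrand.\<close>
  have inner_int: "(\<integral>\<^sup>+t. ennreal (norm (inner t) / t) * indicator {0<..} t \<partial>lborel) \<le> ennreal (D * P / a)"
  proof -
    have "(\<integral>\<^sup>+t. ennreal (norm (inner t) / t) * indicator {0<..} t \<partial>lborel)
      \<le> (\<integral>\<^sup>+t. (\<integral>\<^sup>+y. ?k t y \<partial>\<mu>) \<partial>lborel)"
    proof (rule nn_integral_mono)
      fix t :: real
      show "ennreal (norm (inner t) / t) * indicator {0<..} t
        \<le> (\<integral>\<^sup>+y. ?k t y \<partial>\<mu>)"
      proof (cases "0 < t")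
        case True
        have "ennreal (norm (inner t) / t) = ennreal (1 / t) * ennreal (norm (inner t))"
          using True by (simp flip: ennreal_mult)
        also have "\<dots> \<le> ennreal (1 / t) * (ennreal (t powr (- a)) * ?J t)"
          by (intro mult_left_mono norm_inner True) simp
        also have "\<dots> = ennreal (t powr (- a - 1)) * ?J t"
          using True by (simp add: mult.assoc[symmetric] powr_diff flip: ennreal_mult)
        also have "\<dots> = (\<integral>\<^sup>+y. ennreal (t powr (- a - 1)) * ?h t y \<partial>\<mu>)"
          by (rule nn_integral_cmult[symmetric]) measurable
        also have "\<dots> = (\<integral>\<^sup>+y. ?k t y \<partial>\<mu>)"
          using True by (intro nn_integral_cong) auto
        finally show ?thesis using True by simp
      qed simp
    qed
    also have "\<dots> = (\<integral>\<^sup>+y. (\<integral>\<^sup>+t. ?k t y \<partial>lborel) \<partial>\<mu>)"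
      by (rule P.Fubini') measurable
    also have "\<dots> \<le> (\<integral>\<^sup>+y. ennreal (D / a) * k y \<partial>\<mu>)"
    proof (rule nn_integral_mono)
      fix y
      show "(\<integral>\<^sup>+t. ?k t y \<partial>lborel) \<le> ennreal (D / a) * k y"
      proof (cases "x = y")
        \<comment> \<open>For \<open>y = x\<close> the integral in \<open>t\<close> would start at 0
          and diverge, but the integrand vanishes there.\<close>
        case True then show ?thesis using h_diag by (simp cong: if_cong)
      next
        case False
        then have d: "0 < dist x y" by simp
        have "(\<integral>\<^sup>+t. ?k t y \<partial>lborel)
          = (\<integral>\<^sup>+t. ennreal (norm (h y)) * (ennreal (t powr (- a - 1)) * indicator {dist x y..} t) \<partial>lborel)"
          using less_le_trans[OF d] by (intro nn_integral_cong) (auto simp: indicator_def mult_ac)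
        also have "\<dots> = ennreal (norm (h y)) * ennreal (dist x y powr (- a) / a)"
          using nn_integral_powr_tail[OF a d] by (subst nn_integral_cmult) auto
        also have "\<dots> \<le> ennreal (D * dist x y powr a) * k y * ennreal (dist x y powr (- a) / a)"
          by (intro mult_right_mono h_le) simp
        also have "\<dots> = (ennreal (D * dist x y powr a) * ennreal (dist x y powr (- a) / a)) * k y"
          by (simp only: mult_ac)
        also have "\<dots> = ennreal (D * dist x y powr a * (dist x y powr (- a) / a)) * k y"
          using D a by (subst ennreal_mult) auto
        also have "D * dist x y powr a * (dist x y powr (- a) / a) = D / a"
          using d by (simp add: powr_minus field_simps)
        finally show ?thesis .
      qed
    qed
    also have "\<dots> = ennreal (D * P / a)" using D P0 a by (simp add: nn_integral_cmult k_int flip: ennreal_mult)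
    finally show ?thesis .
  qed
  define H where "H = (D * P) powr (s - 1) * (D * P / a)"
  have total: "(\<integral>\<^sup>+t. ennreal (norm (indicator {0<..} t *\<^sub>R (norm (inner t) powr s / t))) \<partial>lborel) \<le> ennreal H"
  proof -
    have "(\<integral>\<^sup>+t. ennreal (norm (indicator {0<..} t *\<^sub>R (norm (inner t) powr s / t))) \<partial>lborel)
      \<le> (\<integral>\<^sup>+t. ennreal ((D * P) powr (s - 1)) * (ennreal (norm (inner t) / t) * indicator {0<..} t) \<partial>lborel)"
    proof (rule nn_integral_mono)
      fix t :: real
      show "ennreal (norm (indicator {0<..} t *\<^sub>R (norm (inner t) powr s / t)))
        \<le> ennreal ((D * P) powr (s - 1)) * (ennreal (norm (inner t) / t) * indicator {0<..} t)"
      proof (cases "0 < t")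
        case True
        have "norm (inner t) powr s = norm (inner t) powr (s - 1) * norm (inner t)"
          by (cases "inner t = 0") (auto simp: powr_diff)
        also have "\<dots> \<le> (D * P) powr (s - 1) * norm (inner t)"
          using s inner_le[OF True] by (intro mult_right_mono powr_mono2) auto
        finally have "norm (inner t) powr s / t \<le> (D * P) powr (s - 1) * (norm (inner t) / t)"
          using True by (simp add: divide_right_mono)
        then show ?thesis using True by (simp add: ennreal_leI flip: ennreal_mult)
      qed simp
    qed
    also have "\<dots> = ennreal ((D * P) powr (s - 1)) * (\<integral>\<^sup>+t. ennreal (norm (inner t) / t) * indicator {0<..} t \<partial>lborel)"
      by (rule nn_integral_cmult) measurable
    also have "\<dots> \<le> ennreal ((D * P) powr (s - 1)) * ennreal (D * P / a)" by (intro mult_left_mono inner_int) simp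
    also have "\<dots> = ennreal H" using D P0 a by (simp add: H_def flip: ennreal_mult)
    finally show ?thesis .
  qed
  have H0: "0 \<le> H" using D P0 a by (simp add: H_def)
  have int: "integrable lborel (\<lambda>t. indicat_real {0<..} t *\<^sub>R (norm (inner t) powr s / t))"
  proof (rule integrableI_bounded)
    show "(\<integral>\<^sup>+t. ennreal (norm (indicat_real {0<..} t *\<^sub>R (norm (inner t) powr s / t))) \<partial>lborel) < \<infinity>"
      using total by (rule le_less_trans) simp
  qed measurable
  show "marcinkiewicz_converges \<mu> l \<rho> s K f x"
    unfolding marcinkiewicz_converges_def using conv1 int by (auto simp: h_def inner_def set_integrable_def)
  have I0: "0 \<le> (LINT t:{0<..}|lborel. norm (inner t) powr s / t)"
    unfolding set_lebesgue_integral_def by (intro integral_nonneg_AE AE_I2) (auto simp: indicator_def)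
  have "ennreal (LINT t:{0<..}|lborel. norm (inner t) powr s / t)
    = (\<integral>\<^sup>+t. ennreal (indicat_real {0<..} t *\<^sub>R (norm (inner t) powr s / t)) \<partial>lborel)"
    unfolding set_lebesgue_integral_def
    by (rule nn_integral_eq_integral[symmetric, OF int]) (auto simp: indicator_def)
  also have "\<dots> \<le> (\<integral>\<^sup>+t. ennreal (norm (indicat_real {0<..} t *\<^sub>R (norm (inner t) powr s / t))) \<partial>lborel)"
    by (intro nn_integral_mono ennreal_leI) (metis abs_ge_self real_norm_def)
  also note total
  finally have I: "(LINT t:{0<..}|lborel. norm (inner t) powr s / t) \<le> H" using H0 by simp
  have "marcinkiewicz \<mu> l \<rho> s K f x = (LINT t:{0<..}|lborel. norm (inner t) powr s / t) powr (1 / s)"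
    by (simp add: marcinkiewicz_def inner_def)
  also have "\<dots> \<le> H powr (1 / s)" using I I0 s by (intro powr_mono2) auto
  also have "H = (D * P) powr s / a"
    using D P0 by (cases "D * P = 0") (auto simp: H_def powr_diff)
  also have "((D * P) powr s / a) powr (1 / s) = D * P / a powr (1 / s)"
    using D P0 a s by (simp add: powr_divide powr_powr)
  finally show "marcinkiewicz \<mu> l \<rho> s K f x
      \<le> B * C_lam\<^sup>2 / (l + \<rho>) powr (1 / s) * enn2real (lam_potential (\<lambda>y. norm (f y)) x)"
    by (simp add: D_def P_def a_def)
qed

end

theorem theorem4p1:
  fixes \<mu> :: "'a::metric_space measure"
    and lam :: "'a \<Rightarrow> real \<Rightarrow> real"
    and \<phi> :: "'a \<Rightarrow> real \<Rightarrow> real"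
    and \<theta> :: "real \<Rightarrow> real"
    and K :: "'a \<Rightarrow> 'a \<Rightarrow> complex"
    and p \<delta> \<sigma> \<eta> l \<rho> s :: real
  assumes "nonhomogeneous_space \<mu> lam"
    and "1 < p" and "0 < \<delta>" and "\<delta> < 1" and "1 < \<eta>"
    and "\<phi> \<in> G_dec \<mu> \<delta>"
    and "0 < \<sigma>" and "\<sigma> < \<delta> / p" and "weak_reverse_doubling \<sigma> lam"
    and "T_lam_bounded_L2 \<mu> lam"
    and "0 \<le> l" and "0 < \<rho>" and "1 \<le> s"
    and "log_dini \<theta>" and "theta_cz_kernel \<mu> lam l \<theta> K"
  shows "marcinkiewicz_bounded_on_morrey \<mu> \<phi> \<eta> p l \<rho> s K"
proof -
  interpret nonhomogeneous_space \<mu> lam by fact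
  note p = \<open>1 < p\<close> and \<eta> = \<open>1 < \<eta>\<close> and \<phi> = \<open>\<phi> \<in> G_dec \<mu> \<delta>\<close>
  obtain T C where T: "T_lam_L2 T C"
    using \<open>T_lam_bounded_L2 \<mu> lam\<close> unfolding T_lam_bounded_L2_def T_lam_L2_def by blast
  have Kloc: "locally_integrable_off_diagonal \<mu> K"
    and "\<exists>B>0. \<forall>x y. x \<noteq> y \<longrightarrow> norm (K x y) \<le> B * (dist x y powr (1 + l) / lam x (dist x y))"
    using \<open>theta_cz_kernel \<mu> lam l \<theta> K\<close> unfolding theta_cz_kernel_def by simp_all
  then obtain B where B: "0 < B" "\<And>x y. x \<noteq> y \<Longrightarrow> norm (K x y) \<le> B * (dist x y powr (1 + l) / lam x (dist x y))"
    by blast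
  obtain A where A: "0 \<le> A"
    "\<And>u F. u \<in> borel_measurable \<mu> \<Longrightarrow> (\<And>z. 0 \<le> u z) \<Longrightarrow> 0 \<le> F \<Longrightarrow>
      morrey_growth \<phi> \<eta> p u F \<Longrightarrow>
      (AE z in \<mu>. lam_potential u z < \<infinity>) \<and> morrey_growth \<phi> \<eta> p (\<lambda>z. enn2real (lam_potential u z)) (A * F)"
  proof (rule lam_potential_Morrey_bound[OF T \<phi> \<open>0 < \<delta>\<close> \<open>\<delta> < 1\<close> \<eta> p \<open>0 < \<sigma>\<close> \<open>\<sigma> < \<delta> / p\<close>
        \<open>weak_reverse_doubling \<sigma> lam\<close>], goal_cases)
    case (1 A)
    show ?case by (rule 1(1)[OF 1(2)]) (rule 1(3); assumption)
  qed
  define E where "E = B * C_lam\<^sup>2 / (l + \<rho>) powr (1 / s)"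
  have E: "0 \<le> E" using B by (simp add: E_def)
  have \<phi>0: "0 < \<phi> x r" if "0 < r" for x r by (rule G_dec_pos[OF \<phi> that])
  show ?thesis unfolding marcinkiewicz_bounded_on_morrey_def
  proof (intro exI[of _ "E * A powr (1 / p)"] ballI)
    fix f :: "'a \<Rightarrow> complex" assume f: "f \<in> morrey_space \<mu> \<phi> \<eta> p"
    define N where "N = morrey_norm \<mu> \<phi> \<eta> p f"
    have [measurable]: "f \<in> borel_measurable \<mu>"
      and f_int: "\<And>x r. 0 < r \<Longrightarrow> set_integrable \<mu> (ball x r) (\<lambda>y. norm (f y) powr p)"
      and f_bdd: "bdd_above ((\<lambda>(x, r). morrey_mean \<mu> \<phi> \<eta> p f x r) ` (UNIV \<times> {0<..}))"
      using f by (auto simp: morrey_space_def)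
    have mean_le: "morrey_mean \<mu> \<phi> \<eta> p f x r \<le> N" if "0 < r" for x r
      unfolding N_def morrey_norm_def using that
      by (intro cSUP_upper2[OF f_bdd, of "(x, r)"]) auto
    have N: "0 \<le> N" using mean_le[of 1] by (rule order_trans[rotated]) (auto simp: morrey_mean_def)
    define u where "u y = norm (f y)" for y
    have [measurable]: "u \<in> borel_measurable \<mu>" unfolding u_def by measurable
    have u0: "0 \<le> u z" for z by (simp add: u_def)
    have growth: "morrey_growth \<phi> \<eta> p u (N powr p)" unfolding morrey_growth_def
    proof (intro allI impI)
      fix x and R :: real assume R: "0 < R"
      show "(\<integral>\<^sup>+z. ennreal (u z powr p) * indicator (ball x R) z \<partial>\<mu>)
        \<le> ennreal (N powr p * \<phi> x R * measure \<mu> (ball x (\<eta> * R)))"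
      proof (cases "measure \<mu> (ball x (\<eta> * R)) = 0")
        \<comment> \<open>Division by 0 makes the Morrey mean of this ball 0, so the norm carries no
          information; the integral vanishes because the ball is null.\<close>
        case True
        have "measure \<mu> (ball x R) \<le> measure \<mu> (ball x (\<eta> * R))"
          using R \<eta> by (intro measure_ball_mono subset_ball) auto
        then have "emeasure \<mu> (ball x R) = 0" using True by (simp add: emeasure_ball measure_le_0_iff)
        then have "AE z in \<mu>. z \<notin> ball x R" by (intro AE_not_in) auto
        then have "AE z in \<mu>. ennreal (u z powr p) * indicator (ball x R) z = 0" by eventually_elim auto
        then have "(\<integral>\<^sup>+z. ennreal (u z powr p) * indicator (ball x R) z \<partial>\<mu>) = 0" by (subst nn_integral_0_iff_AE) auto
        then show ?thesis by simp
      next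
        case False
        then have m: "0 < measure \<mu> (ball x (\<eta> * R))" by (simp add: zero_less_measure_iff)
        define I where "I = (LINT y:ball x R|\<mu>. norm (f y) powr p)"
        have I0: "0 \<le> I" unfolding I_def set_lebesgue_integral_def by (intro integral_nonneg_AE AE_I2) auto
        have "(\<integral>\<^sup>+z. ennreal (u z powr p) * indicator (ball x R) z \<partial>\<mu>) = (\<integral>\<^sup>+z. ennreal (indicator (ball x R) z *\<^sub>R (norm (f z) powr p)) \<partial>\<mu>)"
          by (intro nn_integral_cong) (auto simp: u_def indicator_def)
        also have "\<dots> = ennreal I"
          unfolding I_def set_lebesgue_integral_def
          using f_int[OF R, of x] by (intro nn_integral_eq_integral) (auto simp: set_integrable_def)
        also have "\<dots> \<le> ennreal (N powr p * \<phi> x R * measure \<mu> (ball x (\<eta> * R)))"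
        proof (rule ennreal_leI)
          define q where "q = 1 / (\<phi> x R * measure \<mu> (ball x (\<eta> * R))) * I"
          have q0: "0 \<le> q" using I0 \<phi>0[OF R, of x] m by (simp add: q_def)
          have "q powr (1 / p) \<le> N" using mean_le[OF R, of x] by (simp add: morrey_mean_def I_def q_def)
          then have "(q powr (1 / p)) powr p \<le> N powr p" using p by (intro powr_mono2) auto
          then have "q \<le> N powr p" using q0 p by (simp add: powr_powr)
          then show "I \<le> N powr p * \<phi> x R * measure \<mu> (ball x (\<eta> * R))"
            using \<phi>0[OF R, of x] m by (simp add: q_def field_simps)
        qed
        finally show ?thesis .
      qed
    qed
    have fin: "AE z in \<mu>. lam_potential u z < \<infinity>"
      and pot: "morrey_growth \<phi> \<eta> p (\<lambda>z. enn2real (lam_potential u z)) (A * N powr p)"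
      using A(2)[OF \<open>u \<in> borel_measurable \<mu>\<close> u0 powr_ge_zero growth] by simp_all
    let ?g = "marcinkiewicz \<mu> l \<rho> s K f"
    have pointwise: "marcinkiewicz_converges \<mu> l \<rho> s K f x \<and> ?g x \<le> E * enn2real (lam_potential u x)"
      if "lam_potential u x < \<infinity>" for x
      using marcinkiewicz_le_lam_potential[OF B(2) Kloc _ \<open>0 \<le> l\<close> \<open>0 < \<rho>\<close> \<open>1 \<le> s\<close>, of f x] that B(1)
      by (simp add: E_def u_def[abs_def])
    have conv: "AE x in \<mu>. marcinkiewicz_converges \<mu> l \<rho> s K f x"
      using fin by eventually_elim (use pointwise in blast)
    have [measurable]: "?g \<in> borel_measurable \<mu>" by (rule marcinkiewicz_measurable[OF Kloc]) measurable
    have g0: "0 \<le> ?g x" for x by (simp add: marcinkiewicz_def)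
    define L where "L = E powr p * (A * N powr p)"
    have L: "0 \<le> L" using A by (simp add: L_def)
    let ?n = "\<lambda>x R z. ennreal (norm (indicat_real (ball x R) z *\<^sub>R (norm (?g z) powr p)))"
    let ?r = "\<lambda>x R z. ennreal (E powr p) * (ennreal (enn2real (lam_potential u z) powr p) * indicator (ball x R) z)"
    have g_bound: "(\<integral>\<^sup>+z. ?n x R z \<partial>\<mu>)
       \<le> ennreal (L * (\<phi> x R * measure \<mu> (ball x (\<eta> * R))))" if R: "0 < R" for x R
    proof -
      have "(\<integral>\<^sup>+z. ?n x R z \<partial>\<mu>)
        \<le> (\<integral>\<^sup>+z. ?r x R z \<partial>\<mu>)"
      proof (rule nn_integral_mono_AE)
        show "AE z in \<mu>. ?n x R z
          \<le> ?r x R z"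
          using fin
        proof eventually_elim
          fix z assume "lam_potential u z < \<infinity>"
          then have "?g z powr p \<le> (E * enn2real (lam_potential u z)) powr p"
            using pointwise[of z] g0 p by (intro powr_mono2) auto
          also have "\<dots> = E powr p * enn2real (lam_potential u z) powr p" using E by (simp add: powr_mult)
          finally show "?n x R z
            \<le> ?r x R z"
            using g0[of z] by (auto simp: indicator_def ennreal_leI simp flip: ennreal_mult)
        qed
      qed
      also have "\<dots> = ennreal (E powr p) * (\<integral>\<^sup>+z. ennreal (enn2real (lam_potential u z) powr p) * indicator (ball x R) z \<partial>\<mu>)"
        by (rule nn_integral_cmult) measurable
      also have "\<dots> \<le> ennreal (E powr p) * ennreal (A * N powr p * \<phi> x R * measure \<mu> (ball x (\<eta> * R)))"
        using pot R by (intro mult_left_mono) (auto simp: morrey_growth_def)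
      also have "\<dots> = ennreal (L * (\<phi> x R * measure \<mu> (ball x (\<eta> * R))))"
        using A \<phi>0[OF R, of x] by (simp add: L_def mult_ac flip: ennreal_mult')
      finally show ?thesis .
    qed
    have g_int: "set_integrable \<mu> (ball x r) (\<lambda>y. norm (?g y) powr p)" if "0 < r" for x r
      unfolding set_integrable_def
    proof (rule integrableI_bounded)
      show "(\<integral>\<^sup>+z. ennreal (norm (indicat_real (ball x r) z *\<^sub>R (norm (?g z) powr p))) \<partial>\<mu>) < \<infinity>"
        using g_bound[OF that] by (rule le_less_trans) simp
    qed measurable
    have g_mean: "morrey_mean \<mu> \<phi> \<eta> p ?g x r \<le> E * A powr (1 / p) * N" if r: "0 < r" for x r
    proof -
      define M where "M = \<phi> x r * measure \<mu> (ball x (\<eta> * r))"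
      have M: "0 \<le> M" using \<phi>0[OF r, of x] by (simp add: M_def)
      define I where "I = (LINT y:ball x r|\<mu>. norm (?g y) powr p)"
      have I0: "0 \<le> I" unfolding I_def set_lebesgue_integral_def by (intro integral_nonneg_AE AE_I2) auto
      have "ennreal I = (\<integral>\<^sup>+z. ennreal (indicator (ball x r) z *\<^sub>R (norm (?g z) powr p)) \<partial>\<mu>)"
        unfolding I_def set_lebesgue_integral_def
        using g_int[OF r, of x] by (intro nn_integral_eq_integral[symmetric]) (auto simp: set_integrable_def)
      also have "\<dots> \<le> ennreal (L * M)" using g_bound[OF r, of x] by (simp add: M_def)
      finally have IL: "I \<le> L * M" using L M by simp
      \<comment> \<open>If \<open>M\<close> is 0, the quotient is 0 by convention and the bound
        follows from \<open>0 \<le> L\<close>.\<close>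
      have "1 / M * I \<le> L"
        using IL M L by (cases "M = 0") (auto simp: field_simps)
      then have "morrey_mean \<mu> \<phi> \<eta> p ?g x r \<le> L powr (1 / p)"
        unfolding morrey_mean_def M_def[symmetric] I_def[symmetric]
        using I0 M p by (intro powr_mono2) auto
      also have "\<dots> = E * A powr (1 / p) * N"
        using E A N p by (simp add: L_def powr_mult powr_powr)
      finally show ?thesis .
    qed
    have "bdd_above ((\<lambda>(x, r). morrey_mean \<mu> \<phi> \<eta> p ?g x r) ` (UNIV \<times> {0<..}))"
      by (intro bdd_aboveI[of _ "E * A powr (1 / p) * N"]) (auto intro: g_mean)
    then have "?g \<in> morrey_space \<mu> \<phi> \<eta> p" using g_int by (auto simp: morrey_space_def)
    moreover have "morrey_norm \<mu> \<phi> \<eta> p ?g \<le> E * A powr (1 / p) * N"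
      unfolding morrey_norm_def
    proof (rule cSUP_least)
      show "(UNIV :: 'a set) \<times> {0::real<..} \<noteq> {}" by auto
    qed (auto intro: g_mean)
    ultimately show "(AE x in \<mu>. marcinkiewicz_converges \<mu> l \<rho> s K f x) \<and> ?g \<in> morrey_space \<mu> \<phi> \<eta> p \<and>
        morrey_norm \<mu> \<phi> \<eta> p ?g \<le> E * A powr (1 / p) * morrey_norm \<mu> \<phi> \<eta> p f"
      using conv by (simp add: N_def)
  qed
qed

end
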